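(* Let $\varphi$ be a Schwartz function on $\mathbb{R}$ and let $\psi(s):=\varphi(s)-2\varphi(2s)$. For any $F,G\in\mathrm{L}^4(\mathbb{R}^2)$ we have $$\|S(F,G)\|_{\mathrm{L}^2(\mathbb{R}^2)} \leq C_\psi \|F\|_{\mathrm{L}^4(\mathbb{R}^2)} \|G\|_{\mathrm{L}^4(\mathbb{R}^2)},$$ with a finite constant $C_\psi$ depending on $\psi$ alone, where $$S(F,G)(x,y) := \bigg( \sum_{j\in\mathbb{Z}} \Big| \int_{\mathbb{R}} F(x+s,y) \,G(x,y+s) \,2^{-j} \psi(2^{-j}s) \,ds \Big|^2 \bigg)^{1/2}.$$
   Context: Functions are complex-valued. *)

theory Defs
  imports "HOL-Analysis.Analysis"
begin

definition iterated_deriv :: "nat \<Rightarrow> (real \<Rightarrow> complex) \<Rightarrow> real \<Rightarrow> complex" where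
  "iterated_deriv n f = ((\<lambda>g x. vector_derivative g (at x)) ^^ n) f"

definition schwartz :: "(real \<Rightarrow> complex) \<Rightarrow> bool" where
  "schwartz f \<longleftrightarrow>
     (\<forall>n x. iterated_deriv n f differentiable (at x)) \<and>
     (\<forall>k n. bounded (range (\<lambda>x. x ^ k *\<^sub>R iterated_deriv n f x)))"

text \<open>Functions rather than almost-everywhere classes, for finite exponents \<open>p > 0\<close>.
  The real-valued \<open>Lp_norm\<close> is meaningful only on \<open>Lp_space\<close>, since the
  Bochner integral of a non-integrable function is \<open>0\<close>.\<close>

definition Lp_space :: "real \<Rightarrow> 'a measure \<Rightarrow> ('a \<Rightarrow> 'b::real_normed_vector) set" where
  "Lp_space p M = {f \<in> borel_measurable M. integrable M (\<lambda>x. norm (f x) powr p)}"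

definition Lp_norm :: "real \<Rightarrow> 'a measure \<Rightarrow> ('a \<Rightarrow> 'b::real_normed_vector) \<Rightarrow> real" where
  "Lp_norm p M f = (LINT x|M. norm (f x) powr p) powr (1 / p)"

definition S_integrand ::
  "(real \<Rightarrow> complex) \<Rightarrow> (real \<times> real \<Rightarrow> complex) \<Rightarrow> (real \<times> real \<Rightarrow> complex)
    \<Rightarrow> int \<Rightarrow> real \<times> real \<Rightarrow> real \<Rightarrow> complex" where
  "S_integrand \<psi> F G j = (\<lambda>(x, y) s.
     F (x + s, y) * G (x, y + s) * of_real (2 powi (- j)) * \<psi> (2 powi (- j) * s))"

text \<open>The inner integral is over \<open>lebesgue\<close>, not \<open>lborel\<close>: almost every line section of a
  Lebesgue measurable function on the plane is Lebesgue measurable, but it need not be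
  Borel measurable.\<close>

definition S_term ::
  "(real \<Rightarrow> complex) \<Rightarrow> (real \<times> real \<Rightarrow> complex) \<Rightarrow> (real \<times> real \<Rightarrow> complex)
    \<Rightarrow> int \<Rightarrow> real \<times> real \<Rightarrow> complex" where
  "S_term \<psi> F G j z = (LINT s|lebesgue. S_integrand \<psi> F G j z s)"

definition S ::
  "(real \<Rightarrow> complex) \<Rightarrow> (real \<times> real \<Rightarrow> complex) \<Rightarrow> (real \<times> real \<Rightarrow> complex)
    \<Rightarrow> real \<times> real \<Rightarrow> real" where
  "S \<psi> F G z = sqrt (\<Sum>\<^sub>\<infinity>j\<in>UNIV. (cmod (S_term \<psi> F G j z))\<^sup>2)"

text \<open>Pointwise well-definedness of \<open>S\<close>: where it fails, \<open>S\<close> contains a default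
  value \<open>0\<close> of the integral or of the infinite sum.\<close>

definition S_converges ::
  "(real \<Rightarrow> complex) \<Rightarrow> (real \<times> real \<Rightarrow> complex) \<Rightarrow> (real \<times> real \<Rightarrow> complex)
    \<Rightarrow> real \<times> real \<Rightarrow> bool" where
  "S_converges \<psi> F G z \<longleftrightarrow>
     (\<forall>j. integrable lebesgue (S_integrand \<psi> F G j z)) \<and>
     (\<lambda>j. (cmod (S_term \<psi> F G j z))\<^sup>2) summable_on UNIV"

end

theory Submission
  imports Defs "HOL-Real_Asymp.Real_Asymp"
begin

text \<open>
  Write \<open>k\<^sub>t(v) = k(v/t)/t\<close> for the \<open>L\<^sup>1\<close>-normalised dilation of a kernel.  The substitution
  \<open>z = x + y + s\<close> turns the inner integral at scale \<open>t\<close> into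
  \<open>\<integral> f(z,y) g(z,x) \<psi>\<^sub>t(z-x-y) dz\<close> with \<open>f(z,y) = F(z-y,y)\<close> and \<open>g(z,x) = G(x,z-x)\<close>.  Squaring and
  integrating in \<open>(x,y)\<close> produces the product \<open>f(z,y) f(z',y) g(z,x) g(z',x)\<close>, whose factors sit on the
  edges of the four-cycle \<open>z - y - z' - x\<close>.  Against an integrable kernel such a product is controlled
  by the fourth powers of \<open>f\<close> and \<open>g\<close> (\<open>four_cycle_Hoelder\<close>), but summing over all scales needs
  cancellation, and the only source of it is that total derivatives in the scale telescope
  (\<open>telescoping_cyc\<close>).

  From dyadic to continuous scales.  Since \<open>\<psi>\<^sub>t = \<phi>\<^sub>t - \<phi>\<^bsub>t/2\<^esub>\<close> and \<open>- t d\<phi>\<^sub>t/dt = \<zeta>\<^sub>t\<close> for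
  \<open>\<zeta> = (v \<phi>)'\<close>, the Cauchy--Schwarz inequality bounds the sum over the scales \<open>2\<^sup>j\<close> by the integral
  against \<open>dt/t\<close> of the same expression with \<open>\<zeta>\<close> in place of \<open>\<psi>\<close> (\<open>avg_difference_square\<close>).
  By linearity \<open>F\<close>, \<open>G\<close> and \<open>\<phi>\<close> may be taken real and \<open>\<phi>\<close> even or odd.

  Splitting the kernel.  The kernel \<open>\<zeta>\<^sub>t(z-x-y) \<zeta>\<^sub>t(z'-x-y)\<close> is a function of
  \<open>m = (z+z')/2 - x - y\<close> and \<open>d = z - z'\<close>.  Integrating out \<open>m\<close> leaves the autocorrelation \<open>q\<close> of \<open>\<zeta>\<close>
  in \<open>d\<close>, and \<open>q\<close> is a derivative in scale: \<open>q = (d Q)'\<close> with integrable \<open>Q\<close>, because \<open>\<zeta>\<close> is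
  itself a derivative.  For an even probability density \<open>\<kappa>\<close> and \<open>\<xi> = (m \<kappa>)'\<close>, the expression
  \<open>q\<^sub>t(d) \<kappa>\<^sub>t(m) + Q\<^sub>t(d) \<xi>\<^sub>t(m)\<close> is \<open>-t d/dt\<close> of \<open>Q\<^sub>t(d) \<kappa>\<^sub>t(m)\<close> and so contributes only boundary terms.
  What remains has vanishing integral in \<open>m\<close>; it is even in \<open>m\<close>, so its first moment vanishes too, and its
  second antiderivative decays.  Hence it is a convolution \<open>V * r\<close> in \<open>m\<close> with
  \<open>r(v) = (1-|v|) e\<^bsup>-|v|\<^esup>\<close> (\<open>mean_zero_even_representation\<close>, \<open>kernel_decomposition\<close>).

  Separating the functions.  The kernel \<open>r(x-x')\<close> is positive semidefinite, and convolution with \<open>V\<close> merely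
  averages over translations, which such forms do not see.  The Cauchy--Schwarz inequality for
  semidefinite forms therefore splits the remainder into one term for \<open>f\<close> and one for \<open>g\<close>
  (\<open>quad_convolution_bound\<close>).  The term for \<open>g\<close> carries the kernel \<open>w\<^sub>t(z-z') r\<^sub>t(x-x')\<close> with
  \<open>w(v) = 1/(1+|v|)\<^sup>2\<close>.  As \<open>r = (v E)'\<close> for \<open>E(v) = e\<^bsup>-|v|\<^esup>\<close>, it is one of the two terms of the scale
  derivative of \<open>w\<^sub>t(z-z') E\<^sub>t(x-x')\<close>; the other one is nonnegative because \<open>(v w)'\<close> is positive
  semidefinite as well.  Telescoping once more gives \<open>one_function_estimate\<close>.

  This bounds the square of the \<open>L\<^sup>2\<close> norm by a multiple of the sum of the fourth powers of the
  \<open>L\<^sup>4\<close> norms.  Replacing \<open>F\<close> and \<open>G\<close> by \<open>\<lambda> F\<close> and \<open>G/\<lambda>\<close> does not change the left-hand side, and the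
  best \<open>\<lambda>\<close> gives the product of the norms.
\<close>

section \<open>Integration on products and on half-lines\<close>

lemma nn_integral_lborel_pair:
  fixes f :: "'a::euclidean_space \<times> 'b::euclidean_space \<Rightarrow> ennreal"
  assumes [measurable]: "f \<in> borel_measurable borel"
  shows nn_integral_lborel_fst: "(\<integral>\<^sup>+x. \<integral>\<^sup>+y. f (x, y) \<partial>lborel \<partial>lborel) = (\<integral>\<^sup>+p. f p \<partial>lborel)"
    and nn_integral_lborel_snd: "(\<integral>\<^sup>+y. \<integral>\<^sup>+x. f (x, y) \<partial>lborel \<partial>lborel) = (\<integral>\<^sup>+p. f p \<partial>lborel)"
proof -
  have "f \<in> borel_measurable (lborel \<Otimes>\<^sub>M lborel)"
    by (simp add: lborel_prod)
  from lborel.nn_integral_fst[OF this] lborel_pair.nn_integral_snd[OF this]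
  show "(\<integral>\<^sup>+x. \<integral>\<^sup>+y. f (x, y) \<partial>lborel \<partial>lborel) = (\<integral>\<^sup>+p. f p \<partial>lborel)"
    "(\<integral>\<^sup>+y. \<integral>\<^sup>+x. f (x, y) \<partial>lborel \<partial>lborel) = (\<integral>\<^sup>+p. f p \<partial>lborel)"
    by (simp_all add: lborel_prod)
qed

lemma nn_integral_lborel_swap:
  fixes f :: "'a::euclidean_space \<Rightarrow> 'b::euclidean_space \<Rightarrow> ennreal"
  assumes "case_prod f \<in> borel_measurable borel"
  shows "(\<integral>\<^sup>+x. \<integral>\<^sup>+y. f x y \<partial>lborel \<partial>lborel) = (\<integral>\<^sup>+y. \<integral>\<^sup>+x. f x y \<partial>lborel \<partial>lborel)"
  using nn_integral_lborel_pair[OF assms] by simp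

lemma integrable_lborel_pair:
  fixes f :: "'a::euclidean_space \<times> 'b::euclidean_space \<Rightarrow> real"
  assumes "integrable lborel f"
  shows AE_integrable_lborel_fst: "AE x in lborel. integrable lborel (\<lambda>y. f (x, y))"
    and integrable_lborel_fst: "integrable lborel (\<lambda>x. \<integral>y. f (x, y) \<partial>lborel)"
    and integral_lborel_fst: "(\<integral>x. \<integral>y. f (x, y) \<partial>lborel \<partial>lborel) = (\<integral>p. f p \<partial>lborel)"
    and AE_integrable_lborel_snd: "AE y in lborel. integrable lborel (\<lambda>x. f (x, y))"
    and integrable_lborel_snd: "integrable lborel (\<lambda>y. \<integral>x. f (x, y) \<partial>lborel)"
    and integral_lborel_snd: "(\<integral>y. \<integral>x. f (x, y) \<partial>lborel \<partial>lborel) = (\<integral>p. f p \<partial>lborel)"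
proof -
  have i: "integrable (lborel \<Otimes>\<^sub>M lborel) f"
    using assms by (simp add: lborel_prod)
  have i': "integrable (lborel \<Otimes>\<^sub>M lborel) (\<lambda>(x, y). f (x, y))"
    using i by simp
  show "AE x in lborel. integrable lborel (\<lambda>y. f (x, y))"
    by (rule lborel_pair.AE_integrable_fst'[OF i])
  show "integrable lborel (\<lambda>x. \<integral>y. f (x, y) \<partial>lborel)"
    by (rule lborel_pair.integrable_fst'[OF i])
  show "(\<integral>x. \<integral>y. f (x, y) \<partial>lborel \<partial>lborel) = (\<integral>p. f p \<partial>lborel)"
    using lborel_pair.integral_fst'[OF i] by (simp add: lborel_prod)
  show "AE y in lborel. integrable lborel (\<lambda>x. f (x, y))"
    by (rule lborel_pair.AE_integrable_snd[OF i'])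
  show "integrable lborel (\<lambda>y. \<integral>x. f (x, y) \<partial>lborel)"
    by (rule lborel_pair.integrable_snd[OF i'])
  show "(\<integral>y. \<integral>x. f (x, y) \<partial>lborel \<partial>lborel) = (\<integral>p. f p \<partial>lborel)"
    using lborel_pair.integral_snd[OF i'] by (simp add: lborel_prod)
qed

lemma integral_FTC_at_top:
  fixes F f :: "real \<Rightarrow> real"
  assumes F: "\<And>v. 0 \<le> v \<Longrightarrow> (F has_real_derivative f v) (at v)"
    and cont: "\<And>v. 0 \<le> v \<Longrightarrow> isCont f v"
    and int: "integrable lborel (\<lambda>v. indicator {0..} v * f v)"
    and lim: "(F \<longlongrightarrow> L) at_top"
  shows "(\<integral>v. indicator {0..} v * f v \<partial>lborel) = L - F 0"
proof -
  let ?g = "\<lambda>v. indicator {0..} v * f v"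
  have 1: "((\<lambda>y. \<integral>x. indicator {..y} x *\<^sub>R ?g x \<partial>lborel) \<longlongrightarrow> (\<integral>x. ?g x \<partial>lborel)) at_top"
    by (rule tendsto_integral_at_top[OF _ int]) simp
  have eq: "(\<integral>x. indicator {..y} x *\<^sub>R ?g x \<partial>lborel) = F y - F 0" if "0 \<le> y" for y
  proof -
    have "(\<integral>x. indicator {..y} x *\<^sub>R ?g x \<partial>lborel) = (\<integral>x. f x * indicator {0..y} x \<partial>lborel)"
      by (rule Bochner_Integration.integral_cong) (auto simp: indicator_def)
    also have "\<dots> = F y - F 0"
      by (rule integral_FTC_Icc_real[OF that]) (use F cont in auto)
    finally show ?thesis .
  qed
  have "((\<lambda>y. F y - F 0) \<longlongrightarrow> (\<integral>x. ?g x \<partial>lborel)) at_top"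
    by (rule Lim_transform_eventually[OF 1])
      (use eq in \<open>auto intro!: eventually_mono[OF eventually_ge_at_top[of 0]]\<close>)
  moreover have "((\<lambda>y. F y - F 0) \<longlongrightarrow> L - F 0) at_top"
    by (intro tendsto_intros lim)
  ultimately show ?thesis
    using tendsto_unique trivial_limit_at_top_linorder by blast
qed

lemma integral_reflect:
  fixes f :: "real \<Rightarrow> real"
  shows "(\<integral>x. f (c - x) \<partial>lborel) = (\<integral>x. f x \<partial>lborel)"
    and "integrable lborel (\<lambda>x. f (c - x)) \<longleftrightarrow> integrable lborel f"
  using lborel_integral_real_affine[of "-1" f c] lborel_integrable_real_affine_iff[of "-1" f c]
  by simp_all

lemma integral_split_reflect:
  fixes f :: "real \<Rightarrow> real"
  assumes int: "integrable lborel f"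
  shows "(\<integral>x. f x \<partial>lborel) = (\<integral>x. indicator {0..} x * f x \<partial>lborel) + (\<integral>x. indicator {0..} x * f (-x) \<partial>lborel)"
proof -
  have i1: "integrable lborel (\<lambda>x. indicator {0..} x * f x)"
    using integrable_mult_indicator[of "{0..}", OF _ int] by simp
  have i2: "integrable lborel (\<lambda>x. indicator {..<0} x * f x)"
    using integrable_mult_indicator[of "{..<0}", OF _ int] by simp
  have "(\<integral>x. f x \<partial>lborel) = (\<integral>x. (indicator {0..} x * f x + indicator {..<0} x * f x) \<partial>lborel)"
    by (rule Bochner_Integration.integral_cong) (auto simp: indicator_def)
  also have "\<dots> = (\<integral>x. indicator {0..} x * f x \<partial>lborel) + (\<integral>x. indicator {..<0} x * f x \<partial>lborel)"
    using i1 i2 by simp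
  also have "(\<integral>x. indicator {..<0} x * f x \<partial>lborel) = (\<integral>x. indicator {..<0} (0 - x) * f (0 - x) \<partial>lborel)"
    by (rule integral_reflect(1)[symmetric])
  also have "\<dots> = (\<integral>x. indicator {0..} x * f (-x) \<partial>lborel)"
    using AE_lborel_singleton[of "0::real"]
    by (intro integral_cong_AE)
      (use borel_measurable_integrable[OF int] in \<open>auto simp: indicator_def\<close>)
  finally show ?thesis .
qed

lemma integral_FTC_real_line:
  fixes F f :: "real \<Rightarrow> real"
  assumes F: "\<And>v. (F has_real_derivative f v) (at v)"
    and cont: "\<And>v. isCont f v"
    and int: "integrable lborel f"
    and lim: "(F \<longlongrightarrow> L) at_top" "((\<lambda>v. F (-v)) \<longlongrightarrow> L') at_top"
  shows "(\<integral>v. f v \<partial>lborel) = L - L'"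
proof -
  have i1: "integrable lborel (\<lambda>x. indicator {0..} x * f x)"
    using integrable_mult_indicator[of "{0..}", OF _ int] by simp
  have int': "integrable lborel (\<lambda>x. f (-x))"
    using integral_reflect(2)[of f 0] int by simp
  have i2: "integrable lborel (\<lambda>x. indicator {0..} x * f (-x))"
    using integrable_mult_indicator[of "{0..}", OF _ int'] by simp
  have a: "(\<integral>v. indicator {0..} v * f v \<partial>lborel) = L - F 0"
    by (rule integral_FTC_at_top) (use assms i1 in auto)
  have "(\<integral>v. indicator {0..} v * f (-v) \<partial>lborel) = - L' - (- F (-0))"
  proof (rule integral_FTC_at_top[OF _ _ i2])
    show "((\<lambda>v. - F (-v)) has_real_derivative f (-v)) (at v)" for v
    proof -
      have "((\<lambda>v. F (-v)) has_real_derivative f (-v) * (-1)) (at v)"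
        by (rule DERIV_chain2[OF F]) (auto intro!: derivative_eq_intros)
      from DERIV_minus[OF this] show ?thesis by simp
    qed
    show "isCont (\<lambda>v. f (-v)) v" for v
      by (rule isCont_o2[of _ uminus]) (use cont in auto)
    show "((\<lambda>v. - F (-v)) \<longlongrightarrow> - L') at_top"
      by (intro tendsto_intros lim)
  qed
  then show ?thesis
    using integral_split_reflect[OF int] a by simp
qed

section \<open>Dilations\<close>

definition dil :: "real \<Rightarrow> (real \<Rightarrow> real) \<Rightarrow> real \<Rightarrow> real" where
  "dil t k v = k (v / t) / t"

lemma measurable_dil [measurable]:
  assumes [measurable]: "k \<in> borel_measurable borel" "f \<in> borel_measurable M" "g \<in> borel_measurable M"
  shows "(\<lambda>x. dil (f x) k (g x)) \<in> borel_measurable M"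
  unfolding dil_def by measurable

text \<open>The factor \<open>1/t\<close> in the dilation makes the total mass independent of \<open>t\<close>; the sign \<open>s\<close> also
  covers the reflections that occur when one variable of the four-cycle is integrated out.\<close>

lemma nn_integral_dil:
  fixes k :: "real \<Rightarrow> real"
  assumes [measurable]: "k \<in> borel_measurable borel" and "0 < t" "\<bar>s\<bar> = 1"
  shows "(\<integral>\<^sup>+v. ennreal (dil t k (c + s * v)) \<partial>lborel) = (\<integral>\<^sup>+v. ennreal (k v) \<partial>lborel)"
proof -
  have "(\<integral>\<^sup>+v. ennreal (k v) \<partial>lborel) = ennreal \<bar>s / t\<bar> * (\<integral>\<^sup>+v. ennreal (k (c / t + s / t * v)) \<partial>lborel)"
    by (rule nn_integral_real_affine) (use assms in auto)
  also have "\<dots> = (\<integral>\<^sup>+v. ennreal \<bar>s / t\<bar> * ennreal (k (c / t + s / t * v)) \<partial>lborel)"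
    by (rule nn_integral_cmult[symmetric]) simp
  also have "\<dots> = (\<integral>\<^sup>+v. ennreal (dil t k (c + s * v)) \<partial>lborel)"
    using assms by (intro nn_integral_cong)
      (simp add: dil_def ennreal_mult'[symmetric] add_divide_distrib)
  finally show ?thesis by simp
qed

text \<open>The weight that dominates every kernel below.  Its slow decay is deliberate: it is a superposition of
  the functions \<open>e\<^bsup>-a|v|\<^esup>\<close>, which is what makes \<open>tkern\<close> positive semidefinite.\<close>

definition tail :: "real \<Rightarrow> real" where
  "tail v = 1 / (1 + \<bar>v\<bar>)\<^sup>2"

lemma measurable_tail [measurable]: "tail \<in> borel_measurable borel"
  unfolding tail_def by measurable

lemma tail_pos [simp]: "0 < tail v" and tail_nonneg [simp]: "0 \<le> tail v"
  by (auto simp: tail_def intro!: zero_less_power)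

lemma tail_le_one: "tail v \<le> 1"
  by (simp add: tail_def)

lemma tail_minus [simp]: "tail (- v) = tail v"
  by (simp add: tail_def)

lemma nn_integral_tail: "(\<integral>\<^sup>+v. ennreal (tail v) \<partial>lborel) = 2"
proof -
  have half: "(\<integral>\<^sup>+v. ennreal (tail v) * indicator {0..} v \<partial>lborel) = ennreal (0 - (- 1 / (1 + 0)))"
  proof -
    have "(\<integral>\<^sup>+v. ennreal (tail v) * indicator {0..} v \<partial>lborel)
      = (\<integral>\<^sup>+v. ennreal (1 / (1 + v)^2) * indicator {0..} v \<partial>lborel)"
      by (rule nn_integral_cong) (auto simp: tail_def indicator_def)
    also have "\<dots> = ennreal (0 - (- 1 / (1 + 0)))"
    proof (rule nn_integral_FTC_atLeast)
      show "((\<lambda>x. - 1 / (1 + x)) has_real_derivative 1 / (1 + x)^2) (at x)" if "0 \<le> x" for x :: real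
        using that by (auto intro!: derivative_eq_intros simp: power2_eq_square)
      show "((\<lambda>x::real. - 1 / (1 + x)) \<longlongrightarrow> 0) at_top"
        by real_asymp
    qed auto
    finally show ?thesis .
  qed
  have refl: "(\<integral>\<^sup>+v. ennreal (tail v) * indicator {..<0} v \<partial>lborel)
      = (\<integral>\<^sup>+v. ennreal (tail v) * indicator {0..} v \<partial>lborel)"
  proof -
    have "(\<integral>\<^sup>+v. ennreal (tail v) * indicator {..<0} v \<partial>lborel)
      = ennreal \<bar>- 1\<bar> * (\<integral>\<^sup>+v. ennreal (tail (0 + (- 1) * v)) * indicator {..<0} (0 + (- 1) * v) \<partial>lborel)"
      by (rule nn_integral_real_affine) auto
    also have "\<dots> = (\<integral>\<^sup>+v. ennreal (tail v) * indicator {0..} v \<partial>lborel)"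
      using AE_lborel_singleton[of "0::real"]
      by (simp, intro nn_integral_cong_AE) (auto simp: indicator_def)
    finally show ?thesis .
  qed
  have "(\<integral>\<^sup>+v. ennreal (tail v) \<partial>lborel)
    = (\<integral>\<^sup>+v. ennreal (tail v) * indicator {0..} v + ennreal (tail v) * indicator {..<0} v \<partial>lborel)"
    by (rule nn_integral_cong) (auto simp: indicator_def)
  also have "\<dots> = (\<integral>\<^sup>+v. ennreal (tail v) * indicator {0..} v \<partial>lborel)
     + (\<integral>\<^sup>+v. ennreal (tail v) * indicator {..<0} v \<partial>lborel)"
    by (rule nn_integral_add) auto
  also have "\<dots> = 2"
    unfolding refl half by (simp add: one_add_one[symmetric] del: one_add_one)
  finally show ?thesis .
qed

lemma nn_integral_dil_tail:
  assumes "0 < t" "\<bar>s\<bar> = 1"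
  shows "(\<integral>\<^sup>+v. ennreal (dil t tail (c + s * v)) \<partial>lborel) = 2"
  using nn_integral_dil[OF measurable_tail assms] nn_integral_tail by simp

lemma integrable_tail_bound:
  fixes k :: "real \<Rightarrow> real"
  assumes [measurable]: "k \<in> borel_measurable borel" and le: "\<And>v. \<bar>k v\<bar> \<le> C * tail v"
  shows "integrable lborel k" "(\<integral>\<^sup>+v. ennreal \<bar>k v\<bar> \<partial>lborel) \<le> ennreal (2 * C)"
    "(\<integral>v. \<bar>k v\<bar> \<partial>lborel) \<le> 2 * C"
proof -
  have C: "0 \<le> C"
    using le[of 0] by (simp add: tail_def)
  have "(\<integral>\<^sup>+v. ennreal \<bar>k v\<bar> \<partial>lborel) \<le> (\<integral>\<^sup>+v. ennreal C * ennreal (tail v) \<partial>lborel)"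
    by (intro nn_integral_mono) (use le C in \<open>simp add: ennreal_mult[symmetric]\<close>)
  also have "\<dots> = ennreal C * 2"
    by (subst nn_integral_cmult) (auto simp: nn_integral_tail)
  also have "\<dots> = ennreal (2 * C)"
    using C by (simp add: ennreal_mult mult.commute)
  finally show 1: "(\<integral>\<^sup>+v. ennreal \<bar>k v\<bar> \<partial>lborel) \<le> ennreal (2 * C)" .
  then show i: "integrable lborel k"
    by (intro integrableI_bounded) (auto simp: le_less_trans)
  show "(\<integral>v. \<bar>k v\<bar> \<partial>lborel) \<le> 2 * C"
    using 1 C i by (subst (asm) nn_integral_eq_integral) auto
qed

section \<open>The four-cycle form and its telescoping\<close>

lemma measurable_fst_borel [measurable]:
  "fst \<in> (borel :: ('a::second_countable_topology \<times> 'b::second_countable_topology) measure) \<rightarrow>\<^sub>M borel"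
  using measurable_fst[of "borel :: 'a measure" "borel :: 'b measure"] by (simp add: borel_prod)

lemma measurable_snd_borel [measurable]:
  "snd \<in> (borel :: ('a::second_countable_topology \<times> 'b::second_countable_topology) measure) \<rightarrow>\<^sub>M borel"
  using measurable_snd[of "borel :: 'a measure" "borel :: 'b measure"] by (simp add: borel_prod)

text \<open>For \<open>p = ((z, z'), (x, y))\<close> this is \<open>f(z,y) f(z',y) g(z,x) g(z',x)\<close>.  The outer pairing groups the
  variables in the way in which the square of an integral over \<open>z\<close> is expanded.\<close>

definition cyc :: "(real \<Rightarrow> real \<Rightarrow> real) \<Rightarrow> (real \<Rightarrow> real \<Rightarrow> real) \<Rightarrow> (real \<times> real) \<times> (real \<times> real) \<Rightarrow> real" where
  "cyc f g p = f (fst (fst p)) (snd (snd p)) * f (snd (fst p)) (snd (snd p))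
     * (g (fst (fst p)) (fst (snd p)) * g (snd (fst p)) (fst (snd p)))"

definition gap :: "(real \<times> real) \<times> (real \<times> real) \<Rightarrow> real" where
  "gap p = fst (fst p) - snd (fst p)"

text \<open>Two geometries are needed: \<open>(z+z')/2 - x - y\<close> for the bilinear kernel (\<open>\<theta> = 1\<close>, \<open>\<sigma> = -1\<close>) and
  \<open>x - y\<close> for the form in one function, where \<open>y\<close> plays the part of \<open>x'\<close> (\<open>\<theta> = 0\<close>, \<open>\<sigma> = 1\<close>).
  All that matters is that the coefficients of \<open>x\<close> and \<open>y\<close> are \<open>1\<close> or \<open>-1\<close>.\<close>

definition slant :: "real \<Rightarrow> real \<Rightarrow> (real \<times> real) \<times> (real \<times> real) \<Rightarrow> real" where
  "slant \<theta> \<sigma> p = \<theta> * (fst (fst p) + snd (fst p)) / 2 + \<sigma> * fst (snd p) - snd (snd p)"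

definition fourth :: "(real \<Rightarrow> real \<Rightarrow> real) \<Rightarrow> ennreal" where
  "fourth f = (\<integral>\<^sup>+z. \<integral>\<^sup>+y. ennreal (f z y ^ 4) \<partial>lborel \<partial>lborel)"

lemma measurable_cyc [measurable]:
  assumes [measurable]: "case_prod f \<in> borel_measurable (borel \<Otimes>\<^sub>M borel)"
    "case_prod g \<in> borel_measurable (borel \<Otimes>\<^sub>M borel)"
  shows "cyc f g \<in> borel_measurable borel"
  unfolding cyc_def[abs_def] by measurable

lemma measurable_gap [measurable]: "gap \<in> borel_measurable borel"
  unfolding gap_def[abs_def] by measurable

lemma measurable_slant [measurable]: "slant \<theta> \<sigma> \<in> borel_measurable borel"
  unfolding slant_def[abs_def] by measurable

lemma cyc_le:
  "\<bar>cyc f g ((z, z'), (x, y))\<bar> \<le> (f z y ^ 4 + f z' y ^ 4 + g z x ^ 4 + g z' x ^ 4) / 4"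
proof -
  have sq: "2 * \<bar>a * b\<bar> \<le> a\<^sup>2 + b\<^sup>2" for a b :: real
    using sum_squares_bound[of "\<bar>a\<bar>" "\<bar>b\<bar>"] by (simp add: abs_mult mult.assoc)
  have "2 * \<bar>cyc f g ((z, z'), (x, y))\<bar> \<le> (f z y * f z' y)\<^sup>2 + (g z x * g z' x)\<^sup>2"
    unfolding cyc_def using sq[of "f z y * f z' y" "g z x * g z' x"] by simp
  moreover have "2 * (a * b)\<^sup>2 \<le> a ^ 4 + b ^ 4" for a b :: real
    using sq[of "a\<^sup>2" "b\<^sup>2"] by (simp add: power_mult_distrib power_mult[symmetric])
  from this[of "f z y" "f z' y"] this[of "g z x" "g z' x"]
  have "2 * ((f z y * f z' y)\<^sup>2 + (g z x * g z' x)\<^sup>2) \<le> f z y ^ 4 + f z' y ^ 4 + g z x ^ 4 + g z' x ^ 4"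
    by simp
  ultimately show ?thesis by simp
qed

lemma nn_integral_four_fold:
  fixes K :: "(real \<times> real) \<times> (real \<times> real) \<Rightarrow> ennreal"
  assumes [measurable]: "K \<in> borel_measurable borel"
  shows "(\<integral>\<^sup>+p. K p \<partial>lborel) = (\<integral>\<^sup>+z. \<integral>\<^sup>+z'. \<integral>\<^sup>+y. \<integral>\<^sup>+x. K ((z, z'), (x, y)) \<partial>lborel \<partial>lborel \<partial>lborel \<partial>lborel)"
    and "(\<integral>\<^sup>+p. K p \<partial>lborel) = (\<integral>\<^sup>+z'. \<integral>\<^sup>+z. \<integral>\<^sup>+y. \<integral>\<^sup>+x. K ((z, z'), (x, y)) \<partial>lborel \<partial>lborel \<partial>lborel \<partial>lborel)"
    and "(\<integral>\<^sup>+p. K p \<partial>lborel) = (\<integral>\<^sup>+z. \<integral>\<^sup>+z'. \<integral>\<^sup>+x. \<integral>\<^sup>+y. K ((z, z'), (x, y)) \<partial>lborel \<partial>lborel \<partial>lborel \<partial>lborel)"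
    and "(\<integral>\<^sup>+p. K p \<partial>lborel) = (\<integral>\<^sup>+z'. \<integral>\<^sup>+z. \<integral>\<^sup>+x. \<integral>\<^sup>+y. K ((z, z'), (x, y)) \<partial>lborel \<partial>lborel \<partial>lborel \<partial>lborel)"
proof -
  have m [measurable]: "(\<lambda>q. \<integral>\<^sup>+r. K (q, r) \<partial>lborel) \<in> borel_measurable borel"
    by measurable
  have "(\<integral>\<^sup>+p. K p \<partial>lborel) = (\<integral>\<^sup>+q. \<integral>\<^sup>+r. K (q, r) \<partial>lborel \<partial>lborel)"
    by (rule nn_integral_lborel_fst[symmetric]) measurable
  then have 1: "(\<integral>\<^sup>+p. K p \<partial>lborel) = (\<integral>\<^sup>+z. \<integral>\<^sup>+z'. \<integral>\<^sup>+r. K ((z, z'), r) \<partial>lborel \<partial>lborel \<partial>lborel)"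
    "(\<integral>\<^sup>+p. K p \<partial>lborel) = (\<integral>\<^sup>+z'. \<integral>\<^sup>+z. \<integral>\<^sup>+r. K ((z, z'), r) \<partial>lborel \<partial>lborel \<partial>lborel)"
    using nn_integral_lborel_pair[OF m] by simp_all
  have 2: "(\<integral>\<^sup>+r. K (q, r) \<partial>lborel) = (\<integral>\<^sup>+y. \<integral>\<^sup>+x. K (q, (x, y)) \<partial>lborel \<partial>lborel)"
    "(\<integral>\<^sup>+r. K (q, r) \<partial>lborel) = (\<integral>\<^sup>+x. \<integral>\<^sup>+y. K (q, (x, y)) \<partial>lborel \<partial>lborel)" for q
    using nn_integral_lborel_pair[of "\<lambda>r. K (q, r)"] by simp_all
  show "(\<integral>\<^sup>+p. K p \<partial>lborel) = (\<integral>\<^sup>+z. \<integral>\<^sup>+z'. \<integral>\<^sup>+y. \<integral>\<^sup>+x. K ((z, z'), (x, y)) \<partial>lborel \<partial>lborel \<partial>lborel \<partial>lborel)"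
    using 1(1) by (simp only: 2(1))
  show "(\<integral>\<^sup>+p. K p \<partial>lborel) = (\<integral>\<^sup>+z'. \<integral>\<^sup>+z. \<integral>\<^sup>+y. \<integral>\<^sup>+x. K ((z, z'), (x, y)) \<partial>lborel \<partial>lborel \<partial>lborel \<partial>lborel)"
    using 1(2) by (simp only: 2(1))
  show "(\<integral>\<^sup>+p. K p \<partial>lborel) = (\<integral>\<^sup>+z. \<integral>\<^sup>+z'. \<integral>\<^sup>+x. \<integral>\<^sup>+y. K ((z, z'), (x, y)) \<partial>lborel \<partial>lborel \<partial>lborel \<partial>lborel)"
    using 1(1) by (simp only: 2(2))
  show "(\<integral>\<^sup>+p. K p \<partial>lborel) = (\<integral>\<^sup>+z'. \<integral>\<^sup>+z. \<integral>\<^sup>+x. \<integral>\<^sup>+y. K ((z, z'), (x, y)) \<partial>lborel \<partial>lborel \<partial>lborel \<partial>lborel)"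
    using 1(2) by (simp only: 2(2))
qed

text \<open>Each of the four fourth powers from \<open>cyc_le\<close> leaves two variables free.  One of them
  can be integrated against the weight in the slanted variable and the other against the weight in the gap,
  each giving the factor \<open>2\<close>.\<close>

lemma four_cycle_Hoelder:
  assumes [measurable]: "case_prod f \<in> borel_measurable (borel \<Otimes>\<^sub>M borel)"
    "case_prod g \<in> borel_measurable (borel \<Otimes>\<^sub>M borel)"
    and t: "0 < t" and \<sigma>: "\<bar>\<sigma>\<bar> = 1"
  shows "(\<integral>\<^sup>+p. ennreal (\<bar>cyc f g p\<bar> * (dil t tail (gap p) * dil t tail (slant \<theta> \<sigma> p))) \<partial>lborel)
    \<le> 2 * (fourth f + fourth g)"
proof -
  let ?a = "\<lambda>z z'. ennreal (dil t tail (z - z'))"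
  let ?b = "\<lambda>z z' x y. ennreal (dil t tail (\<theta> * (z + z') / 2 + \<sigma> * x - y))"
  have dn: "0 \<le> dil t tail v" for v
    using t by (simp add: dil_def)
  have a1: "(\<integral>\<^sup>+z'. ?a z z' \<partial>lborel) = 2" for z
    using nn_integral_dil_tail[OF t, of "-1" z] by simp
  have a2: "(\<integral>\<^sup>+z. ?a z z' \<partial>lborel) = 2" for z'
    using nn_integral_dil_tail[OF t, of "1" "-z'"] by simp
  have b1: "(\<integral>\<^sup>+x. ?b z z' x y \<partial>lborel) = 2" for z z' y
    using nn_integral_dil_tail[OF t \<sigma>, of "\<theta> * (z + z') / 2 - y"] by (simp add: algebra_simps)
  have b2: "(\<integral>\<^sup>+y. ?b z z' x y \<partial>lborel) = 2" for z z' x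
    using nn_integral_dil_tail[OF t, of "-1" "\<theta> * (z + z') / 2 + \<sigma> * x"] by (simp add: algebra_simps)
  define W where "W = (\<lambda>p. ennreal (dil t tail (gap p)) * ennreal (dil t tail (slant \<theta> \<sigma> p)))"
  have [measurable]: "W \<in> borel_measurable borel"
    unfolding W_def by measurable
  have W: "W ((z, z'), (x, y)) = ?a z z' * ?b z z' x y" for z z' x y
    by (simp add: W_def gap_def slant_def)
  have pieces:
    "(\<integral>\<^sup>+p. ennreal (h (fst (fst p)) (snd (snd p)) ^ 4) * W p \<partial>lborel) = 4 * fourth h"
    "(\<integral>\<^sup>+p. ennreal (h (snd (fst p)) (snd (snd p)) ^ 4) * W p \<partial>lborel) = 4 * fourth h"
    "(\<integral>\<^sup>+p. ennreal (h (fst (fst p)) (fst (snd p)) ^ 4) * W p \<partial>lborel) = 4 * fourth h"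
    "(\<integral>\<^sup>+p. ennreal (h (snd (fst p)) (fst (snd p)) ^ 4) * W p \<partial>lborel) = 4 * fourth h"
    if [measurable]: "case_prod h \<in> borel_measurable (borel \<Otimes>\<^sub>M borel)" for h
  proof -
    let ?H = "\<lambda>z. \<integral>\<^sup>+y. ennreal (h z y ^ 4) \<partial>lborel"
    have four: "(2::ennreal) * 2 = 4" by simp
    have e: "(\<integral>\<^sup>+z'. ?H z * (?a z z' * 2) \<partial>lborel) = 4 * ?H z"
      "(\<integral>\<^sup>+z'. ?H z * (?a z' z * 2) \<partial>lborel) = 4 * ?H z" for z
      by (simp_all add: nn_integral_cmult nn_integral_multc a1 a2 mult.commute four)
    have x: "(\<integral>\<^sup>+x. c * (?a z z' * ?b z z' x y) \<partial>lborel) = c * (?a z z' * 2)" for c z z' y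
      by (simp add: nn_integral_cmult b1)
    have y: "(\<integral>\<^sup>+y. c * (?a z z' * ?b z z' x y) \<partial>lborel) = c * (?a z z' * 2)" for c z z' x
      by (simp add: nn_integral_cmult b2)
    have H: "(\<integral>\<^sup>+y. ennreal (h z y ^ 4) * c \<partial>lborel) = ?H z * c" for z c
      by (rule nn_integral_multc) measurable
    have F: "(\<integral>\<^sup>+z. 4 * ?H z \<partial>lborel) = 4 * fourth h"
      unfolding fourth_def by (rule nn_integral_cmult) measurable
    show "(\<integral>\<^sup>+p. ennreal (h (fst (fst p)) (snd (snd p)) ^ 4) * W p \<partial>lborel) = 4 * fourth h"
      by (subst nn_integral_four_fold(1), measurable) (simp only: W fst_conv snd_conv x H e F)
    show "(\<integral>\<^sup>+p. ennreal (h (snd (fst p)) (snd (snd p)) ^ 4) * W p \<partial>lborel) = 4 * fourth h"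
      by (subst nn_integral_four_fold(2), measurable) (simp only: W fst_conv snd_conv x H e F)
    show "(\<integral>\<^sup>+p. ennreal (h (fst (fst p)) (fst (snd p)) ^ 4) * W p \<partial>lborel) = 4 * fourth h"
      by (subst nn_integral_four_fold(3), measurable) (simp only: W fst_conv snd_conv y H e F)
    show "(\<integral>\<^sup>+p. ennreal (h (snd (fst p)) (fst (snd p)) ^ 4) * W p \<partial>lborel) = 4 * fourth h"
      by (subst nn_integral_four_fold(4), measurable) (simp only: W fst_conv snd_conv y H e F)
  qed
  let ?s = "\<lambda>p. ennreal (f (fst (fst p)) (snd (snd p)) ^ 4) * W p
      + ennreal (f (snd (fst p)) (snd (snd p)) ^ 4) * W p
      + ennreal (g (fst (fst p)) (fst (snd p)) ^ 4) * W p
      + ennreal (g (snd (fst p)) (fst (snd p)) ^ 4) * W p"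
  have pt: "ennreal (\<bar>cyc f g p\<bar> * (dil t tail (gap p) * dil t tail (slant \<theta> \<sigma> p))) \<le> ennreal (1/4) * ?s p" for p
  proof -
    obtain z z' x y where p: "p = ((z, z'), (x, y))"
      by (metis prod.exhaust)
    have "ennreal (\<bar>cyc f g p\<bar> * (dil t tail (gap p) * dil t tail (slant \<theta> \<sigma> p))) = ennreal \<bar>cyc f g p\<bar> * W p"
      using dn by (simp add: W_def ennreal_mult)
    also have "\<dots> \<le> ennreal ((f z y ^ 4 + f z' y ^ 4 + g z x ^ 4 + g z' x ^ 4) / 4) * W p"
      unfolding p by (intro mult_right_mono ennreal_leI cyc_le) simp
    also have "\<dots> = ennreal (1/4) * ?s p"
    proof -
      have "ennreal ((f z y ^ 4 + f z' y ^ 4 + g z x ^ 4 + g z' x ^ 4) / 4)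
        = ennreal (1/4) * ennreal (f z y ^ 4 + f z' y ^ 4 + g z x ^ 4 + g z' x ^ 4)"
        by (subst ennreal_mult[symmetric]) auto
      also have "\<dots> = ennreal (1/4) * (ennreal (f z y ^ 4) + ennreal (f z' y ^ 4) + ennreal (g z x ^ 4) + ennreal (g z' x ^ 4))"
        by (simp add: ennreal_plus)
      finally show ?thesis
        unfolding p by (simp add: distrib_left distrib_right mult.assoc)
    qed
    finally show ?thesis .
  qed
  have "(\<integral>\<^sup>+p. ennreal (\<bar>cyc f g p\<bar> * (dil t tail (gap p) * dil t tail (slant \<theta> \<sigma> p))) \<partial>lborel)
     \<le> (\<integral>\<^sup>+p. ennreal (1/4) * ?s p \<partial>lborel)"
    by (intro nn_integral_mono pt)
  also have "\<dots> = ennreal (1/4) * (4 * fourth f + 4 * fourth f + 4 * fourth g + 4 * fourth g)"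
    by (simp add: nn_integral_cmult nn_integral_add pieces)
  also have "\<dots> = ennreal (1/4) * 4 * (2 * (fourth f + fourth g))"
    by (simp add: mult_2 distrib_left distrib_right ac_simps)
  also have "ennreal (1/4) * 4 = 1"
    by (simp add: ennreal_mult[symmetric] flip: ennreal_numeral)
  finally show ?thesis by simp
qed

lemma integrable_slab:
  fixes K :: "real \<Rightarrow> 'a::euclidean_space \<Rightarrow> real"
  assumes [measurable]: "case_prod K \<in> borel_measurable borel"
    and t0: "0 < t0"
    and B: "\<And>t. t0 \<le> t \<Longrightarrow> t \<le> t1 \<Longrightarrow> (\<integral>\<^sup>+p. ennreal \<bar>K t p\<bar> \<partial>lborel) \<le> ennreal B"
  shows "integrable lborel (\<lambda>(t, p). indicator {t0..t1} t / t * K t p)"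
proof (rule integrableI_bounded)
  have [measurable]: "case_prod K \<in> borel_measurable (borel \<Otimes>\<^sub>M borel)"
    by (simp add: borel_prod)
  show m: "(\<lambda>(t, p). indicator {t0..t1} t / t * K t p) \<in> borel_measurable lborel"
    by (simp add: borel_prod[symmetric])
  have [measurable]: "(\<lambda>q. ennreal (norm (case q of (t, p) \<Rightarrow> indicator {t0..t1} t / t * K t p))) \<in> borel_measurable borel"
    using m by simp
  have "(\<integral>\<^sup>+q. ennreal (norm (case q of (t, p) \<Rightarrow> indicator {t0..t1} t / t * K t p)) \<partial>lborel)
    = (\<integral>\<^sup>+t. \<integral>\<^sup>+p. ennreal (indicator {t0..t1} t / t) * ennreal \<bar>K t p\<bar> \<partial>lborel \<partial>lborel)"
    using t0 by (subst nn_integral_lborel_fst[symmetric])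
      (auto simp: abs_mult ennreal_mult[symmetric] indicator_def intro!: nn_integral_cong)
  also have "\<dots> \<le> (\<integral>\<^sup>+t. ennreal (1 / t0 * B) * indicator {t0..t1} t \<partial>lborel)"
  proof (rule nn_integral_mono)
    fix t
    have mt: "(\<lambda>p. ennreal \<bar>K t p\<bar>) \<in> borel_measurable lborel"
      by measurable
    show "(\<integral>\<^sup>+p. ennreal (indicator {t0..t1} t / t) * ennreal \<bar>K t p\<bar> \<partial>lborel)
       \<le> ennreal (1 / t0 * B) * indicator {t0..t1} t"
    proof (cases "t \<in> {t0..t1}")
      case True
      have "ennreal (1 / t) * (\<integral>\<^sup>+p. ennreal \<bar>K t p\<bar> \<partial>lborel) \<le> ennreal (1 / t0) * ennreal B"
        using True t0 by (intro mult_mono B ennreal_leI) (auto simp: frac_le)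
      moreover have "ennreal (1 / t0) * ennreal B = ennreal (1 / t0 * B)"
        by (rule ennreal_mult'[symmetric]) (use t0 in simp)
      ultimately show ?thesis
        using True by (simp only: nn_integral_cmult[OF mt] indicator_simps mult_1_right)
    qed (simp)
  qed
  also have "\<dots> < \<infinity>"
    by (subst nn_integral_cmult) (auto simp: ennreal_mult_less_top emeasure_lborel_Icc_eq)
  finally show "(\<integral>\<^sup>+q. ennreal (norm (case q of (t, p) \<Rightarrow> indicator {t0..t1} t / t * K t p)) \<partial>lborel) < \<infinity>" .
qed

lemma abs_integral_le:
  fixes f :: "'a \<Rightarrow> real"
  assumes "(\<integral>\<^sup>+x. ennreal \<bar>f x\<bar> \<partial>M) \<le> ennreal B" "0 \<le> B"
  shows "\<bar>\<integral>x. f x \<partial>M\<bar> \<le> B"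
proof (cases "integrable M f")
  case True
  have "\<bar>\<integral>x. f x \<partial>M\<bar> \<le> (\<integral>x. \<bar>f x\<bar> \<partial>M)"
    by (rule integral_abs_bound)
  also have "\<dots> \<le> B"
    using assms True by (subst (asm) nn_integral_eq_integral) auto
  finally show ?thesis .
qed (use assms in \<open>simp add: not_integrable_integral_eq\<close>)

text \<open>If \<open>- K'/t\<close> is the derivative of \<open>K\<close> in the scale, integrating the form with kernel \<open>K'\<close> against \<open>dt/t\<close>
  leaves only the forms with kernel \<open>K\<close> at the two end points, however long the range of scales is.\<close>

lemma telescoping:
  fixes h :: "'a::euclidean_space \<Rightarrow> real" and K K' :: "real \<Rightarrow> 'a \<Rightarrow> real"
  assumes [measurable]: "h \<in> borel_measurable borel" "\<And>t. K t \<in> borel_measurable borel"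
      "case_prod K' \<in> borel_measurable borel"
    and t: "0 < t0" "t0 \<le> t1" and B0: "0 \<le> B"
    and B: "\<And>t. t0 \<le> t \<Longrightarrow> t \<le> t1 \<Longrightarrow> (\<integral>\<^sup>+p. ennreal \<bar>h p * K t p\<bar> \<partial>lborel) \<le> ennreal B"
    and B': "\<And>t. t0 \<le> t \<Longrightarrow> t \<le> t1 \<Longrightarrow> (\<integral>\<^sup>+p. ennreal \<bar>h p * K' t p\<bar> \<partial>lborel) \<le> ennreal B'"
    and deriv: "\<And>t p. t0 \<le> t \<Longrightarrow> t \<le> t1 \<Longrightarrow> ((\<lambda>s. K s p) has_real_derivative - K' t p / t) (at t)"
    and cont: "\<And>t p. t0 \<le> t \<Longrightarrow> t \<le> t1 \<Longrightarrow> isCont (\<lambda>s. K' s p) t"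
  shows "\<bar>\<integral>t. indicator {t0..t1} t / t * (\<integral>p. h p * K' t p \<partial>lborel) \<partial>lborel\<bar> \<le> 2 * B"
proof -
  have [measurable]: "case_prod K' \<in> borel_measurable (borel \<Otimes>\<^sub>M borel)"
    by (simp add: borel_prod)
  have "(\<lambda>(t, p). h p * K' t p) \<in> borel_measurable borel"
    by (simp add: borel_prod[symmetric])
  from integrable_slab[OF this t(1) B']
  have i: "integrable lborel (\<lambda>(t, p). indicator {t0..t1} t / t * (h p * K' t p))" .
  have "(\<integral>t. indicator {t0..t1} t / t * (\<integral>p. h p * K' t p \<partial>lborel) \<partial>lborel)
    = (\<integral>t. \<integral>p. indicator {t0..t1} t / t * (h p * K' t p) \<partial>lborel \<partial>lborel)"
    by simp
  also have "\<dots> = (\<integral>p. \<integral>t. indicator {t0..t1} t / t * (h p * K' t p) \<partial>lborel \<partial>lborel)"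
    using integral_lborel_fst[OF i] integral_lborel_snd[OF i] by simp
  also have "\<dots> = (\<integral>p. h p * (\<integral>t. (K' t p / t) * indicator {t0..t1} t \<partial>lborel) \<partial>lborel)"
    by (subst integral_mult_right_zero[symmetric]) (simp add: mult_ac)
  also have "\<dots> = (\<integral>p. h p * (K t0 p - K t1 p) \<partial>lborel)"
  proof (rule Bochner_Integration.integral_cong[OF refl])
    fix p
    have "(\<integral>t. (K' t p / t) * indicator {t0..t1} t \<partial>lborel) = - K t1 p - (- K t0 p)"
    proof (rule integral_FTC_Icc_real[OF t(2)])
      fix s assume s: "t0 \<le> s" "s \<le> t1"
      show "((\<lambda>s. - K s p) has_real_derivative K' s p / s) (at s)"
        using DERIV_minus[OF deriv[OF s]] by simp
      show "isCont (\<lambda>s. K' s p / s) s"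
        using cont[OF s] s t by (intro continuous_intros) auto
    qed
    then show "h p * (\<integral>t. (K' t p / t) * indicator {t0..t1} t \<partial>lborel) = h p * (K t0 p - K t1 p)"
      by simp
  qed
  also have "\<bar>\<dots>\<bar> \<le> 2 * B"
  proof (rule abs_integral_le)
    have "(\<integral>\<^sup>+p. ennreal \<bar>h p * (K t0 p - K t1 p)\<bar> \<partial>lborel)
       \<le> (\<integral>\<^sup>+p. ennreal \<bar>h p * K t0 p\<bar> + ennreal \<bar>h p * K t1 p\<bar> \<partial>lborel)"
      by (intro nn_integral_mono) (simp add: right_diff_distrib flip: ennreal_plus)
    also have "\<dots> = (\<integral>\<^sup>+p. ennreal \<bar>h p * K t0 p\<bar> \<partial>lborel) + (\<integral>\<^sup>+p. ennreal \<bar>h p * K t1 p\<bar> \<partial>lborel)"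
      by (rule nn_integral_add) measurable
    also have "\<dots> \<le> ennreal B + ennreal B"
      using t by (intro add_mono B) auto
    finally show "(\<integral>\<^sup>+p. ennreal \<bar>h p * (K t0 p - K t1 p)\<bar> \<partial>lborel) \<le> ennreal (2 * B)"
      using B0 by (simp flip: ennreal_plus)
  qed (use B0 in simp)
  finally show ?thesis .
qed

text \<open>The relation between \<open>k\<close> and \<open>l\<close> amounts to \<open>l = (v k)'\<close>, but stated in the scale variable it needs no
  differentiability of \<open>k\<close> at the origin; \<open>tail\<close> and \<open>e\<^bsup>-|v|\<^esup>\<close> have a corner there.\<close>

definition scale_pair :: "real \<Rightarrow> (real \<Rightarrow> real) \<Rightarrow> (real \<Rightarrow> real) \<Rightarrow> bool" where
  "scale_pair C k l \<longleftrightarrow> k \<in> borel_measurable borel \<and> continuous_on UNIV l \<and>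
    (\<forall>t v. 0 < t \<longrightarrow> ((\<lambda>s. dil s k v) has_real_derivative - dil t l v / t) (at t)) \<and>
    (\<forall>v. \<bar>k v\<bar> \<le> C * tail v \<and> \<bar>l v\<bar> \<le> C * tail v)"

lemma scale_pairD:
  assumes "scale_pair C k l"
  shows "k \<in> borel_measurable borel" "l \<in> borel_measurable borel" "isCont l v"
    "0 < t \<Longrightarrow> ((\<lambda>s. dil s k v) has_real_derivative - dil t l v / t) (at t)"
    "\<bar>k v\<bar> \<le> C * tail v" "\<bar>l v\<bar> \<le> C * tail v" "0 \<le> C"
    "0 < t \<Longrightarrow> isCont (\<lambda>s. dil s k v) t" "0 < t \<Longrightarrow> isCont (\<lambda>s. dil s l v) t"
    "0 < t \<Longrightarrow> \<bar>dil t k v\<bar> \<le> C * dil t tail v" "0 < t \<Longrightarrow> \<bar>dil t l v\<bar> \<le> C * dil t tail v"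
proof -
  note a = assms[unfolded scale_pair_def]
  show "k \<in> borel_measurable borel" and l: "l \<in> borel_measurable borel"
    using a by (auto intro: borel_measurable_continuous_onI)
  show c: "isCont l v" for v
    using a by (auto simp: continuous_on_eq_continuous_at)
  show d: "0 < t \<Longrightarrow> ((\<lambda>s. dil s k v) has_real_derivative - dil t l v / t) (at t)"
    and b: "\<bar>k v\<bar> \<le> C * tail v" "\<bar>l v\<bar> \<le> C * tail v" for t v
    using a by auto
  show "0 \<le> C"
    using b(1)[of 0] by (simp add: tail_def)
  show "0 < t \<Longrightarrow> isCont (\<lambda>s. dil s k v) t"
    using d DERIV_isCont by blast
  show "isCont (\<lambda>s. dil s l v) t" if "0 < t"
  proof -
    have "isCont (\<lambda>s. l (v / s)) t"
      by (rule isCont_o2[of t "\<lambda>s. v / s" l]) (use that c in \<open>auto intro!: continuous_intros\<close>)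
    then show ?thesis
      unfolding dil_def using that by (intro continuous_intros) auto
  qed
  show "\<bar>dil t k v\<bar> \<le> C * dil t tail v" "\<bar>dil t l v\<bar> \<le> C * dil t tail v" if "0 < t"
    using divide_right_mono[OF b(1)[of "v / t"], of t] divide_right_mono[OF b(2)[of "v / t"], of t] that
    by (simp_all add: dil_def)
qed

lemma nn_integral_cyc_kernel:
  assumes [measurable]: "case_prod f \<in> borel_measurable (borel \<Otimes>\<^sub>M borel)"
    "case_prod g \<in> borel_measurable (borel \<Otimes>\<^sub>M borel)"
    and t: "0 < t" and \<sigma>: "\<bar>\<sigma>\<bar> = 1"
    and B: "fourth f + fourth g \<le> ennreal B" "0 \<le> B"
    and K: "\<And>p. \<bar>K p\<bar> \<le> C * (dil t tail (gap p) * dil t tail (slant \<theta> \<sigma> p))" and C: "0 \<le> C"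
  shows "(\<integral>\<^sup>+p. ennreal \<bar>cyc f g p * K p\<bar> \<partial>lborel) \<le> ennreal (2 * C * B)"
proof -
  have "(\<integral>\<^sup>+p. ennreal \<bar>cyc f g p * K p\<bar> \<partial>lborel)
    \<le> (\<integral>\<^sup>+p. ennreal C * ennreal (\<bar>cyc f g p\<bar> * (dil t tail (gap p) * dil t tail (slant \<theta> \<sigma> p))) \<partial>lborel)"
  proof (rule nn_integral_mono)
    fix p
    have "\<bar>cyc f g p * K p\<bar> \<le> \<bar>cyc f g p\<bar> * (C * (dil t tail (gap p) * dil t tail (slant \<theta> \<sigma> p)))"
      unfolding abs_mult by (intro mult_left_mono K) simp
    then show "ennreal \<bar>cyc f g p * K p\<bar>
      \<le> ennreal C * ennreal (\<bar>cyc f g p\<bar> * (dil t tail (gap p) * dil t tail (slant \<theta> \<sigma> p)))"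
      using C by (simp add: ennreal_mult'[symmetric] mult_ac ennreal_leI)
  qed
  also have "\<dots> = ennreal C * (\<integral>\<^sup>+p. ennreal (\<bar>cyc f g p\<bar> * (dil t tail (gap p) * dil t tail (slant \<theta> \<sigma> p))) \<partial>lborel)"
    by (rule nn_integral_cmult) measurable
  also have "\<dots> \<le> ennreal C * (2 * ennreal B)"
  proof -
    have "2 * (fourth f + fourth g) \<le> 2 * ennreal B"
      by (rule mult_left_mono[OF B(1)]) simp
    with four_cycle_Hoelder[OF assms(1,2) t \<sigma>, of \<theta>] show ?thesis
      by (intro mult_left_mono) (auto intro: order_trans)
  qed
  also have "\<dots> = ennreal (2 * C * B)"
    using B C by (simp add: ennreal_mult mult_ac)
  finally show ?thesis .
qed

text \<open>The product rule for two scale pairs, one in the gap \<open>z - z'\<close> and one in the slanted variable.\<close>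

lemma telescoping_cyc:
  assumes [measurable]: "case_prod f \<in> borel_measurable (borel \<Otimes>\<^sub>M borel)"
    "case_prod g \<in> borel_measurable (borel \<Otimes>\<^sub>M borel)"
    and t: "0 < t0" "t0 \<le> t1" and \<sigma>: "\<bar>\<sigma>\<bar> = 1"
    and B: "fourth f + fourth g \<le> ennreal B" "0 \<le> B"
    and sp1: "scale_pair C1 k1 l1" and sp2: "scale_pair C2 k2 l2"
  shows "\<bar>\<integral>t. indicator {t0..t1} t / t * (\<integral>p. cyc f g p *
      (dil t l1 (gap p) * dil t k2 (slant \<theta> \<sigma> p) + dil t k1 (gap p) * dil t l2 (slant \<theta> \<sigma> p)) \<partial>lborel) \<partial>lborel\<bar>
    \<le> 4 * (C1 * C2) * B"
proof -
  note p1 = scale_pairD[OF sp1] and p2 = scale_pairD[OF sp2]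
  note [measurable] = p1(1,2) p2(1,2)
  let ?K = "\<lambda>t p. dil t k1 (gap p) * dil t k2 (slant \<theta> \<sigma> p)"
  let ?K' = "\<lambda>t p. dil t l1 (gap p) * dil t k2 (slant \<theta> \<sigma> p) + dil t k1 (gap p) * dil t l2 (slant \<theta> \<sigma> p)"
  have prod: "\<bar>a * b\<bar> \<le> C1 * C2 * (c * d)"
    if "\<bar>a\<bar> \<le> C1 * c" "\<bar>b\<bar> \<le> C2 * d" for a b c d
    using mult_mono[OF that] that p1(7) p2(7) by (simp add: abs_mult mult_ac)
  have CC: "0 \<le> C1 * C2"
    using p1(7) p2(7) by simp
  have "\<bar>\<integral>t. indicator {t0..t1} t / t * (\<integral>p. cyc f g p * ?K' t p \<partial>lborel) \<partial>lborel\<bar> \<le> 2 * (2 * (C1 * C2) * B)"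
  proof (rule telescoping[where K = ?K and B' = "2 * (2 * (C1 * C2)) * B"])
    show "(\<lambda>(t, p). ?K' t p) \<in> borel_measurable borel"
      unfolding case_prod_beta' by measurable
    fix t assume "t0 \<le> t" "t \<le> t1"
    then have t': "0 < t" using t by simp
    show "(\<integral>\<^sup>+p. ennreal \<bar>cyc f g p * ?K t p\<bar> \<partial>lborel) \<le> ennreal (2 * (C1 * C2) * B)"
      by (rule nn_integral_cyc_kernel[OF assms(1,2) t' \<sigma> B prod[OF p1(10)[OF t'] p2(10)[OF t']] CC])
    show "(\<integral>\<^sup>+p. ennreal \<bar>cyc f g p * ?K' t p\<bar> \<partial>lborel) \<le> ennreal (2 * (2 * (C1 * C2)) * B)"
    proof (rule nn_integral_cyc_kernel[OF assms(1,2) t' \<sigma> B])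
      fix p
      show "\<bar>?K' t p\<bar> \<le> 2 * (C1 * C2) * (dil t tail (gap p) * dil t tail (slant \<theta> \<sigma> p))"
        using prod[OF p1(11)[OF t', of "gap p"] p2(10)[OF t', of "slant \<theta> \<sigma> p"]]
          prod[OF p1(10)[OF t', of "gap p"] p2(11)[OF t', of "slant \<theta> \<sigma> p"]]
        by linarith
    qed (use CC in auto)
    fix p
    show "((\<lambda>s. ?K s p) has_real_derivative - ?K' t p / t) (at t)"
      by (rule derivative_eq_intros p1(4)[OF t'] p2(4)[OF t'])+ (simp add: algebra_simps add_divide_distrib diff_divide_distrib)
    show "isCont (\<lambda>s. ?K' s p) t"
      by (intro continuous_intros p1 p2 t')
  qed (use t B CC in \<open>auto\<close>)
  then show ?thesis by simp
qed

section \<open>Positive semidefinite kernels\<close>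

lemma power_le_fact_exp:
  assumes "0 \<le> (x::real)"
  shows "x ^ n \<le> fact n * exp x"
proof -
  have "(\<Sum>i\<in>{n}. inverse (fact i) * x ^ i) \<le> (\<Sum>i. inverse (fact i) * x ^ i)"
    by (rule sum_le_suminf[OF summable_exp]) (use assms in auto)
  then have "inverse (fact n) * x ^ n \<le> exp x"
    by (simp add: exp_def scaleR_conv_of_real)
  then have "fact n * (inverse (fact n) * x ^ n) \<le> fact n * exp x"
    by (rule mult_left_mono) simp
  moreover have "fact n * (inverse (fact n) * x ^ n) = x ^ n"
    by (simp only: mult.assoc[symmetric]) simp
  ultimately show ?thesis by simp
qed

lemma power_exp_bound:
  assumes "0 \<le> (v::real)"
  shows "(1 + v) ^ n * exp (- v) \<le> 3 * fact n"
proof -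
  have "(1 + v) ^ n * exp (- v) \<le> (fact n * exp (1 + v)) * exp (- v)"
    using assms by (intro mult_right_mono power_le_fact_exp) auto
  also have "\<dots> = fact n * exp 1"
    by (simp add: exp_add exp_minus)
  also have "\<dots> \<le> fact n * 3"
    using exp_le by (intro mult_left_mono) auto
  finally show ?thesis by simp
qed

lemma exp_tail_bound:
  assumes "\<bar>k\<bar> \<le> (1 + \<bar>v\<bar>) * exp (- \<bar>v\<bar>)"
  shows "\<bar>k\<bar> \<le> 18 * tail v"
proof -
  have "(1 + \<bar>v\<bar>) * exp (- \<bar>v\<bar>) * (1 + \<bar>v\<bar>)\<^sup>2 \<le> 18"
    using power_exp_bound[of "\<bar>v\<bar>" 3] by (simp add: power3_eq_cube power2_eq_square fact_numeral mult_ac)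
  then have "(1 + \<bar>v\<bar>) * exp (- \<bar>v\<bar>) \<le> 18 / (1 + \<bar>v\<bar>)\<^sup>2"
    by (subst pos_le_divide_eq) (auto intro!: zero_less_power)
  with assms show ?thesis
    by (simp add: tail_def)
qed

text \<open>The two pairs \<open>(ekern, rkern)\<close> and \<open>(tail, tkern)\<close> are scale pairs.  The kernel \<open>rkern\<close> has Fourier transform
  \<open>4 \<xi>\<^sup>2 / (1 + \<xi>\<^sup>2)\<^sup>2\<close> and is four times the autocorrelation of the one-sided function \<open>rho\<close>.\<close>

definition ekern :: "real \<Rightarrow> real" where "ekern v = exp (- \<bar>v\<bar>)"
definition rkern :: "real \<Rightarrow> real" where "rkern v = (1 - \<bar>v\<bar>) * exp (- \<bar>v\<bar>)"
definition tkern :: "real \<Rightarrow> real" where "tkern v = (1 - \<bar>v\<bar>) / (1 + \<bar>v\<bar>) ^ 3"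
definition rho :: "real \<Rightarrow> real" where "rho v = indicator {0..} v * ((1 - v) * exp (- v))"

lemma measurable_kerns [measurable]:
  "ekern \<in> borel_measurable borel" "rkern \<in> borel_measurable borel"
  "tkern \<in> borel_measurable borel" "rho \<in> borel_measurable borel"
  unfolding ekern_def[abs_def] rkern_def[abs_def] tkern_def[abs_def] rho_def[abs_def] by measurable

lemma kern_tail_bounds:
  "\<bar>ekern v\<bar> \<le> 18 * tail v" "\<bar>rkern v\<bar> \<le> 18 * tail v" "\<bar>tkern v\<bar> \<le> tail v" "\<bar>rho v\<bar> \<le> 18 * tail v"
proof -
  show "\<bar>ekern v\<bar> \<le> 18 * tail v"
    by (rule exp_tail_bound) (simp add: ekern_def)
  show "\<bar>rkern v\<bar> \<le> 18 * tail v"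
    by (rule exp_tail_bound) (auto simp: rkern_def abs_mult intro!: mult_right_mono)
  show "\<bar>rho v\<bar> \<le> 18 * tail v"
    by (rule exp_tail_bound) (auto simp: rho_def abs_mult indicator_def intro!: mult_right_mono)
  have "\<bar>1 - \<bar>v\<bar>\<bar> / (1 + \<bar>v\<bar>) ^ 3 \<le> (1 + \<bar>v\<bar>) / (1 + \<bar>v\<bar>) ^ 3"
    by (intro divide_right_mono) auto
  also have "\<dots> = tail v"
    by (simp add: tail_def power3_eq_cube power2_eq_square)
  finally show "\<bar>tkern v\<bar> \<le> tail v"
    by (simp add: tkern_def)
qed

lemma scale_pair_ekern: "scale_pair 18 ekern rkern"
  unfolding scale_pair_def
proof (intro conjI allI impI)
  show "ekern \<in> borel_measurable borel" by measurable
  show "continuous_on UNIV rkern"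
    unfolding rkern_def by (intro continuous_intros)
  show "\<bar>ekern v\<bar> \<le> 18 * tail v" "\<bar>rkern v\<bar> \<le> 18 * tail v" for v
    by (rule kern_tail_bounds)+
  fix t v :: real assume t: "0 < t"
  have "((\<lambda>s. exp (- (\<bar>v\<bar> / s)) / s) has_real_derivative - dil t rkern v / t) (at t)"
    using t by (auto intro!: derivative_eq_intros simp: dil_def rkern_def field_simps power2_eq_square)
  moreover have "eventually (\<lambda>s. dil s ekern v = exp (- (\<bar>v\<bar> / s)) / s) (nhds t)"
    using eventually_nhds_in_open[of "{0<..}" t] t
    by (auto simp: dil_def ekern_def elim!: eventually_mono)
  ultimately show "((\<lambda>s. dil s ekern v) has_real_derivative - dil t rkern v / t) (at t)"
    by (subst DERIV_cong_ev[OF refl _ refl]) auto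
qed

lemma scale_pair_tail: "scale_pair 1 tail tkern"
  unfolding scale_pair_def
proof (intro conjI allI impI)
  show "tail \<in> borel_measurable borel" by measurable
  show "continuous_on UNIV tkern"
    unfolding tkern_def by (intro continuous_intros) (auto simp: add_nonneg_eq_0_iff)
  show "\<bar>tail v\<bar> \<le> 1 * tail v" "\<bar>tkern v\<bar> \<le> 1 * tail v" for v
    using kern_tail_bounds by auto
  fix t v :: real assume t: "0 < t"
  have p: "0 < t + \<bar>v\<bar>" using t by simp
  have *: "dil s tail v = s / (s + \<bar>v\<bar>)\<^sup>2" if "0 < s" for s
  proof -
    have "1 + \<bar>v / s\<bar> = (s + \<bar>v\<bar>) / s"
      using that by (simp add: field_simps)
    then show ?thesis
      using that by (simp add: dil_def tail_def power_divide power2_eq_square)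
  qed
  have **: "dil t tkern v = (t - \<bar>v\<bar>) * t / (t + \<bar>v\<bar>) ^ 3"
  proof -
    have a: "1 + \<bar>v / t\<bar> = (t + \<bar>v\<bar>) / t" "1 - \<bar>v / t\<bar> = (t - \<bar>v\<bar>) / t"
      using t by (simp_all add: field_simps)
    have "(b / t) / (S / t) ^ 3 / t = b * t / S ^ 3" if "0 < S" for b S
      using t that by (simp add: power_divide divide_simps power3_eq_cube)
    from this[OF p] show ?thesis
      unfolding dil_def tkern_def a .
  qed
  have "((\<lambda>s. s / (s + \<bar>v\<bar>)\<^sup>2) has_real_derivative
      (1 * (t + \<bar>v\<bar>)\<^sup>2 - t * (2 * (t + \<bar>v\<bar>))) / ((t + \<bar>v\<bar>)\<^sup>2 * (t + \<bar>v\<bar>)\<^sup>2)) (at t)"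
    using p by (auto intro!: derivative_eq_intros)
  also have "(1 * (t + \<bar>v\<bar>)\<^sup>2 - t * (2 * (t + \<bar>v\<bar>))) / ((t + \<bar>v\<bar>)\<^sup>2 * (t + \<bar>v\<bar>)\<^sup>2) = - dil t tkern v / t"
  proof -
    have "1 * (t + \<bar>v\<bar>)\<^sup>2 - t * (2 * (t + \<bar>v\<bar>)) = (t + \<bar>v\<bar>) * (\<bar>v\<bar> - t)"
      by (simp add: power2_eq_square algebra_simps)
    then show ?thesis
      unfolding ** using t p by (simp add: power2_eq_square power3_eq_cube divide_simps)
  qed
  finally have "((\<lambda>s. s / (s + \<bar>v\<bar>)\<^sup>2) has_real_derivative - dil t tkern v / t) (at t)" .
  moreover have "eventually (\<lambda>s. dil s tail v = s / (s + \<bar>v\<bar>)\<^sup>2) (nhds t)"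
    using eventually_nhds_in_open[of "{0<..}" t] t * by (auto elim!: eventually_mono)
  ultimately show "((\<lambda>s. dil s tail v) has_real_derivative - dil t tkern v / t) (at t)"
    by (subst DERIV_cong_ev[OF refl _ refl]) auto
qed

lemma abs_mult_le_squares: "\<bar>a * b\<bar> \<le> a\<^sup>2 + (b::real)\<^sup>2"
  using sum_squares_bound[of "\<bar>a\<bar>" "\<bar>b\<bar>"] abs_ge_zero[of "a * b"]
  by (simp only: abs_mult[symmetric] power2_abs mult.assoc)

text \<open>The bilinear form with convolution kernel \<open>l\<close>; it is only meaningful for square integrable arguments and
  integrable \<open>l\<close>.\<close>

definition quad :: "(real \<Rightarrow> real) \<Rightarrow> (real \<Rightarrow> real) \<Rightarrow> (real \<Rightarrow> real) \<Rightarrow> real" where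
  "quad l h k = (\<integral>p. h (fst p) * k (snd p) * l (fst p - snd p) \<partial>lborel)"

lemma nn_integral_quad:
  fixes h k l :: "real \<Rightarrow> real"
  assumes [measurable]: "h \<in> borel_measurable borel" "k \<in> borel_measurable borel" "l \<in> borel_measurable borel"
  shows "(\<integral>\<^sup>+p. ennreal \<bar>h (fst p) * k (snd p) * l (fst p - snd p)\<bar> \<partial>lborel)
    \<le> ((\<integral>\<^sup>+x. ennreal ((h x)\<^sup>2) \<partial>lborel) + (\<integral>\<^sup>+x. ennreal ((k x)\<^sup>2) \<partial>lborel)) * (\<integral>\<^sup>+v. ennreal \<bar>l v\<bar> \<partial>lborel)"
proof -
  let ?L = "\<integral>\<^sup>+v. ennreal \<bar>l v\<bar> \<partial>lborel"
  have sh: "(\<integral>\<^sup>+y. ennreal \<bar>l (x - y)\<bar> \<partial>lborel) = ?L" for x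
    using nn_integral_real_affine[of "\<lambda>v. ennreal \<bar>l v\<bar>" "-1" x] by simp
  have sh': "(\<integral>\<^sup>+x. ennreal \<bar>l (x - y)\<bar> \<partial>lborel) = ?L" for y
    using nn_integral_real_affine[of "\<lambda>v. ennreal \<bar>l v\<bar>" "1" "-y"] by simp
  have pt: "\<bar>a * b * c\<bar> \<le> a\<^sup>2 * \<bar>c\<bar> + b\<^sup>2 * \<bar>c\<bar>" for a b c :: real
  proof -
    have "\<bar>a * b\<bar> \<le> a\<^sup>2 + b\<^sup>2"
      by (rule abs_mult_le_squares)
    then show ?thesis
      by (simp add: abs_mult[of "a*b"] distrib_right[symmetric] mult_right_mono)
  qed
  have "(\<integral>\<^sup>+p. ennreal \<bar>h (fst p) * k (snd p) * l (fst p - snd p)\<bar> \<partial>lborel)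
    \<le> (\<integral>\<^sup>+p. ennreal ((h (fst p))\<^sup>2) * ennreal \<bar>l (fst p - snd p)\<bar>
        + ennreal ((k (snd p))\<^sup>2) * ennreal \<bar>l (fst p - snd p)\<bar> \<partial>lborel)"
    by (intro nn_integral_mono) (use pt in \<open>simp add: ennreal_mult'[symmetric] ennreal_plus[symmetric] del: ennreal_plus\<close>)
  also have "\<dots> = (\<integral>\<^sup>+p. ennreal ((h (fst p))\<^sup>2) * ennreal \<bar>l (fst p - snd p)\<bar> \<partial>lborel)
      + (\<integral>\<^sup>+p. ennreal ((k (snd p))\<^sup>2) * ennreal \<bar>l (fst p - snd p)\<bar> \<partial>lborel)"
    by (rule nn_integral_add) measurable
  also have "(\<integral>\<^sup>+p. ennreal ((h (fst p))\<^sup>2) * ennreal \<bar>l (fst p - snd p)\<bar> \<partial>lborel)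
     = (\<integral>\<^sup>+x. ennreal ((h x)\<^sup>2) * ?L \<partial>lborel)"
    by (subst nn_integral_lborel_fst[symmetric], measurable) (simp add: nn_integral_cmult sh)
  also have "(\<integral>\<^sup>+p. ennreal ((k (snd p))\<^sup>2) * ennreal \<bar>l (fst p - snd p)\<bar> \<partial>lborel)
     = (\<integral>\<^sup>+x. ennreal ((k x)\<^sup>2) * ?L \<partial>lborel)"
    by (subst nn_integral_lborel_snd[symmetric], measurable) (simp add: nn_integral_cmult sh')
  finally show ?thesis
    by (simp add: nn_integral_multc distrib_right)
qed

lemma nn_integral_sq_finite:
  fixes k :: "'a \<Rightarrow> real"
  assumes "integrable M (\<lambda>x. (k x)\<^sup>2)"
  shows "(\<integral>\<^sup>+x. ennreal ((k x)\<^sup>2) \<partial>M) < \<infinity>"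
  using assms unfolding integrable_iff_bounded by simp

lemma integrable_quad:
  fixes h k l :: "real \<Rightarrow> real"
  assumes "h \<in> borel_measurable borel" "k \<in> borel_measurable borel"
    "integrable lborel (\<lambda>x. (h x)\<^sup>2)" "integrable lborel (\<lambda>x. (k x)\<^sup>2)"
    and l: "l \<in> borel_measurable borel" "integrable lborel l"
  shows "integrable lborel (\<lambda>p. h (fst p) * k (snd p) * l (fst p - snd p))"
proof (rule integrableI_bounded)
  note [measurable] = assms(1,2) l(1)
  show "(\<lambda>p. h (fst p) * k (snd p) * l (fst p - snd p)) \<in> borel_measurable lborel"
    by measurable
  have "(\<integral>\<^sup>+v. ennreal \<bar>l v\<bar> \<partial>lborel) < \<infinity>"
    using l(2) unfolding integrable_iff_bounded by simp
  then show "(\<integral>\<^sup>+p. ennreal (norm (h (fst p) * k (snd p) * l (fst p - snd p))) \<partial>lborel) < \<infinity>"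
    using nn_integral_quad[OF assms(1,2) l(1)] nn_integral_sq_finite[OF assms(3)] nn_integral_sq_finite[OF assms(4)]
    by (simp add: le_less_trans ennreal_mult_less_top ennreal_add_less_top less_top)
qed

lemma rho_autocorrelation: "(\<integral>p. rho (a - p) * rho (b - p) \<partial>lborel) = rkern (a - b) / 4"
proof -
  have main: "(\<integral>p. rho (a - p) * rho (b - p) \<partial>lborel) = rkern (a - b) / 4" if "b \<le> a" for a b
  proof -
    define d where "d = a - b"
    have d: "0 \<le> d" using that by (simp add: d_def)
    have "(\<integral>p. rho (a - p) * rho (b - p) \<partial>lborel) = (\<integral>v. rho (a - (b - v)) * rho (b - (b - v)) \<partial>lborel)"
      by (rule integral_reflect(1)[symmetric])
    also have "\<dots> = (\<integral>v. indicator {0..} v * ((1 - v) * (1 - d - v) * exp (- 2 * v - d)) \<partial>lborel)"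
    proof (rule Bochner_Integration.integral_cong[OF refl])
      fix v
      have "exp (- (d + v)) * exp (- v) = exp (- 2 * v - d)"
        by (simp add: exp_add[symmetric])
      then show "rho (a - (b - v)) * rho (b - (b - v)) = indicator {0..} v * ((1 - v) * (1 - d - v) * exp (- 2 * v - d))"
        using d by (auto simp: rho_def indicator_def d_def algebra_simps)
    qed
    \<comment> \<open>The integrand has the primitive \<open>e\<^bsup>-2v-d\<^esup> (- v\<^sup>2/2 + (1-d) v/2 - (1-d)/4)\<close>, which vanishes at infinity.\<close>
    also have "\<dots> = 0 - exp (- 2 * 0 - d) * (- (0\<^sup>2) / 2 + (1 - d) / 2 * 0 - (1 - d) / 4)"
    proof (rule integral_FTC_at_top)
      show "((\<lambda>v. exp (- 2 * v - d) * (- (v\<^sup>2) / 2 + (1 - d) / 2 * v - (1 - d) / 4)) has_real_derivative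
          (1 - v) * (1 - d - v) * exp (- 2 * v - d)) (at v)" for v
        by (auto intro!: derivative_eq_intros simp: algebra_simps power2_eq_square)
          (simp add: field_simps)
      show "isCont (\<lambda>v. (1 - v) * (1 - d - v) * exp (- 2 * v - d)) v" for v
        by (intro continuous_intros)
      show "((\<lambda>v. exp (- 2 * v - d) * (- (v\<^sup>2) / 2 + (1 - d) / 2 * v - (1 - d) / 4)) \<longlongrightarrow> 0) at_top"
        by real_asymp
      have "integrable lborel (\<lambda>v. rho (d + v) * rho v)"
      proof (rule integrable_tail_bound(1))
        fix v
        have "\<bar>rho (d + v)\<bar> \<le> 18 * 1"
          using kern_tail_bounds(4)[of "d + v"] tail_le_one[of "d + v"] by linarith
        then show "\<bar>rho (d + v) * rho v\<bar> \<le> (18 * 18) * tail v"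
          using mult_mono[OF _ kern_tail_bounds(4)[of v], of "\<bar>rho (d + v)\<bar>" 18] by (simp add: abs_mult)
      qed measurable
      also have "(\<lambda>v. rho (d + v) * rho v) = (\<lambda>v. indicator {0..} v * ((1 - v) * (1 - d - v) * exp (- 2 * v - d)))"
      proof
        fix v
        have "exp (- (d + v)) * exp (- v) = exp (- 2 * v - d)"
          by (simp add: exp_add[symmetric])
        then show "rho (d + v) * rho v = indicator {0..} v * ((1 - v) * (1 - d - v) * exp (- 2 * v - d))"
          using d by (auto simp: rho_def indicator_def algebra_simps)
      qed
      finally show "integrable lborel (\<lambda>v. indicator {0..} v * ((1 - v) * (1 - d - v) * exp (- 2 * v - d)))" .
    qed
    also have "\<dots> = rkern (a - b) / 4"
      using d by (simp add: rkern_def flip: d_def)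
    finally show ?thesis .
  qed
  show ?thesis
  proof (cases "b \<le> a")
    case False
    then show ?thesis
      using main[of a b] by (simp add: mult.commute rkern_def abs_minus_commute)
  qed (rule main)
qed

text \<open>Writing \<open>rkern\<close> as an autocorrelation of \<open>rho\<close> turns the form into
  \<open>\<integral> (\<integral> k(x) rho(x/t - p) dx)\<^sup>2 dp\<close>, up to a positive factor.\<close>

lemma rkern_psd:
  assumes [measurable]: "k \<in> borel_measurable borel" and k: "integrable lborel (\<lambda>x. (k x)\<^sup>2)" and t: "0 < t"
  shows "0 \<le> quad (dil t rkern) k k"
proof -
  have rint: "integrable lborel rho" "(\<integral>\<^sup>+v. ennreal \<bar>rho v\<bar> \<partial>lborel) < \<infinity>"
    using integrable_tail_bound[OF measurable_kerns(4) kern_tail_bounds(4)] by (auto intro: le_less_trans)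
  let ?R = "\<integral>\<^sup>+v. ennreal \<bar>rho v\<bar> \<partial>lborel" and ?N = "\<integral>\<^sup>+x. ennreal ((k x)\<^sup>2) \<partial>lborel"
  let ?r = "\<lambda>p x. rho (x / t - p)"
  have sx: "(\<integral>\<^sup>+x. ennreal \<bar>?r p x\<bar> \<partial>lborel) = ennreal t * ?R" for p
  proof -
    have "?R = ennreal \<bar>1 / t\<bar> * (\<integral>\<^sup>+x. ennreal \<bar>rho (- p + 1 / t * x)\<bar> \<partial>lborel)"
      by (rule nn_integral_real_affine) (use t in auto)
    then have "ennreal t * ?R = (ennreal t * ennreal (1 / t)) * (\<integral>\<^sup>+x. ennreal \<bar>?r p x\<bar> \<partial>lborel)"
      using t by (simp add: mult.assoc)
    also have "ennreal t * ennreal (1 / t) = 1"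
      using t by (simp add: ennreal_mult[symmetric])
    finally show ?thesis by simp
  qed
  have sp: "(\<integral>\<^sup>+p. ennreal \<bar>?r p x\<bar> \<partial>lborel) = ?R" for x
    using nn_integral_real_affine[of "\<lambda>v. ennreal \<bar>rho v\<bar>" "-1" "x / t"] by simp
  define G where "G = (\<lambda>(p, q). k (fst q) * ?r p (fst q) * (k (snd q) * ?r p (snd q)))"
  have [measurable]: "G \<in> borel_measurable borel"
    unfolding G_def case_prod_beta' by measurable
  have T1: "(\<integral>\<^sup>+p. \<integral>\<^sup>+q. ennreal ((k (fst q))\<^sup>2) * ennreal \<bar>?r p (fst q)\<bar> * ennreal \<bar>?r p (snd q)\<bar> \<partial>lborel \<partial>lborel) = ?N * ?R * (ennreal t * ?R)"
  proof -
    have "(\<integral>\<^sup>+q. ennreal ((k (fst q))\<^sup>2) * ennreal \<bar>?r p (fst q)\<bar> * ennreal \<bar>?r p (snd q)\<bar> \<partial>lborel)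
      = (\<integral>\<^sup>+x. ennreal ((k x)\<^sup>2) * ennreal \<bar>?r p x\<bar> * (ennreal t * ?R) \<partial>lborel)" for p
      by (subst nn_integral_lborel_fst[symmetric], measurable) (simp add: nn_integral_cmult sx)
    then have "(\<integral>\<^sup>+p. \<integral>\<^sup>+q. ennreal ((k (fst q))\<^sup>2) * ennreal \<bar>?r p (fst q)\<bar> * ennreal \<bar>?r p (snd q)\<bar> \<partial>lborel \<partial>lborel)
      = (\<integral>\<^sup>+p. \<integral>\<^sup>+x. ennreal ((k x)\<^sup>2) * ennreal \<bar>?r p x\<bar> * (ennreal t * ?R) \<partial>lborel \<partial>lborel)"
      by simp
    also have "\<dots> = (\<integral>\<^sup>+x. \<integral>\<^sup>+p. ennreal ((k x)\<^sup>2) * ennreal \<bar>?r p x\<bar> * (ennreal t * ?R) \<partial>lborel \<partial>lborel)"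
      by (rule nn_integral_lborel_swap) (unfold case_prod_beta', measurable)
    also have "\<dots> = ?N * ?R * (ennreal t * ?R)"
      by (simp add: nn_integral_multc nn_integral_cmult sp)
    finally show ?thesis .
  qed
  have T2: "(\<integral>\<^sup>+p. \<integral>\<^sup>+q. ennreal ((k (snd q))\<^sup>2) * ennreal \<bar>?r p (snd q)\<bar> * ennreal \<bar>?r p (fst q)\<bar> \<partial>lborel \<partial>lborel) = ?N * ?R * (ennreal t * ?R)"
  proof -
    have "(\<integral>\<^sup>+q. ennreal ((k (snd q))\<^sup>2) * ennreal \<bar>?r p (snd q)\<bar> * ennreal \<bar>?r p (fst q)\<bar> \<partial>lborel)
      = (\<integral>\<^sup>+q. ennreal ((k (fst q))\<^sup>2) * ennreal \<bar>?r p (fst q)\<bar> * ennreal \<bar>?r p (snd q)\<bar> \<partial>lborel)" for p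
    proof -
      have m: "(\<lambda>q. ennreal ((k (snd q))\<^sup>2) * ennreal \<bar>?r p (snd q)\<bar> * ennreal \<bar>?r p (fst q)\<bar>) \<in> borel_measurable borel"
        "(\<lambda>q. ennreal ((k (fst q))\<^sup>2) * ennreal \<bar>?r p (fst q)\<bar> * ennreal \<bar>?r p (snd q)\<bar>) \<in> borel_measurable borel"
        by measurable
      show ?thesis
        using nn_integral_lborel_snd[OF m(1)] nn_integral_lborel_fst[OF m(2)] by simp
    qed
    then show ?thesis using T1 by simp
  qed
  have i: "integrable lborel G"
  proof (rule integrableI_bounded)
    have "(\<integral>\<^sup>+w. ennreal (norm (G w)) \<partial>lborel) = (\<integral>\<^sup>+p. \<integral>\<^sup>+q. ennreal \<bar>G (p, q)\<bar> \<partial>lborel \<partial>lborel)"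
      by (subst nn_integral_lborel_fst[symmetric]) auto
    also have "\<dots> \<le> (\<integral>\<^sup>+p. \<integral>\<^sup>+q. (ennreal ((k (fst q))\<^sup>2) * ennreal \<bar>?r p (fst q)\<bar> * ennreal \<bar>?r p (snd q)\<bar>
        + ennreal ((k (snd q))\<^sup>2) * ennreal \<bar>?r p (snd q)\<bar> * ennreal \<bar>?r p (fst q)\<bar>) \<partial>lborel \<partial>lborel)"
    proof (intro nn_integral_mono)
      fix p q
      have "\<bar>a * b * (c * d)\<bar> \<le> a\<^sup>2 * \<bar>b\<bar> * \<bar>d\<bar> + c\<^sup>2 * \<bar>d\<bar> * \<bar>b\<bar>" for a b c d :: real
      proof -
        have "\<bar>a * c\<bar> \<le> a\<^sup>2 + c\<^sup>2"
          by (rule abs_mult_le_squares)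
        then have "\<bar>a * c\<bar> * \<bar>b * d\<bar> \<le> (a\<^sup>2 + c\<^sup>2) * \<bar>b * d\<bar>"
          by (rule mult_right_mono) simp
        then show ?thesis
          by (simp add: abs_mult distrib_right distrib_left mult_ac)
      qed
      from this[of "k (fst q)" "?r p (fst q)" "k (snd q)" "?r p (snd q)"]
      show "ennreal \<bar>G (p, q)\<bar> \<le> ennreal ((k (fst q))\<^sup>2) * ennreal \<bar>?r p (fst q)\<bar> * ennreal \<bar>?r p (snd q)\<bar>
        + ennreal ((k (snd q))\<^sup>2) * ennreal \<bar>?r p (snd q)\<bar> * ennreal \<bar>?r p (fst q)\<bar>"
        by (simp add: G_def ennreal_mult'[symmetric] ennreal_plus[symmetric] del: ennreal_plus)
    qed
    also have "\<dots> = ?N * ?R * (ennreal t * ?R) + ?N * ?R * (ennreal t * ?R)"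
    proof -
      have "(\<integral>\<^sup>+p. \<integral>\<^sup>+q. (ennreal ((k (fst q))\<^sup>2) * ennreal \<bar>?r p (fst q)\<bar> * ennreal \<bar>?r p (snd q)\<bar>
        + ennreal ((k (snd q))\<^sup>2) * ennreal \<bar>?r p (snd q)\<bar> * ennreal \<bar>?r p (fst q)\<bar>) \<partial>lborel \<partial>lborel)
        = (\<integral>\<^sup>+p. (\<integral>\<^sup>+q. ennreal ((k (fst q))\<^sup>2) * ennreal \<bar>?r p (fst q)\<bar> * ennreal \<bar>?r p (snd q)\<bar> \<partial>lborel)
        + (\<integral>\<^sup>+q. ennreal ((k (snd q))\<^sup>2) * ennreal \<bar>?r p (snd q)\<bar> * ennreal \<bar>?r p (fst q)\<bar> \<partial>lborel) \<partial>lborel)"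
        by (intro nn_integral_cong nn_integral_add) measurable
      also have "\<dots> = (\<integral>\<^sup>+p. \<integral>\<^sup>+q. ennreal ((k (fst q))\<^sup>2) * ennreal \<bar>?r p (fst q)\<bar> * ennreal \<bar>?r p (snd q)\<bar> \<partial>lborel \<partial>lborel)
        + (\<integral>\<^sup>+p. \<integral>\<^sup>+q. ennreal ((k (snd q))\<^sup>2) * ennreal \<bar>?r p (snd q)\<bar> * ennreal \<bar>?r p (fst q)\<bar> \<partial>lborel \<partial>lborel)"
        by (rule nn_integral_add) measurable
      finally show ?thesis unfolding T1 T2 .
    qed
    also have "\<dots> < \<infinity>"
      using rint(2) nn_integral_sq_finite[OF k] by (simp add: ennreal_mult_less_top ennreal_mult_eq_top_iff less_top[symmetric])
    finally show "(\<integral>\<^sup>+w. ennreal (norm (G w)) \<partial>lborel) < \<infinity>" .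
  qed measurable
  have "(\<integral>q. \<integral>p. G (p, q) \<partial>lborel \<partial>lborel) = (\<integral>q. (t / 4) * (k (fst q) * k (snd q) * dil t rkern (fst q - snd q)) \<partial>lborel)"
  proof (rule Bochner_Integration.integral_cong[OF refl])
    fix q :: "real \<times> real"
    have "(\<integral>p. G (p, q) \<partial>lborel) = (k (fst q) * k (snd q)) * (\<integral>p. ?r p (fst q) * ?r p (snd q) \<partial>lborel)"
      by (subst integral_mult_right_zero[symmetric]) (simp add: G_def mult_ac)
    then show "(\<integral>p. G (p, q) \<partial>lborel) = (t / 4) * (k (fst q) * k (snd q) * dil t rkern (fst q - snd q))"
      using t by (simp add: rho_autocorrelation dil_def diff_divide_distrib)
  qed
  then have "(t / 4) * quad (dil t rkern) k k = (\<integral>p. \<integral>q. G (p, q) \<partial>lborel \<partial>lborel)"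
    using integral_lborel_fst[OF i] integral_lborel_snd[OF i] by (simp add: quad_def)
  also have "\<dots> \<ge> 0"
  proof (rule integral_nonneg_AE)
    show "AE p in lborel. 0 \<le> (\<integral>q. G (p, q) \<partial>lborel)"
      using AE_integrable_lborel_fst[OF i]
    proof eventually_elim
      case (elim p)
      have "(\<integral>q. G (p, q) \<partial>lborel) = (\<integral>x. \<integral>y. k x * ?r p x * (k y * ?r p y) \<partial>lborel \<partial>lborel)"
        using integral_lborel_fst[OF elim] by (simp add: G_def)
      also have "\<dots> = (\<integral>x. k x * ?r p x \<partial>lborel)\<^sup>2"
        by (simp add: power2_eq_square)
      finally show ?case by simp
    qed
  qed
  finally show ?thesis
    using t by (simp add: zero_le_mult_iff)
qed


text \<open>This is \<open>tail(s) = \<integral>\<^sub>0\<^sup>\<infinity> a e\<^bsup>-a\<^esup> e\<^bsup>-a s\<^esup> da\<close> after applying \<open>d/ds (s \<cdot>)\<close> on both sides.\<close>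

lemma tkern_superposition:
  assumes s: "0 \<le> s"
  shows "(\<integral>\<alpha>. indicator {0..} \<alpha> * (\<alpha> * exp (- \<alpha>) * rkern (\<alpha> * s)) \<partial>lborel) = (1 - s) / (1 + s) ^ 3"
proof -
  let ?S = "1 + s"
  have S: "0 < ?S" using s by simp
  have D: "((\<lambda>v. exp (- (v * S)) * (A * v\<^sup>2 + B * v + C)) has_real_derivative
      exp (- (v * S)) * ((A * (2 * v) + B) - S * (A * v\<^sup>2 + B * v + C))) (at v)" for A B C S v :: real
    by (auto intro!: derivative_eq_intros simp: algebra_simps)
  have "(\<integral>\<alpha>. indicator {0..} \<alpha> * (\<alpha> * exp (- \<alpha>) * rkern (\<alpha> * s)) \<partial>lborel)
    = (\<integral>\<alpha>. indicator {0..} \<alpha> * ((\<alpha> - s * \<alpha>\<^sup>2) * exp (- (\<alpha> * ?S))) \<partial>lborel)"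
  proof (rule Bochner_Integration.integral_cong[OF refl])
    fix \<alpha> :: real
    have "exp (- \<alpha>) * exp (- (\<alpha> * s)) = exp (- (\<alpha> * ?S))"
      by (simp add: exp_add[symmetric] algebra_simps)
    then show "indicator {0..} \<alpha> * (\<alpha> * exp (- \<alpha>) * rkern (\<alpha> * s)) = indicator {0..} \<alpha> * ((\<alpha> - s * \<alpha>\<^sup>2) * exp (- (\<alpha> * ?S)))"
      using s by (auto simp: rkern_def indicator_def abs_mult power2_eq_square algebra_simps)
  qed
  \<comment> \<open>The coefficients of the primitive \<open>e\<^bsup>-\<alpha>(1+s)\<^esup> (a \<alpha>\<^sup>2 + b \<alpha> + c)\<close> are found by comparing powers of \<open>\<alpha>\<close>.\<close>
  also have "\<dots> = 0 - exp (- (0 * ?S)) * (s / ?S * 0\<^sup>2 + (2 * s / ?S - 1) / ?S * 0 + (s - 1) / ?S ^ 3)"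
  proof (rule integral_FTC_at_top)
    fix v :: real assume v: "0 \<le> v"
    have e: "(s / ?S * (2 * v) + (2 * s / ?S - 1) / ?S) - ?S * (s / ?S * v\<^sup>2 + (2 * s / ?S - 1) / ?S * v + (s - 1) / ?S ^ 3)
       = v - s * v\<^sup>2"
    proof -
      define T where "T = ?S"
      have T: "T \<noteq> 0" "s = T - 1" using S by (auto simp: T_def)
      show ?thesis
        unfolding T_def[symmetric] using T(1) by (simp add: T(2) field_simps power2_eq_square power3_eq_cube)
    qed
    have "((\<lambda>v. exp (- (v * ?S)) * (s / ?S * v\<^sup>2 + (2 * s / ?S - 1) / ?S * v + (s - 1) / ?S ^ 3)) has_real_derivative
       exp (- (v * ?S)) * ((s / ?S * (2 * v) + (2 * s / ?S - 1) / ?S) - ?S * (s / ?S * v\<^sup>2 + (2 * s / ?S - 1) / ?S * v + (s - 1) / ?S ^ 3))) (at v)"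
      by (rule D)
    then show "((\<lambda>v. exp (- (v * ?S)) * (s / ?S * v\<^sup>2 + (2 * s / ?S - 1) / ?S * v + (s - 1) / ?S ^ 3)) has_real_derivative
       (v - s * v\<^sup>2) * exp (- (v * ?S))) (at v)"
      unfolding e by (simp only: mult.commute)
    show "isCont (\<lambda>v. (v - s * v\<^sup>2) * exp (- (v * ?S))) v"
      by (intro continuous_intros)
  next
    show "((\<lambda>v. exp (- (v * ?S)) * (s / ?S * v\<^sup>2 + (2 * s / ?S - 1) / ?S * v + (s - 1) / ?S ^ 3)) \<longlongrightarrow> 0) at_top"
      using S by real_asymp
    have "integrable lborel (\<lambda>v. indicator {0..} v * (v * exp (- v) * rkern (v * s)))"
    proof (rule integrable_tail_bound(1))
      fix v :: real
      have r: "\<bar>rkern (v * s)\<bar> \<le> 18"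
        using kern_tail_bounds(2)[of "v * s"] tail_le_one[of "v * s"] by linarith
      have e: "\<bar>indicator {0..} v * (v * exp (- v))\<bar> \<le> 18 * tail v"
        by (rule exp_tail_bound) (auto simp: indicator_def abs_mult intro!: mult_right_mono)
      have "\<bar>indicator {0..} v * (v * exp (- v))\<bar> * \<bar>rkern (v * s)\<bar> \<le> (18 * tail v) * 18"
        by (rule mult_mono[OF e r]) auto
      then show "\<bar>indicator {0..} v * (v * exp (- v) * rkern (v * s))\<bar> \<le> 324 * tail v"
        by (simp add: abs_mult mult_ac)
    qed measurable
    also have "(\<lambda>v. indicator {0..} v * (v * exp (- v) * rkern (v * s))) = (\<lambda>v. indicator {0..} v * ((v - s * v\<^sup>2) * exp (- (v * ?S))))"
    proof
      fix \<alpha> :: real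
      have "exp (- \<alpha>) * exp (- (\<alpha> * s)) = exp (- (\<alpha> * ?S))"
        by (simp add: exp_add[symmetric] algebra_simps)
      then show "indicator {0..} \<alpha> * (\<alpha> * exp (- \<alpha>) * rkern (\<alpha> * s)) = indicator {0..} \<alpha> * ((\<alpha> - s * \<alpha>\<^sup>2) * exp (- (\<alpha> * ?S)))"
        using s by (auto simp: rkern_def indicator_def abs_mult power2_eq_square algebra_simps)
    qed
    finally show "integrable lborel (\<lambda>v. indicator {0..} v * ((v - s * v\<^sup>2) * exp (- (v * ?S))))" .
  qed
  also have "\<dots> = (1 - s) / (1 + s) ^ 3"
    using S by (simp add: diff_divide_distrib)
  finally show ?thesis .
qed

text \<open>A superposition of dilates of \<open>rkern\<close> with positive coefficients inherits semidefiniteness from it.\<close>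

lemma tkern_psd:
  assumes [measurable]: "k \<in> borel_measurable borel" and k: "integrable lborel (\<lambda>x. (k x)\<^sup>2)" and t: "0 < t"
  shows "0 \<le> quad (dil t tkern) k k"
proof -
  let ?e = "\<lambda>\<alpha>. indicator {0..} \<alpha> * exp (- \<alpha>)"
  define G where "G = (\<lambda>(\<alpha>, q). ?e \<alpha> * (k (fst q) * k (snd q) * dil (t / \<alpha>) rkern (fst q - snd q)))"
  let ?R = "\<integral>\<^sup>+v. ennreal \<bar>rkern v\<bar> \<partial>lborel" and ?N = "\<integral>\<^sup>+x. ennreal ((k x)\<^sup>2) \<partial>lborel"
  have [measurable]: "G \<in> borel_measurable borel"
    unfolding G_def case_prod_beta' by measurable
  have R: "?R < \<infinity>"
    using integrable_tail_bound(2)[OF measurable_kerns(2) kern_tail_bounds(2)] by (auto intro: le_less_trans)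
  have Rs: "(\<integral>\<^sup>+v. ennreal \<bar>dil s rkern v\<bar> \<partial>lborel) = ?R" if "0 < s" for s
    using nn_integral_dil[of "\<lambda>v. \<bar>rkern v\<bar>" s 1 0] that by (simp add: dil_def)
  have i: "integrable lborel G"
  proof (rule integrableI_bounded)
    have "(\<integral>\<^sup>+w. ennreal (norm (G w)) \<partial>lborel) = (\<integral>\<^sup>+\<alpha>. \<integral>\<^sup>+q. ennreal \<bar>G (\<alpha>, q)\<bar> \<partial>lborel \<partial>lborel)"
      by (subst nn_integral_lborel_fst[symmetric]) auto
    also have "\<dots> \<le> (\<integral>\<^sup>+\<alpha>. ennreal (?e \<alpha>) * ((?N + ?N) * ?R) \<partial>lborel)"
    proof (rule nn_integral_mono)
      fix \<alpha> :: real
      let ?Q = "\<integral>\<^sup>+q. ennreal \<bar>k (fst q) * k (snd q) * dil (t / \<alpha>) rkern (fst q - snd q)\<bar> \<partial>lborel"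
      have "(\<integral>\<^sup>+q. ennreal \<bar>G (\<alpha>, q)\<bar> \<partial>lborel) = (\<integral>\<^sup>+q. ennreal (?e \<alpha>) * ennreal \<bar>k (fst q) * k (snd q) * dil (t / \<alpha>) rkern (fst q - snd q)\<bar> \<partial>lborel)"
        by (intro nn_integral_cong) (simp add: G_def abs_mult ennreal_mult'[symmetric])
      also have "\<dots> = ennreal (?e \<alpha>) * ?Q"
        by (rule nn_integral_cmult) measurable
      also have "\<dots> \<le> ennreal (?e \<alpha>) * ((?N + ?N) * ?R)"
      proof (cases "0 < \<alpha>")
        case True
        have "?Q \<le> (?N + ?N) * (\<integral>\<^sup>+v. ennreal \<bar>dil (t / \<alpha>) rkern v\<bar> \<partial>lborel)"
          by (rule nn_integral_quad) measurable
        then show ?thesis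
          using t True by (intro mult_left_mono) (auto simp: Rs)
      next
        case False
        then have "\<alpha> < 0 \<or> \<alpha> = 0" by auto
        then show ?thesis
          by (auto simp: dil_def)
      qed
      finally show "(\<integral>\<^sup>+q. ennreal \<bar>G (\<alpha>, q)\<bar> \<partial>lborel) \<le> ennreal (?e \<alpha>) * ((?N + ?N) * ?R)" .
    qed
    also have "\<dots> = (\<integral>\<^sup>+\<alpha>. ennreal (?e \<alpha>) \<partial>lborel) * ((?N + ?N) * ?R)"
      by (rule nn_integral_multc) measurable
    also have "\<dots> < \<infinity>"
    proof -
      have "(\<integral>\<^sup>+\<alpha>. ennreal (?e \<alpha>) \<partial>lborel) \<le> (\<integral>\<^sup>+\<alpha>. ennreal \<bar>ekern \<alpha>\<bar> \<partial>lborel)"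
        by (intro nn_integral_mono ennreal_leI) (auto simp: ekern_def indicator_def)
      also have "\<dots> < \<infinity>"
        using integrable_tail_bound(2)[OF measurable_kerns(1) kern_tail_bounds(1)] by (auto intro: le_less_trans)
      finally show ?thesis
        using R nn_integral_sq_finite[OF k] by (simp add: ennreal_mult_less_top ennreal_mult_eq_top_iff less_top[symmetric])
    qed
    finally show "(\<integral>\<^sup>+w. ennreal (norm (G w)) \<partial>lborel) < \<infinity>" .
  qed measurable
  have "(\<integral>q. \<integral>\<alpha>. G (\<alpha>, q) \<partial>lborel \<partial>lborel) = quad (dil t tkern) k k"
    unfolding quad_def
  proof (rule Bochner_Integration.integral_cong[OF refl])
    fix q :: "real \<times> real"
    let ?v = "fst q - snd q"
    have "(\<integral>\<alpha>. G (\<alpha>, q) \<partial>lborel)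
      = (\<integral>\<alpha>. (k (fst q) * k (snd q) / t) * (indicator {0..} \<alpha> * (\<alpha> * exp (- \<alpha>) * rkern (\<alpha> * (\<bar>?v\<bar> / t)))) \<partial>lborel)"
    proof (rule Bochner_Integration.integral_cong[OF refl])
      fix \<alpha> :: real
      have "rkern (?v / (t / \<alpha>)) = rkern (\<alpha> * (\<bar>?v\<bar> / t))"
        using t by (simp add: rkern_def abs_mult mult.commute)
      then show "G (\<alpha>, q) = (k (fst q) * k (snd q) / t) * (indicator {0..} \<alpha> * (\<alpha> * exp (- \<alpha>) * rkern (\<alpha> * (\<bar>?v\<bar> / t))))"
        by (simp add: G_def dil_def mult_ac)
    qed
    also have "\<dots> = (k (fst q) * k (snd q) / t) * ((1 - \<bar>?v\<bar> / t) / (1 + \<bar>?v\<bar> / t) ^ 3)"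
      using t by (simp only: integral_mult_right_zero tkern_superposition[of "\<bar>?v\<bar> / t"] divide_nonneg_pos abs_ge_zero)
    also have "\<dots> = k (fst q) * k (snd q) * dil t tkern ?v"
      using t by (simp add: dil_def tkern_def)
    finally show "(\<integral>\<alpha>. G (\<alpha>, q) \<partial>lborel) = k (fst q) * k (snd q) * dil t tkern ?v" .
  qed
  then have "quad (dil t tkern) k k = (\<integral>\<alpha>. \<integral>q. G (\<alpha>, q) \<partial>lborel \<partial>lborel)"
    using integral_lborel_fst[OF i] integral_lborel_snd[OF i] by simp
  also have "\<dots> = (\<integral>\<alpha>. ?e \<alpha> * quad (dil (t / \<alpha>) rkern) k k \<partial>lborel)"
    by (simp add: G_def quad_def)
  also have "\<dots> \<ge> 0"
  proof (rule Bochner_Integration.integral_nonneg)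
    fix \<alpha> :: real
    consider "0 < \<alpha>" | "\<alpha> = 0" | "\<alpha> < 0" by linarith
    then show "0 \<le> ?e \<alpha> * quad (dil (t / \<alpha>) rkern) k k"
    proof cases
      case 1
      then show ?thesis
        using rkern_psd[OF assms(1) k, of "t / \<alpha>"] t by simp
    next
      case 2
      then show ?thesis by (simp add: quad_def dil_def)
    qed simp
  qed
  finally show ?thesis .
qed

definition psd_kernel :: "(real \<Rightarrow> real) \<Rightarrow> bool" where
  "psd_kernel l \<longleftrightarrow> l \<in> borel_measurable borel \<and> integrable lborel l \<and> (\<forall>v. l (- v) = l v) \<and>
    (\<forall>k. k \<in> borel_measurable borel \<longrightarrow> integrable lborel (\<lambda>x. (k x)\<^sup>2) \<longrightarrow> 0 \<le> quad l k k)"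

lemma psd_kernel_rkern: "0 < t \<Longrightarrow> psd_kernel (dil t rkern)"
proof -
  assume t: "0 < t"
  have "integrable lborel rkern"
    by (rule integrable_tail_bound(1)[OF measurable_kerns(2) kern_tail_bounds(2)])
  then have "integrable lborel (\<lambda>v. rkern (0 + 1 / t * v) / t)"
    using t by (intro integrable_divide lborel_integrable_real_affine) auto
  also have "(\<lambda>v. rkern (0 + 1 / t * v) / t) = dil t rkern"
    by (auto simp: dil_def fun_eq_iff)
  finally have "integrable lborel (dil t rkern)" .
  then show ?thesis
    using rkern_psd[OF _ _ t] unfolding psd_kernel_def by (auto simp: dil_def rkern_def)
qed

lemma quad_commute:
  assumes "\<And>v. l (- v) = l v" and [measurable]: "h \<in> borel_measurable borel" "k \<in> borel_measurable borel" "l \<in> borel_measurable borel"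
  shows "quad l h k = quad l k h"
proof -
  have "quad l h k = (\<integral>(x, y). h y * k x * l (y - x) \<partial>(lborel \<Otimes>\<^sub>M lborel))"
    unfolding quad_def lborel_prod[symmetric]
    by (subst lborel_pair.integral_product_swap[symmetric]) (auto simp: case_prod_beta')
  also have "\<dots> = quad l k h"
    unfolding quad_def lborel_prod
  proof (rule Bochner_Integration.integral_cong[OF refl])
    fix p :: "real \<times> real"
    show "(case p of (x, y) \<Rightarrow> h y * k x * l (y - x)) = k (fst p) * h (snd p) * l (fst p - snd p)"
      using assms(1)[of "fst p - snd p"] by (simp add: case_prod_beta')
  qed
  finally show ?thesis .
qed

text \<open>The form with the arithmetic mean, which comes from semidefiniteness on \<open>h + k\<close> and \<open>h - k\<close>; only the sum of
  the two quadratic terms is controlled later on.\<close>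

lemma quad_Cauchy_Schwarz:
  assumes l: "psd_kernel l"
    and h: "h \<in> borel_measurable borel" "integrable lborel (\<lambda>x. (h x)\<^sup>2)"
    and k: "k \<in> borel_measurable borel" "integrable lborel (\<lambda>x. (k x)\<^sup>2)"
  shows "\<bar>quad l h k\<bar> \<le> (quad l h h + quad l k k) / 2"
proof -
  note [measurable] = h(1) k(1)
  have lm [measurable]: "l \<in> borel_measurable borel" and li: "integrable lborel l"
    and ev: "\<And>v. l (- v) = l v"
    and psd: "\<And>k. k \<in> borel_measurable borel \<Longrightarrow> integrable lborel (\<lambda>x. (k x)\<^sup>2) \<Longrightarrow> 0 \<le> quad l k k"
    using l by (auto simp: psd_kernel_def)
  have hk: "integrable lborel (\<lambda>x. h x * k x)"
    by (rule Bochner_Integration.integrable_bound[OF Bochner_Integration.integrable_add[OF h(2) k(2)]])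
      (use abs_mult_le_squares in auto)
  have *: "quad l (\<lambda>x. h x + s * k x) (\<lambda>x. h x + s * k x) = quad l h h + 2 * s * quad l h k + quad l k k" if s: "s\<^sup>2 = 1" for s :: real
  proof -
    have "quad l (\<lambda>x. h x + s * k x) (\<lambda>x. h x + s * k x)
      = (\<integral>p. h (fst p) * h (snd p) * l (fst p - snd p) + s * (h (fst p) * k (snd p) * l (fst p - snd p))
         + s * (k (fst p) * h (snd p) * l (fst p - snd p)) + s\<^sup>2 * (k (fst p) * k (snd p) * l (fst p - snd p)) \<partial>lborel)"
      unfolding quad_def by (rule Bochner_Integration.integral_cong) (simp_all add: algebra_simps power2_eq_square)
    also have "\<dots> = quad l h h + s * quad l h k + s * quad l k h + s\<^sup>2 * quad l k k"
      unfolding quad_def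
      by (simp only: Bochner_Integration.integral_add integral_mult_right_zero Bochner_Integration.integrable_add integrable_mult_right
        integrable_quad[OF h(1) h(1) h(2) h(2) lm li] integrable_quad[OF h(1) k(1) h(2) k(2) lm li]
        integrable_quad[OF k(1) h(1) k(2) h(2) lm li] integrable_quad[OF k(1) k(1) k(2) k(2) lm li])
    also have "quad l k h = quad l h k"
      by (rule quad_commute) (use ev in auto)
    finally show ?thesis using s by simp
  qed
  have "0 \<le> quad l (\<lambda>x. h x + s * k x) (\<lambda>x. h x + s * k x)" for s :: real
  proof (rule psd)
    have "integrable lborel (\<lambda>x. (h x)\<^sup>2 + 2 * s * (h x * k x) + s\<^sup>2 * (k x)\<^sup>2)"
      using h k hk by simp
    then show "integrable lborel (\<lambda>x. (h x + s * k x)\<^sup>2)"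
      by (simp add: power2_sum power_mult_distrib algebra_simps)
  qed measurable
  from this[of 1] this[of "-1"] show ?thesis
    using *[of 1] *[of "-1"] by simp
qed

lemma quad_reflect:
  assumes l: "psd_kernel l"
    and h: "h \<in> borel_measurable borel" "integrable lborel (\<lambda>x. (h x)\<^sup>2)"
  shows "quad l (\<lambda>x. h (c - x)) (\<lambda>x. h (c - x)) = quad l h h"
proof -
  note [measurable] = h(1)
  have lm [measurable]: "l \<in> borel_measurable borel" and li: "integrable lborel l"
    and ev: "\<And>v. l (- v) = l v"
    using l by (auto simp: psd_kernel_def)
  have hr: "(\<lambda>x. h (c - x)) \<in> borel_measurable borel" by measurable
  have hi: "integrable lborel (\<lambda>x. (h (c - x))\<^sup>2)"
    using integral_reflect(2)[of "\<lambda>x. (h x)\<^sup>2" c] h(2) by simp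
  have "quad l (\<lambda>x. h (c - x)) (\<lambda>x. h (c - x)) = (\<integral>x. \<integral>y. h (c - x) * h (c - y) * l (x - y) \<partial>lborel \<partial>lborel)"
    unfolding quad_def using integral_lborel_fst[OF integrable_quad[OF hr hr hi hi lm li]] by simp
  also have "\<dots> = (\<integral>x. \<integral>y. h (c - x) * h y * l (x - (c - y)) \<partial>lborel \<partial>lborel)"
  proof (rule Bochner_Integration.integral_cong[OF refl])
    fix x
    show "(\<integral>y. h (c - x) * h (c - y) * l (x - y) \<partial>lborel) = (\<integral>y. h (c - x) * h y * l (x - (c - y)) \<partial>lborel)"
      using integral_reflect(1)[of "\<lambda>y. h (c - x) * h y * l (x - (c - y))" c] by simp
  qed
  also have "\<dots> = (\<integral>x. \<integral>y. h x * h y * l ((c - x) - (c - y)) \<partial>lborel \<partial>lborel)"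
    using integral_reflect(1)[of "\<lambda>x. \<integral>y. h x * h y * l ((c - x) - (c - y)) \<partial>lborel" c] by simp
  also have "\<dots> = (\<integral>x. \<integral>y. h x * h y * l (x - y) \<partial>lborel \<partial>lborel)"
    using ev[of "_ - _"] by simp
  also have "\<dots> = quad l h h"
    unfolding quad_def using integral_lborel_fst[OF integrable_quad[OF h(1) h(1) h(2) h(2) lm li]] by simp
  finally show ?thesis .
qed

text \<open>Fixing the convolution variable \<open>b\<close>, the integral becomes \<open>quad l\<close> of \<open>k\<close> and of the function \<open>h\<close>
  reflected about a point depending on \<open>b\<close>.  The reflection does not change \<open>quad l h h\<close>, so the
  Cauchy--Schwarz bound is uniform in \<open>b\<close>.  This is the step that separates the two functions.\<close>

lemma quad_convolution_bound:
  assumes l: "psd_kernel l" and V: "V \<in> borel_measurable borel" "(\<integral>\<^sup>+b. ennreal \<bar>V b\<bar> \<partial>lborel) \<le> ennreal A" "0 \<le> A"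
    and h: "h \<in> borel_measurable borel" "integrable lborel (\<lambda>x. (h x)\<^sup>2)"
    and k: "k \<in> borel_measurable borel" "integrable lborel (\<lambda>x. (k x)\<^sup>2)"
    and N: "\<And>m. N m = (\<integral>b. V b * l (m - b) \<partial>lborel)"
  shows "\<bar>\<integral>p. h (snd p) * k (fst p) * N (c - fst p - snd p) \<partial>lborel\<bar> \<le> A * ((quad l h h + quad l k k) / 2)"
proof -
  note [measurable] = V(1) h(1) k(1)
  have lm [measurable]: "l \<in> borel_measurable borel" and li: "integrable lborel l"
    and ev: "\<And>v. l (- v) = l v"
    using l by (auto simp: psd_kernel_def)
  define G where "G = (\<lambda>(b, p). V b * (h (snd p) * k (fst p) * l (c - b - fst p - snd p)))"
  have [measurable]: "G \<in> borel_measurable borel"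
    unfolding G_def case_prod_beta' by measurable
  let ?hr = "\<lambda>b y. h (c - b - y)"
  have hr [measurable]: "?hr b \<in> borel_measurable borel" for b by measurable
  have hi: "integrable lborel (\<lambda>x. (?hr b x)\<^sup>2)" for b
    using integral_reflect(2)[of "\<lambda>x. (h x)\<^sup>2" "c - b"] h(2) by simp
  let ?H = "\<integral>\<^sup>+x. ennreal ((h x)\<^sup>2) \<partial>lborel" and ?K = "\<integral>\<^sup>+x. ennreal ((k x)\<^sup>2) \<partial>lborel"
    and ?L = "\<integral>\<^sup>+v. ennreal \<bar>l v\<bar> \<partial>lborel"
  have Hr: "(\<integral>\<^sup>+y. ennreal ((?hr b y)\<^sup>2) \<partial>lborel) = ?H" for b
    using nn_integral_real_affine[of "\<lambda>y. ennreal ((h y)\<^sup>2)" "-1" "c - b"] by simp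
  have nn: "(\<integral>\<^sup>+p. ennreal \<bar>h (snd p) * k (fst p) * l (c - b - fst p - snd p)\<bar> \<partial>lborel) \<le> (?K + ?H) * ?L" for b
  proof -
    have "(\<integral>\<^sup>+p. ennreal \<bar>h (snd p) * k (fst p) * l (c - b - fst p - snd p)\<bar> \<partial>lborel)
      = (\<integral>\<^sup>+x. \<integral>\<^sup>+y. ennreal \<bar>h y * k x * l (c - b - x - y)\<bar> \<partial>lborel \<partial>lborel)"
      by (subst nn_integral_lborel_fst[symmetric]) auto
    also have "\<dots> = (\<integral>\<^sup>+x. \<integral>\<^sup>+y. ennreal \<bar>k x * ?hr b y * l (x - y)\<bar> \<partial>lborel \<partial>lborel)"
    proof (rule nn_integral_cong)
      fix x
      have "(\<integral>\<^sup>+y. ennreal \<bar>h y * k x * l (c - b - x - y)\<bar> \<partial>lborel)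
        = ennreal \<bar>-1\<bar> * (\<integral>\<^sup>+y. ennreal \<bar>h ((c - b) + (-1) * y) * k x * l (c - b - x - ((c - b) + (-1) * y))\<bar> \<partial>lborel)"
        by (rule nn_integral_real_affine) auto
      also have "\<dots> = (\<integral>\<^sup>+y. ennreal \<bar>k x * ?hr b y * l (x - y)\<bar> \<partial>lborel)"
        using ev[of "x - _"] by (simp add: mult_ac)
      finally show "(\<integral>\<^sup>+y. ennreal \<bar>h y * k x * l (c - b - x - y)\<bar> \<partial>lborel) = (\<integral>\<^sup>+y. ennreal \<bar>k x * ?hr b y * l (x - y)\<bar> \<partial>lborel)" .
    qed
    also have "\<dots> = (\<integral>\<^sup>+p. ennreal \<bar>k (fst p) * ?hr b (snd p) * l (fst p - snd p)\<bar> \<partial>lborel)"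
      by (subst nn_integral_lborel_fst[symmetric]) auto
    also have "\<dots> \<le> (?K + ?H) * ?L"
      using nn_integral_quad[of k "?hr b" l] by (simp add: Hr)
    finally show ?thesis .
  qed
  have Lfin: "?L < \<infinity>"
    using li unfolding integrable_iff_bounded by simp
  have i: "integrable lborel G"
  proof (rule integrableI_bounded)
    have "(\<integral>\<^sup>+w. ennreal (norm (G w)) \<partial>lborel) = (\<integral>\<^sup>+b. \<integral>\<^sup>+p. ennreal \<bar>V b\<bar> * ennreal \<bar>h (snd p) * k (fst p) * l (c - b - fst p - snd p)\<bar> \<partial>lborel \<partial>lborel)"
      by (subst nn_integral_lborel_fst[symmetric]) (auto simp: G_def abs_mult ennreal_mult'[symmetric] intro!: nn_integral_cong)
    also have "\<dots> \<le> (\<integral>\<^sup>+b. ennreal \<bar>V b\<bar> * ((?K + ?H) * ?L) \<partial>lborel)"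
      by (intro nn_integral_mono, subst nn_integral_cmult) (auto intro!: mult_left_mono nn)
    also have "\<dots> = (\<integral>\<^sup>+b. ennreal \<bar>V b\<bar> \<partial>lborel) * ((?K + ?H) * ?L)"
      by (rule nn_integral_multc) measurable
    also have "\<dots> < \<infinity>"
      using Lfin nn_integral_sq_finite[OF h(2)] nn_integral_sq_finite[OF k(2)] le_less_trans[OF V(2) ennreal_less_top]
      by (simp add: ennreal_mult_less_top ennreal_mult_eq_top_iff less_top[symmetric])
    finally show "(\<integral>\<^sup>+w. ennreal (norm (G w)) \<partial>lborel) < \<infinity>" .
  qed measurable
  have inner: "(\<integral>p. h (snd p) * k (fst p) * l (c - b - fst p - snd p) \<partial>lborel) = quad l k (?hr b)" for b
  proof -
    have "integrable lborel (\<lambda>p. h (snd p) * k (fst p) * l (c - b - fst p - snd p))"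
    proof (rule integrableI_bounded)
      have "(?K + ?H) * ?L < \<infinity>"
        using Lfin nn_integral_sq_finite[OF h(2)] nn_integral_sq_finite[OF k(2)]
        by (simp add: ennreal_mult_less_top ennreal_mult_eq_top_iff less_top[symmetric])
      with nn[of b] show "(\<integral>\<^sup>+p. ennreal (norm (h (snd p) * k (fst p) * l (c - b - fst p - snd p))) \<partial>lborel) < \<infinity>"
        by (auto intro: le_less_trans)
    qed measurable
    from integral_lborel_fst[OF this]
    have "(\<integral>p. h (snd p) * k (fst p) * l (c - b - fst p - snd p) \<partial>lborel)
      = (\<integral>x. \<integral>y. h y * k x * l (c - b - x - y) \<partial>lborel \<partial>lborel)" by simp
    also have "\<dots> = (\<integral>x. \<integral>y. k x * ?hr b y * l (x - y) \<partial>lborel \<partial>lborel)"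
    proof (rule Bochner_Integration.integral_cong[OF refl])
      fix x
      have "(\<integral>y. h y * k x * l (c - b - x - y) \<partial>lborel) = (\<integral>y. h (c - b - y) * k x * l (c - b - x - (c - b - y)) \<partial>lborel)"
        by (rule integral_reflect(1)[symmetric])
      also have "\<dots> = (\<integral>y. k x * ?hr b y * l (x - y) \<partial>lborel)"
        using ev[of "x - _"] by (simp add: mult_ac)
      finally show "(\<integral>y. h y * k x * l (c - b - x - y) \<partial>lborel) = (\<integral>y. k x * ?hr b y * l (x - y) \<partial>lborel)" .
    qed
    also have "\<dots> = quad l k (?hr b)"
      unfolding quad_def using integral_lborel_fst[OF integrable_quad[OF k(1) hr k(2) hi lm li]] by simp
    finally show ?thesis .
  qed
  let ?Q = "(quad l h h + quad l k k) / 2"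
  have qb: "\<bar>quad l k (?hr b)\<bar> \<le> ?Q" for b
    using quad_Cauchy_Schwarz[OF l k hr hi, of b] quad_reflect[OF l h, of "c - b"] by simp
  have Q0: "0 \<le> ?Q"
    using qb[of 0] abs_ge_zero order_trans by blast
  have "(\<integral>p. h (snd p) * k (fst p) * N (c - fst p - snd p) \<partial>lborel) = (\<integral>p. \<integral>b. G (b, p) \<partial>lborel \<partial>lborel)"
  proof (rule Bochner_Integration.integral_cong[OF refl])
    fix p :: "real \<times> real"
    show "h (snd p) * k (fst p) * N (c - fst p - snd p) = (\<integral>b. G (b, p) \<partial>lborel)"
      unfolding N by (subst integral_mult_right_zero[symmetric]) (simp add: G_def algebra_simps)
  qed
  also have "\<dots> = (\<integral>b. \<integral>p. G (b, p) \<partial>lborel \<partial>lborel)"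
    using integral_lborel_fst[OF i] integral_lborel_snd[OF i] by simp
  also have "\<dots> = (\<integral>b. V b * quad l k (?hr b) \<partial>lborel)"
    by (simp add: G_def inner)
  also have "\<bar>\<dots>\<bar> \<le> A * ?Q"
  proof (rule abs_integral_le)
    have "(\<integral>\<^sup>+b. ennreal \<bar>V b * quad l k (?hr b)\<bar> \<partial>lborel) \<le> (\<integral>\<^sup>+b. ennreal \<bar>V b\<bar> * ennreal ?Q \<partial>lborel)"
    proof (rule nn_integral_mono)
      fix b
      have "\<bar>V b * quad l k (?hr b)\<bar> \<le> \<bar>V b\<bar> * ?Q"
        unfolding abs_mult by (rule mult_left_mono[OF qb]) simp
      then have "ennreal \<bar>V b * quad l k (?hr b)\<bar> \<le> ennreal (\<bar>V b\<bar> * ?Q)"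
        by (rule ennreal_leI)
      also have "\<dots> = ennreal \<bar>V b\<bar> * ennreal ?Q"
        by (rule ennreal_mult') simp
      finally show "ennreal \<bar>V b * quad l k (?hr b)\<bar> \<le> ennreal \<bar>V b\<bar> * ennreal ?Q" .
    qed
    also have "\<dots> = (\<integral>\<^sup>+b. ennreal \<bar>V b\<bar> \<partial>lborel) * ennreal ?Q"
      by (rule nn_integral_multc) measurable
    also have "\<dots> \<le> ennreal A * ennreal ?Q"
      by (intro mult_right_mono V) simp
    also have "\<dots> = ennreal (A * ?Q)"
      using V Q0 by (intro ennreal_mult[symmetric]) auto
    finally show "(\<integral>\<^sup>+b. ennreal \<bar>V b * quad l k (?hr b)\<bar> \<partial>lborel) \<le> ennreal (A * ?Q)" .
  qed (use V Q0 in simp)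
  finally show ?thesis .
qed

section \<open>The estimate for a single function\<close>

text \<open>The semidefinite forms are applied to products of two slices.  They are square integrable only almost
  everywhere: a positive weight in the difference of the two parameters makes the total integral finite.\<close>

lemma AE_square_integrable:
  assumes [measurable]: "case_prod G \<in> borel_measurable (borel \<Otimes>\<^sub>M borel)" and fin: "fourth G < \<infinity>"
  shows "AE q in lborel. integrable lborel (\<lambda>v. (G (fst q) v * G (snd q) v)\<^sup>2)"
proof -
  let ?w = "\<lambda>q. ennreal (dil 1 tail (fst q - snd q))"
  let ?g = "\<lambda>a v. ennreal (G a v ^ 4)"
  have w1: "(\<integral>\<^sup>+b. ?w (a, b) \<partial>lborel) = 2" for a
    using nn_integral_dil_tail[of 1 "-1" a] by simp
  have w2: "(\<integral>\<^sup>+a. ?w (a, b) \<partial>lborel) = 2" for b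
    using nn_integral_dil_tail[of 1 "1" "-b"] by simp
  have e1: "(\<integral>\<^sup>+b. ennreal (dil 1 tail (a - b)) * c \<partial>lborel) = 2 * c" for a c
    by (subst nn_integral_multc) (simp_all add: w1[simplified])
  have e2: "(\<integral>\<^sup>+a. ennreal (dil 1 tail (a - b)) * c \<partial>lborel) = 2 * c" for b c
    by (subst nn_integral_multc) (simp_all add: w2[simplified])
  have w0: "0 < dil 1 tail v" for v by (simp add: dil_def)
  have "(\<integral>\<^sup>+q. ?w q * (\<integral>\<^sup>+v. ennreal ((G (fst q) v * G (snd q) v)\<^sup>2) \<partial>lborel) \<partial>lborel)
     \<le> (\<integral>\<^sup>+q. ?w q * (\<integral>\<^sup>+v. ?g (fst q) v \<partial>lborel) + ?w q * (\<integral>\<^sup>+v. ?g (snd q) v \<partial>lborel) \<partial>lborel)"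
  proof (rule nn_integral_mono)
    fix q :: "real \<times> real"
    have "(\<integral>\<^sup>+v. ennreal ((G (fst q) v * G (snd q) v)\<^sup>2) \<partial>lborel) \<le> (\<integral>\<^sup>+v. ?g (fst q) v + ?g (snd q) v \<partial>lborel)"
    proof (rule nn_integral_mono)
      fix v
      have "(a * b)\<^sup>2 \<le> a ^ 4 + b ^ 4" for a b :: real
        using abs_mult_le_squares[of "a\<^sup>2" "b\<^sup>2"] by (simp add: power_mult_distrib power_mult[symmetric])
      then show "ennreal ((G (fst q) v * G (snd q) v)\<^sup>2) \<le> ?g (fst q) v + ?g (snd q) v"
        by (simp add: ennreal_plus[symmetric] ennreal_leI del: ennreal_plus)
    qed
    also have "\<dots> = (\<integral>\<^sup>+v. ?g (fst q) v \<partial>lborel) + (\<integral>\<^sup>+v. ?g (snd q) v \<partial>lborel)"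
      by (rule nn_integral_add) measurable
    finally show "?w q * (\<integral>\<^sup>+v. ennreal ((G (fst q) v * G (snd q) v)\<^sup>2) \<partial>lborel)
       \<le> ?w q * (\<integral>\<^sup>+v. ?g (fst q) v \<partial>lborel) + ?w q * (\<integral>\<^sup>+v. ?g (snd q) v \<partial>lborel)"
      by (simp add: distrib_left[symmetric] mult_left_mono)
  qed
  also have "\<dots> = (\<integral>\<^sup>+q. ?w q * (\<integral>\<^sup>+v. ?g (fst q) v \<partial>lborel) \<partial>lborel) + (\<integral>\<^sup>+q. ?w q * (\<integral>\<^sup>+v. ?g (snd q) v \<partial>lborel) \<partial>lborel)"
    by (rule nn_integral_add) measurable
  also have "(\<integral>\<^sup>+q. ?w q * (\<integral>\<^sup>+v. ?g (fst q) v \<partial>lborel) \<partial>lborel) = 2 * fourth G"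
  proof -
    have m: "(\<lambda>q. ?w q * (\<integral>\<^sup>+v. ?g (fst q) v \<partial>lborel)) \<in> borel_measurable borel" by measurable
    have "(\<integral>\<^sup>+q. ?w q * (\<integral>\<^sup>+v. ?g (fst q) v \<partial>lborel) \<partial>lborel) = (\<integral>\<^sup>+a. 2 * (\<integral>\<^sup>+v. ?g a v \<partial>lborel) \<partial>lborel)"
      unfolding nn_integral_lborel_fst[OF m, symmetric]
      by (rule nn_integral_cong) (simp only: e1 fst_conv snd_conv)
    then show ?thesis
      by (simp add: fourth_def nn_integral_cmult)
  qed
  also have "(\<integral>\<^sup>+q. ?w q * (\<integral>\<^sup>+v. ?g (snd q) v \<partial>lborel) \<partial>lborel) = 2 * fourth G"
  proof -
    have m: "(\<lambda>q. ?w q * (\<integral>\<^sup>+v. ?g (snd q) v \<partial>lborel)) \<in> borel_measurable borel" by measurable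
    have "(\<integral>\<^sup>+q. ?w q * (\<integral>\<^sup>+v. ?g (snd q) v \<partial>lborel) \<partial>lborel) = (\<integral>\<^sup>+a. 2 * (\<integral>\<^sup>+v. ?g a v \<partial>lborel) \<partial>lborel)"
      unfolding nn_integral_lborel_snd[OF m, symmetric]
      by (rule nn_integral_cong) (simp only: e2 fst_conv snd_conv)
    then show ?thesis
      by (simp add: fourth_def nn_integral_cmult)
  qed
  also have "2 * fourth G + 2 * fourth G < \<infinity>"
    using fin by (simp add: ennreal_mult_less_top)
  finally have "AE q in lborel. ?w q * (\<integral>\<^sup>+v. ennreal ((G (fst q) v * G (snd q) v)\<^sup>2) \<partial>lborel) \<noteq> \<infinity>"
    by (intro nn_integral_PInf_AE) (auto simp: less_top)
  then show ?thesis
  proof eventually_elim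
    case (elim q)
    have "(\<integral>\<^sup>+v. ennreal ((G (fst q) v * G (snd q) v)\<^sup>2) \<partial>lborel) < \<infinity>"
      using elim w0[of "fst q - snd q"] by (auto simp: ennreal_mult_eq_top_iff less_top[symmetric])
    then show ?case
      by (intro integrableI_bounded) auto
  qed
qed

lemma integrable_cyc_kernel:
  assumes [measurable]: "case_prod f \<in> borel_measurable (borel \<Otimes>\<^sub>M borel)"
    "case_prod g \<in> borel_measurable (borel \<Otimes>\<^sub>M borel)" "K \<in> borel_measurable borel"
    and t: "0 < t" and \<sigma>: "\<bar>\<sigma>\<bar> = 1"
    and B: "fourth f + fourth g \<le> ennreal B" "0 \<le> B"
    and K: "\<And>p. \<bar>K p\<bar> \<le> C * (dil t tail (gap p) * dil t tail (slant \<theta> \<sigma> p))" and C: "0 \<le> C"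
  shows "integrable lborel (\<lambda>p. cyc f g p * K p)"
  using le_less_trans[OF nn_integral_cyc_kernel[OF assms(1,2) t \<sigma> B K C] ennreal_less_top]
  by (intro integrableI_bounded) auto

text \<open>For one function the four-cycle is symmetric, so the form can be read either as a quadratic form in \<open>x\<close>
  with parameters \<open>z, z'\<close> or as one in \<open>z\<close> with parameters \<open>x, x'\<close>.\<close>

lemma integral_cyc_quad:
  assumes gm [measurable]: "case_prod g \<in> borel_measurable (borel \<Otimes>\<^sub>M borel)"
    and i: "integrable lborel (\<lambda>p. cyc g g p * (W (gap p) * l (slant 0 1 p)))"
  shows "(\<integral>p. cyc g g p * (W (gap p) * l (slant 0 1 p)) \<partial>lborel)
      = (\<integral>q. W (fst q - snd q) * quad l (\<lambda>x. g (fst q) x * g (snd q) x) (\<lambda>x. g (fst q) x * g (snd q) x) \<partial>lborel)"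
    "integrable lborel (\<lambda>q. W (fst q - snd q) * quad l (\<lambda>x. g (fst q) x * g (snd q) x) (\<lambda>x. g (fst q) x * g (snd q) x))"
    "(\<integral>p. cyc g g p * (W (gap p) * l (slant 0 1 p)) \<partial>lborel)
      = (\<integral>r. l (fst r - snd r) * quad W (\<lambda>z. g z (fst r) * g z (snd r)) (\<lambda>z. g z (fst r) * g z (snd r)) \<partial>lborel)"
proof -
  have 1: "(\<integral>r. cyc g g (q, r) * (W (gap (q, r)) * l (slant 0 1 (q, r))) \<partial>lborel)
     = W (fst q - snd q) * quad l (\<lambda>x. g (fst q) x * g (snd q) x) (\<lambda>x. g (fst q) x * g (snd q) x)" for q
    unfolding quad_def
    by (subst integral_mult_right_zero[symmetric]) (simp add: cyc_def gap_def slant_def mult_ac)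
  have 2: "(\<integral>q. cyc g g (q, r) * (W (gap (q, r)) * l (slant 0 1 (q, r))) \<partial>lborel)
     = l (fst r - snd r) * quad W (\<lambda>z. g z (fst r) * g z (snd r)) (\<lambda>z. g z (fst r) * g z (snd r))" for r
    unfolding quad_def
    by (subst integral_mult_right_zero[symmetric]) (simp add: cyc_def gap_def slant_def mult_ac)
  show "(\<integral>p. cyc g g p * (W (gap p) * l (slant 0 1 p)) \<partial>lborel)
      = (\<integral>q. W (fst q - snd q) * quad l (\<lambda>x. g (fst q) x * g (snd q) x) (\<lambda>x. g (fst q) x * g (snd q) x) \<partial>lborel)"
    using integral_lborel_fst[OF i] unfolding 1 by simp
  show "integrable lborel (\<lambda>q. W (fst q - snd q) * quad l (\<lambda>x. g (fst q) x * g (snd q) x) (\<lambda>x. g (fst q) x * g (snd q) x))"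
    using integrable_lborel_fst[OF i] unfolding 1 .
  show "(\<integral>p. cyc g g p * (W (gap p) * l (slant 0 1 p)) \<partial>lborel)
      = (\<integral>r. l (fst r - snd r) * quad W (\<lambda>z. g z (fst r) * g z (snd r)) (\<lambda>z. g z (fst r) * g z (snd r)) \<partial>lborel)"
    using integral_lborel_snd[OF i] unfolding 2 by simp
qed

lemma fourth_swap:
  assumes [measurable]: "case_prod g \<in> borel_measurable (borel \<Otimes>\<^sub>M borel)"
  shows "fourth (\<lambda>x z. g z x) = fourth g"
  unfolding fourth_def by (rule nn_integral_lborel_swap) (unfold borel_prod[symmetric], measurable)

text \<open>The kernel is one of the two terms in the scale derivative of \<open>tail \<otimes> ekern\<close>.  The other term, with \<open>tkern\<close> in the gap and
  \<open>ekern\<close> in \<open>x - x'\<close>, is nonnegative when the form is read in the variables \<open>z, z'\<close>, so it may be dropped.\<close>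

lemma one_function_estimate:
  assumes gm [measurable]: "case_prod g \<in> borel_measurable (borel \<Otimes>\<^sub>M borel)"
    and t: "0 < t0" "t0 \<le> t1" and B: "fourth g \<le> ennreal B" "0 \<le> B"
  shows "(\<integral>t. indicator {t0..t1} t / t *
      (\<integral>p. cyc g g p * (dil t tail (gap p) * dil t rkern (slant 0 1 p)) \<partial>lborel) \<partial>lborel) \<le> 144 * B"
    and "integrable lborel (\<lambda>t. indicator {t0..t1} t / t *
      (\<integral>p. cyc g g p * (dil t tail (gap p) * dil t rkern (slant 0 1 p)) \<partial>lborel))"
proof -
  have B2: "fourth g + fourth g \<le> ennreal (2 * B)" "0 \<le> 2 * B"
    using add_mono[OF B(1) B(1)] B(2) by (simp_all flip: ennreal_plus)
  note sp1 = scale_pairD[OF scale_pair_tail] and sp2 = scale_pairD[OF scale_pair_ekern]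
  have bnd: "\<bar>a * b\<bar> \<le> 18 * (c * d)" if "\<bar>a\<bar> \<le> 1 * c" "\<bar>b\<bar> \<le> 18 * d" for a b c d :: real
    using mult_mono[OF that] that by (simp add: abs_mult mult_ac)
  let ?k1 = "\<lambda>t p. dil t tkern (gap p) * dil t ekern (slant 0 1 p)"
  let ?k2 = "\<lambda>t p. dil t tail (gap p) * dil t rkern (slant 0 1 p)"
  have k1: "\<bar>?k1 t p\<bar> \<le> 18 * (dil t tail (gap p) * dil t tail (slant 0 1 p))"
    and k2: "\<bar>?k2 t p\<bar> \<le> 18 * (dil t tail (gap p) * dil t tail (slant 0 1 p))" if "0 < t" for t p
    using bnd[OF sp1(11)[OF that] sp2(10)[OF that]] bnd[OF sp1(10)[OF that] sp2(11)[OF that]] by blast+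
  have one: "\<bar>1::real\<bar> = 1" by simp
  have i1: "integrable lborel (\<lambda>p. cyc g g p * ?k1 t p)" and i2: "integrable lborel (\<lambda>p. cyc g g p * ?k2 t p)" if "0 < t" for t
    by (rule integrable_cyc_kernel[OF gm gm _ that one B2 k1[OF that]]; simp)
      (rule integrable_cyc_kernel[OF gm gm _ that one B2 k2[OF that]]; simp)
  have slab: "integrable lborel (\<lambda>(t, p). indicator {t0..t1} t / t * (cyc g g p * ?k1 t p))"
    "integrable lborel (\<lambda>(t, p). indicator {t0..t1} t / t * (cyc g g p * ?k2 t p))"
  proof -
    have n1: "(\<integral>\<^sup>+p. ennreal \<bar>cyc g g p * ?k1 t p\<bar> \<partial>lborel) \<le> ennreal (2 * 18 * (2 * B))"
      and n2: "(\<integral>\<^sup>+p. ennreal \<bar>cyc g g p * ?k2 t p\<bar> \<partial>lborel) \<le> ennreal (2 * 18 * (2 * B))" if "t0 \<le> t" for t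
    proof -
      have t': "0 < t" using that t by simp
      show "(\<integral>\<^sup>+p. ennreal \<bar>cyc g g p * ?k1 t p\<bar> \<partial>lborel) \<le> ennreal (2 * 18 * (2 * B))"
        by (rule nn_integral_cyc_kernel[OF gm gm t' one B2 k1[OF t']]) simp
      show "(\<integral>\<^sup>+p. ennreal \<bar>cyc g g p * ?k2 t p\<bar> \<partial>lborel) \<le> ennreal (2 * 18 * (2 * B))"
        by (rule nn_integral_cyc_kernel[OF gm gm t' one B2 k2[OF t']]) simp
    qed
    show "integrable lborel (\<lambda>(t, p). indicator {t0..t1} t / t * (cyc g g p * ?k1 t p))"
      by (rule integrable_slab[OF _ t(1) n1]) (unfold case_prod_beta', measurable)
    show "integrable lborel (\<lambda>(t, p). indicator {t0..t1} t / t * (cyc g g p * ?k2 t p))"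
      by (rule integrable_slab[OF _ t(1) n2]) (unfold case_prod_beta', measurable)
  qed
  let ?J1 = "\<lambda>t. indicator {t0..t1} t / t * (\<integral>p. cyc g g p * ?k1 t p \<partial>lborel)"
  let ?J2 = "\<lambda>t. indicator {t0..t1} t / t * (\<integral>p. cyc g g p * ?k2 t p \<partial>lborel)"
  have J: "integrable lborel ?J1" "integrable lborel ?J2"
    using integrable_lborel_fst[OF slab(1)] integrable_lborel_fst[OF slab(2)] by simp_all
  show "integrable lborel ?J2" by fact
  have "0 \<le> (\<integral>t. ?J1 t \<partial>lborel)"
  proof (rule Bochner_Integration.integral_nonneg)
    fix t :: real
    show "0 \<le> ?J1 t"
    proof (cases "t \<in> {t0..t1}")
      case True
      then have t': "0 < t" using t by simp
      have fin: "fourth (\<lambda>x z. g z x) < \<infinity>"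
        unfolding fourth_swap[OF gm] using B(1) by (auto intro: le_less_trans)
      have gm': "case_prod (\<lambda>x z. g z x) \<in> borel_measurable (borel \<Otimes>\<^sub>M borel)" by measurable
      have "0 \<le> (\<integral>p. cyc g g p * ?k1 t p \<partial>lborel)"
        unfolding integral_cyc_quad(3)[OF gm i1[OF t']]
      proof (rule integral_nonneg_AE)
        show "AE r in lborel. 0 \<le> dil t ekern (fst r - snd r) * quad (dil t tkern) (\<lambda>z. g z (fst r) * g z (snd r)) (\<lambda>z. g z (fst r) * g z (snd r))"
          using AE_square_integrable[OF gm' fin]
        proof eventually_elim
          case (elim r)
          have "0 \<le> quad (dil t tkern) (\<lambda>z. g z (fst r) * g z (snd r)) (\<lambda>z. g z (fst r) * g z (snd r))"
            by (rule tkern_psd[OF _ elim t']) measurable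
          then show ?case
            using t' by (simp add: dil_def ekern_def)
        qed
      qed
      then show ?thesis using t' by simp
    qed simp
  qed
  moreover have "\<bar>\<integral>t. ?J1 t + ?J2 t \<partial>lborel\<bar> \<le> 144 * B"
  proof -
    have "(\<integral>t. ?J1 t + ?J2 t \<partial>lborel) = (\<integral>t. indicator {t0..t1} t / t * (\<integral>p. cyc g g p * (?k1 t p + ?k2 t p) \<partial>lborel) \<partial>lborel)"
    proof (rule Bochner_Integration.integral_cong[OF refl])
      fix t :: real
      show "?J1 t + ?J2 t = indicator {t0..t1} t / t * (\<integral>p. cyc g g p * (?k1 t p + ?k2 t p) \<partial>lborel)"
      proof (cases "t \<in> {t0..t1}")
        case True
        then have t': "0 < t" using t by simp
        have "(\<integral>p. cyc g g p * (?k1 t p + ?k2 t p) \<partial>lborel) = (\<integral>p. cyc g g p * ?k1 t p \<partial>lborel) + (\<integral>p. cyc g g p * ?k2 t p \<partial>lborel)"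
          by (subst Bochner_Integration.integral_add[OF i1[OF t'] i2[OF t'], symmetric]) (simp add: distrib_left)
        then show ?thesis by (simp add: distrib_left add_divide_distrib)
      qed simp
    qed
    then show ?thesis
      using telescoping_cyc[OF gm gm t one B2 scale_pair_tail scale_pair_ekern, of 0] by simp
  qed
  ultimately show "(\<integral>t. ?J2 t \<partial>lborel) \<le> 144 * B"
    using J by simp
qed

section \<open>Even functions of mean zero as convolutions\<close>

lemma tendsto_antiderivative:
  fixes F f :: "real \<Rightarrow> real"
  assumes F: "\<And>v. (F has_real_derivative f v) (at v)"
    and cont: "\<And>v. isCont f v" and int: "integrable lborel f"
  shows "(F \<longlongrightarrow> F 0 + (\<integral>v. indicator {0..} v * f v \<partial>lborel)) at_top"
proof -
  let ?g = "\<lambda>v. indicator {0..} v * f v"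
  have "integrable lborel ?g"
    using integrable_mult_indicator[of "{0..}", OF _ int] by simp
  then have 1: "((\<lambda>y. F 0 + (\<integral>x. indicator {..y} x *\<^sub>R ?g x \<partial>lborel)) \<longlongrightarrow> F 0 + (\<integral>x. ?g x \<partial>lborel)) at_top"
    by (intro tendsto_intros tendsto_integral_at_top) auto
  have eq: "F 0 + (\<integral>x. indicator {..y} x *\<^sub>R ?g x \<partial>lborel) = F y" if "0 \<le> y" for y
  proof -
    have "(\<integral>x. indicator {..y} x *\<^sub>R ?g x \<partial>lborel) = (\<integral>x. f x * indicator {0..y} x \<partial>lborel)"
      by (rule Bochner_Integration.integral_cong) (auto simp: indicator_def)
    also have "\<dots> = F y - F 0"
      by (rule integral_FTC_Icc_real[OF that]) (use F cont in auto)
    finally show ?thesis by simp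
  qed
  show ?thesis
    by (rule Lim_transform_eventually[OF 1])
      (use eq in \<open>auto intro!: eventually_mono[OF eventually_ge_at_top[of 0]]\<close>)
qed

lemma antiderivative_exists:
  fixes f :: "real \<Rightarrow> real"
  assumes "\<And>v. isCont f v"
  obtains F where "F 0 = 0" "\<And>v. (F has_real_derivative f v) (at v)"
proof -
  define F where "F = (\<lambda>u. interval_lebesgue_integral lborel (ereal 0) (ereal u) f)"
  have "(F has_real_derivative f v) (at v)" for v
  proof -
    let ?a = "- \<bar>v\<bar> - 1" and ?b = "\<bar>v\<bar> + 1"
    have "(F has_vector_derivative f v) (at v within {?a..?b})"
      unfolding F_def
      by (rule interval_integral_FTC2) (use assms in \<open>auto intro: continuous_at_imp_continuous_on\<close>)
    moreover have "at v within {?a..?b} = at v"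
      by (rule at_within_interior) (auto simp: interior_atLeastAtMost_real)
    ultimately show ?thesis
      by (simp add: has_real_derivative_iff_has_vector_derivative)
  qed
  moreover have "F 0 = 0"
    unfolding F_def by simp
  ultimately show ?thesis
    using that by blast
qed

text \<open>Both \<open>G - F\<close> and \<open>G + F\<close> decrease to \<open>0\<close>.\<close>

lemma antiderivative_bound:
  fixes F G f g :: "real \<Rightarrow> real"
  assumes F: "\<And>v. (F has_real_derivative f v) (at v)"
    and G: "\<And>v. 0 \<le> v \<Longrightarrow> (G has_real_derivative - g v) (at v)"
    and le: "\<And>v. 0 \<le> v \<Longrightarrow> \<bar>f v\<bar> \<le> g v"
    and lim: "(F \<longlongrightarrow> 0) at_top" "(G \<longlongrightarrow> 0) at_top" and v: "0 \<le> v"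
  shows "\<bar>F v\<bar> \<le> G v"
proof -
  have nn: "0 \<le> H v" if H: "\<And>v. 0 \<le> v \<Longrightarrow> (H has_real_derivative h v) (at v)" "\<And>v. 0 \<le> v \<Longrightarrow> h v \<le> 0"
     "(H \<longlongrightarrow> 0) at_top" for H h :: "real \<Rightarrow> real"
  proof (rule tendsto_upperbound[OF H(3)])
    show "\<forall>\<^sub>F w in at_top. H w \<le> H v"
      using eventually_ge_at_top[of v]
    proof eventually_elim
      case (elim w)
      show ?case
      proof (rule DERIV_nonpos_imp_nonincreasing[OF elim])
        fix x assume "v \<le> x"
        with v have "0 \<le> x" by simp
        then show "\<exists>y. (H has_real_derivative y) (at x) \<and> y \<le> 0"
          using H(1,2) by blast
      qed
    qed
  qed simp
  have "0 \<le> G v - F v"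
  proof (rule nn[where h = "\<lambda>v. - g v - f v"])
    show "((\<lambda>v. G v - F v) has_real_derivative - g w - f w) (at w)" if "0 \<le> w" for w
      using G[OF that] F[of w] by (intro derivative_intros)
    show "- g w - f w \<le> 0" if "0 \<le> w" for w
      using le[OF that] by linarith
    show "((\<lambda>v. G v - F v) \<longlongrightarrow> 0) at_top"
      using tendsto_diff[OF lim(2) lim(1)] by simp
  qed
  moreover have "0 \<le> G v + F v"
  proof (rule nn[where h = "\<lambda>v. - g v + f v"])
    show "((\<lambda>v. G v + F v) has_real_derivative - g w + f w) (at w)" if "0 \<le> w" for w
      using G[OF that] F[of w] by (intro derivative_intros)
    show "- g w + f w \<le> 0" if "0 \<le> w" for w
      using le[OF that] by linarith
    show "((\<lambda>v. G v + F v) \<longlongrightarrow> 0) at_top"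
      using tendsto_add[OF lim(2) lim(1)] by simp
  qed
  ultimately show ?thesis by linarith
qed

lemma DERIV_zero_imp_eq:
  fixes F :: "real \<Rightarrow> real"
  assumes "\<And>v. (F has_real_derivative 0) (at v)"
  shows "F v = F 0"
  using DERIV_isconst_all[of F] assms by blast

lemma DERIV_affine_compose:
  fixes F :: "real \<Rightarrow> real"
  assumes "\<And>v. (F has_real_derivative f v) (at v)"
  shows "((\<lambda>v. F (m + s * v)) has_real_derivative s * f (m + s * v)) (at v)"
proof -
  have "((\<lambda>v. F (m + s * v)) has_real_derivative f (m + s * v) * s) (at v)"
    by (rule DERIV_chain2[OF assms]) (auto intro!: derivative_eq_intros)
  then show ?thesis by (simp add: mult.commute)
qed

lemma inverse_power_le_tail:
  assumes "2 \<le> n"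
  shows "1 / (1 + \<bar>v\<bar>) ^ n \<le> tail v"
  unfolding tail_def using assms by (intro divide_left_mono power_increasing) auto

text \<open>Let \<open>T'' = N\<close>.  Since \<open>N\<close> is even with integral \<open>0\<close>, both \<open>T'\<close> and \<open>T\<close> can be made to vanish at
  infinity, which costs two powers of decay.  On the Fourier side \<open>N\<close> corresponds to \<open>- \<xi>\<^sup>2 T\<close> and \<open>rkern\<close> to
  \<open>4 \<xi>\<^sup>2 / (1 + \<xi>\<^sup>2)\<^sup>2\<close>, so \<open>V = - (1 - \<partial>\<^sup>2)\<^sup>2 T / 4 = - (T - 2 N + N'') / 4\<close> is the solution.\<close>

lemma mean_zero_even_representation:
  fixes N N1 N2 :: "real \<Rightarrow> real"
  assumes N: "\<And>v. (N has_real_derivative N1 v) (at v)" "\<And>v. (N1 has_real_derivative N2 v) (at v)" "\<And>v. isCont N2 v"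
    and bd: "\<And>v. \<bar>N v\<bar> \<le> A / (1 + \<bar>v\<bar>) ^ 4" "\<And>v. \<bar>N1 v\<bar> \<le> A / (1 + \<bar>v\<bar>) ^ 4" "\<And>v. \<bar>N2 v\<bar> \<le> A / (1 + \<bar>v\<bar>) ^ 4"
    and even: "\<And>v. N (- v) = N v" and zero: "(\<integral>v. N v \<partial>lborel) = 0"
  obtains V where "V \<in> borel_measurable borel" "\<And>v. \<bar>V v\<bar> \<le> A * tail v"
    "\<And>m. N m = (\<integral>b. V b * rkern (m - b) \<partial>lborel)"
proof -
  have A: "0 \<le> A" using bd(1)[of 0] by simp
  have cN: "isCont N v" "isCont N1 v" for v
    using N DERIV_isCont by blast+
  have t4: "A / (1 + \<bar>v\<bar>) ^ 4 \<le> A * tail v" for v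
    using mult_left_mono[OF inverse_power_le_tail[of 4 v] A] by simp
  have ta: "A * tail v \<le> A" for v
    using mult_left_mono[OF tail_le_one A] by simp
  note bdt = order_trans[OF bd(1) t4] order_trans[OF bd(2) t4] order_trans[OF bd(3) t4]
  have meas [measurable]: "N \<in> borel_measurable borel" "N1 \<in> borel_measurable borel" "N2 \<in> borel_measurable borel"
    using cN N(3) by (auto intro!: borel_measurable_continuous_onI continuous_at_imp_continuous_on)
  have iN: "integrable lborel N"
    by (rule integrable_tail_bound(1)[OF meas(1) bdt(1)])
  obtain n1 where n1: "n1 0 = 0" "\<And>v. (n1 has_real_derivative N v) (at v)"
    using antiderivative_exists[OF cN(1)] by blast
  have c1: "isCont n1 v" for v using n1(2) DERIV_isCont by blast
  have odd: "n1 (- v) = - n1 v" for v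
  proof -
    have "((\<lambda>v. n1 v + n1 (0 + (-1) * v)) has_real_derivative N w + (-1) * N (0 + (-1) * w)) (at w)" for w
      by (intro derivative_intros n1 DERIV_affine_compose)
    then have "((\<lambda>v. n1 v + n1 (- v)) has_real_derivative 0) (at w)" for w
      by (simp add: even)
    from DERIV_zero_imp_eq[OF this] show ?thesis using n1(1) by (simp add: add_eq_0_iff)
  qed
  have lim1: "(n1 \<longlongrightarrow> 0) at_top"
  proof -
    have "(\<integral>v. indicator {0..} v * N v \<partial>lborel) = 0"
      using integral_split_reflect[OF iN] zero by (simp add: even)
    then show ?thesis
      using tendsto_antiderivative[OF n1(2) cN(1) iN] n1(1) by simp
  qed
  have b1': "\<bar>n1 v\<bar> \<le> A / (3 * (1 + v) ^ 3)" if "0 \<le> v" for v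
  proof (rule antiderivative_bound[OF n1(2) _ _ lim1 _ that])
    show "((\<lambda>v. A / (3 * (1 + v) ^ 3)) has_real_derivative - (A / (1 + w) ^ 4)) (at w)" if "0 \<le> w" for w
    proof -
      have "((\<lambda>v. A / (3 * (1 + v) ^ 3)) has_real_derivative (0 * (3 * (1 + w) ^ 3) - A * (3 * (3 * (1 + w)\<^sup>2))) / ((3 * (1 + w) ^ 3) * (3 * (1 + w) ^ 3))) (at w)"
        using that by (auto intro!: derivative_eq_intros)
      moreover have "(0 * (3 * S ^ 3) - A * (3 * (3 * S\<^sup>2))) / ((3 * S ^ 3) * (3 * S ^ 3)) = - (A / S ^ 4)"
        if "0 < S" for S :: real
        using that by (simp add: power2_eq_square power3_eq_cube power4_eq_xxxx)
      from this[of "1 + w"] have "(0 * (3 * (1 + w) ^ 3) - A * (3 * (3 * (1 + w)\<^sup>2))) / ((3 * (1 + w) ^ 3) * (3 * (1 + w) ^ 3)) = - (A / (1 + w) ^ 4)"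
        using that by simp
      ultimately show ?thesis by (simp only:)
    qed
    show "\<bar>N w\<bar> \<le> A / (1 + w) ^ 4" if "0 \<le> w" for w
      using bd(1)[of w] that by simp
    show "((\<lambda>v. A / (3 * (1 + v) ^ 3)) \<longlongrightarrow> 0) at_top"
      by real_asymp
  qed
  have b1: "\<bar>n1 v\<bar> \<le> A / (3 * (1 + \<bar>v\<bar>) ^ 3)" for v
    using b1'[of "\<bar>v\<bar>"] odd[of v] by (auto simp: abs_if split: if_splits)
  have b1t: "\<bar>n1 v\<bar> \<le> A * tail v" for v
  proof -
    have "A / (3 * (1 + \<bar>v\<bar>) ^ 3) \<le> A / (1 + \<bar>v\<bar>) ^ 3"
      using A by (intro divide_left_mono) auto
    also have "\<dots> \<le> A * tail v"
      using mult_left_mono[OF inverse_power_le_tail[of 3 v] A] by simp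
    finally show ?thesis using b1[of v] by linarith
  qed
  have [measurable]: "n1 \<in> borel_measurable borel"
    using c1 by (auto intro!: borel_measurable_continuous_onI continuous_at_imp_continuous_on)
  have i1: "integrable lborel n1"
    by (rule integrable_tail_bound(1)[OF _ b1t]) measurable
  obtain U where U: "U 0 = 0" "\<And>v. (U has_real_derivative n1 v) (at v)"
    using antiderivative_exists[OF c1] by blast
  \<comment> \<open>The constant of integration makes \<open>T\<close> vanish at \<open>+\<infinity>\<close>, hence also at \<open>-\<infinity>\<close> by evenness.\<close>
  define T where "T = (\<lambda>v. U v - (\<integral>v. indicator {0..} v * n1 v \<partial>lborel))"
  have T: "(T has_real_derivative n1 v) (at v)" for v
    unfolding T_def using U(2)[of v] by (auto intro!: derivative_eq_intros)
  have limT: "(T \<longlongrightarrow> 0) at_top"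
  proof -
    have "(T \<longlongrightarrow> (U 0 + (\<integral>v. indicator {0..} v * n1 v \<partial>lborel)) - (\<integral>v. indicator {0..} v * n1 v \<partial>lborel)) at_top"
      unfolding T_def by (intro tendsto_intros tendsto_antiderivative U c1 i1)
    then show ?thesis using U(1) by simp
  qed
  have evT: "T (- v) = T v" for v
  proof -
    have "((\<lambda>v. T v - T (0 + (-1) * v)) has_real_derivative n1 w - (-1) * n1 (0 + (-1) * w)) (at w)" for w
      by (intro derivative_intros T DERIV_affine_compose)
    then have "((\<lambda>v. T v - T (- v)) has_real_derivative 0) (at w)" for w
      by (simp add: odd)
    from DERIV_zero_imp_eq[OF this] show ?thesis by simp
  qed
  have bT': "\<bar>T v\<bar> \<le> A / (6 * (1 + v)\<^sup>2)" if "0 \<le> v" for v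
  proof (rule antiderivative_bound[OF T _ _ limT _ that])
    show "((\<lambda>v. A / (6 * (1 + v)\<^sup>2)) has_real_derivative - (A / (3 * (1 + w) ^ 3))) (at w)" if "0 \<le> w" for w
    proof -
      have "((\<lambda>v. A / (6 * (1 + v)\<^sup>2)) has_real_derivative (0 * (6 * (1 + w)\<^sup>2) - A * (6 * (2 * (1 + w)))) / ((6 * (1 + w)\<^sup>2) * (6 * (1 + w)\<^sup>2))) (at w)"
        using that by (auto intro!: derivative_eq_intros)
      moreover have "(0 * (6 * S\<^sup>2) - A * (6 * (2 * S))) / ((6 * S\<^sup>2) * (6 * S\<^sup>2)) = - (A / (3 * S ^ 3))"
        if "0 < S" for S :: real
        using that by (simp add: power2_eq_square power3_eq_cube)
      from this[of "1 + w"] have "(0 * (6 * (1 + w)\<^sup>2) - A * (6 * (2 * (1 + w)))) / ((6 * (1 + w)\<^sup>2) * (6 * (1 + w)\<^sup>2)) = - (A / (3 * (1 + w) ^ 3))"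
        using that by simp
      ultimately show ?thesis by (simp only:)
    qed
    show "\<bar>n1 w\<bar> \<le> A / (3 * (1 + w) ^ 3)" if "0 \<le> w" for w
      using b1'[OF that] .
    show "((\<lambda>v. A / (6 * (1 + v)\<^sup>2)) \<longlongrightarrow> 0) at_top"
      by real_asymp
  qed
  have bTt: "\<bar>T v\<bar> \<le> A * tail v" for v
  proof -
    have "\<bar>T v\<bar> \<le> A / (6 * (1 + \<bar>v\<bar>)\<^sup>2)"
      using bT'[of "\<bar>v\<bar>"] evT[of v] by (auto simp: abs_if split: if_splits)
    also have "\<dots> \<le> A / (1 + \<bar>v\<bar>)\<^sup>2"
      using A by (intro divide_left_mono) auto
    finally show ?thesis by (simp add: tail_def)
  qed
  have [measurable]: "T \<in> borel_measurable borel"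
    using T DERIV_isCont by (blast intro!: borel_measurable_continuous_onI continuous_at_imp_continuous_on)
  define V where "V = (\<lambda>v. - (T v - 2 * N v + N2 v) / 4)"
  have Vm [measurable]: "V \<in> borel_measurable borel" unfolding V_def by measurable
  have Vb: "\<bar>V v\<bar> \<le> A * tail v" for v
  proof -
    have "\<bar>- (a - 2 * b + c) / 4\<bar> \<le> X" if "\<bar>a\<bar> \<le> X" "\<bar>b\<bar> \<le> X" "\<bar>c\<bar> \<le> X" for a b c X :: real
      using that by (auto simp: abs_le_iff field_simps)
    from this[OF bTt bdt(1) bdt(3)] show ?thesis unfolding V_def .
  qed
  have cV: "isCont V v" for v
    unfolding V_def using DERIV_isCont[OF T] cN N(3) by (intro continuous_intros) auto
  have half: "(\<integral>v. indicator {0..} v * ((1 - v) * exp (- v) * V (m + s * v)) \<partial>lborel) = (s * n1 m + 2 * N m + s * N1 m) / 4"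
    if s: "s * s = 1" for s m :: real
  proof -
    \<comment> \<open>A primitive on the half-line, found by comparing the coefficients of \<open>T\<close> and its derivatives.  In the sum over
      \<open>s = 1\<close> and \<open>s = -1\<close> the odd derivatives at \<open>m\<close> cancel.\<close>
    let ?F = "\<lambda>v. - (exp (- v) * (v * T (m + s * v) + (1 + v) * (s * n1 (m + s * v)) + (2 - v) * N (m + s * v) + (1 - v) * (s * N1 (m + s * v)))) / 4"
    have "(\<integral>v. indicator {0..} v * ((1 - v) * exp (- v) * V (m + s * v)) \<partial>lborel) = 0 - ?F 0"
    proof (rule integral_FTC_at_top)
      fix v :: real
      let ?w = "m + s * v"
      let ?X = "v * T ?w + (1 + v) * (s * n1 ?w) + (2 - v) * N ?w + (1 - v) * (s * N1 ?w)"
      let ?X' = "1 * T ?w + s * n1 ?w * v + (1 * (s * n1 ?w) + s * (s * N ?w) * (1 + v)) + (- 1 * N ?w + s * N1 ?w * (2 - v))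
          + (- 1 * (s * N1 ?w) + s * (s * N2 ?w) * (1 - v))"
      have lin: "((\<lambda>v. 1 + v) has_real_derivative 1) (at v)" "((\<lambda>v. 2 - v) has_real_derivative - 1) (at v)"
        "((\<lambda>v. 1 - v) has_real_derivative - 1) (at v)"
        by (auto intro!: derivative_eq_intros)
      note DX = DERIV_add[OF DERIV_add[OF DERIV_add[OF
          DERIV_mult[OF DERIV_ident DERIV_affine_compose[OF T]]
          DERIV_mult[OF lin(1) DERIV_cmult[OF DERIV_affine_compose[OF n1(2)]]]]
          DERIV_mult[OF lin(2) DERIV_affine_compose[OF N(1)]]]
          DERIV_mult[OF lin(3) DERIV_cmult[OF DERIV_affine_compose[OF N(2)]]]]
      have DE: "((\<lambda>v. - (exp (- v) * X v) / 4) has_real_derivative - (exp (- v) * D - exp (- v) * X v) / 4) (at v)"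
        if "(X has_real_derivative D) (at v)" for X D
      proof -
        have "((\<lambda>v. exp (- v)) has_real_derivative - exp (- v)) (at v)"
          by (auto intro!: derivative_eq_intros)
        from DERIV_cdivide[OF DERIV_minus[OF DERIV_mult[OF this that]], of 4] show ?thesis
          by (rule DERIV_cong) simp
      qed
      have "(?F has_real_derivative - (exp (- v) * ?X' - exp (- v) * ?X) / 4) (at v)"
        by (rule DE[OF DX[of m s]])
      moreover have ss: "s * (s * y) = y" for y
        using s by (simp add: mult.assoc[symmetric])
      have alg: "- (e * (1 * t + p * v + (1 * p + n * (1 + v)) + (- 1 * n + q * (2 - v)) + (- 1 * q + r * (1 - v)))
          - e * (v * t + (1 + v) * p + (2 - v) * n + (1 - v) * q)) / 4 = (1 - v) * e * (- (t - 2 * n + r) / 4)" for e t p n q r :: real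
        by (simp add: algebra_simps)
      have "- (exp (- v) * ?X' - exp (- v) * ?X) / 4 = (1 - v) * exp (- v) * V ?w"
        unfolding V_def ss by (rule alg)
      ultimately show "(?F has_real_derivative (1 - v) * exp (- v) * V (m + s * v)) (at v)"
        by (simp only:)
      show "isCont (\<lambda>v. (1 - v) * exp (- v) * V (m + s * v)) v"
        by (intro continuous_intros isCont_o2[of v "\<lambda>v. m + s * v" V] cV)
    next
      show "(?F \<longlongrightarrow> 0) at_top"
      proof (rule Lim_null_comparison)
        have s1: "\<bar>s\<bar> = 1" using s power2_eq_1_iff[of s] by (auto simp: power2_eq_square)
        show "\<forall>\<^sub>F v in at_top. norm (?F v) \<le> 4 * A * ((2 + v) * exp (- v))"
          using eventually_ge_at_top[of 0]
        proof eventually_elim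
          case (elim v)
          let ?w = "m + s * v"
          have "\<bar>a * b\<bar> \<le> (2 + v) * A" if "\<bar>a\<bar> \<le> 2 + v" "\<bar>b\<bar> \<le> A" for a b
            unfolding abs_mult using that elim by (intro mult_mono) auto
          note bb = this
          have "\<bar>v * T ?w\<bar> \<le> (2 + v) * A" "\<bar>(1 + v) * (s * n1 ?w)\<bar> \<le> (2 + v) * A"
            "\<bar>(2 - v) * N ?w\<bar> \<le> (2 + v) * A" "\<bar>(1 - v) * (s * N1 ?w)\<bar> \<le> (2 + v) * A"
            using elim order_trans[OF bTt ta] order_trans[OF b1t ta] order_trans[OF bdt(1) ta] order_trans[OF bdt(2) ta]
            by (intro bb; auto simp: abs_mult s1)+
          then have "\<bar>v * T ?w + (1 + v) * (s * n1 ?w) + (2 - v) * N ?w + (1 - v) * (s * N1 ?w)\<bar> \<le> 4 * ((2 + v) * A)"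
            by linarith
          from mult_left_mono[OF this, of "exp (- v)"]
          have "\<bar>exp (- v) * (v * T ?w + (1 + v) * (s * n1 ?w) + (2 - v) * N ?w + (1 - v) * (s * N1 ?w))\<bar> \<le> exp (- v) * (4 * ((2 + v) * A))"
            by (simp add: abs_mult)
          also have "exp (- v) * (4 * ((2 + v) * A)) = 4 * A * ((2 + v) * exp (- v))"
            by simp
          finally have bound: "\<bar>exp (- v) * (v * T ?w + (1 + v) * (s * n1 ?w) + (2 - v) * N ?w + (1 - v) * (s * N1 ?w))\<bar> \<le> 4 * A * ((2 + v) * exp (- v))" .
          have "norm (- Y / 4) \<le> \<bar>Y\<bar>" for Y :: real
            by simp
          from order_trans[OF this bound] show ?case .
        qed
        show "((\<lambda>v. 4 * A * ((2 + v) * exp (- v))) \<longlongrightarrow> 0) at_top"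
          by real_asymp
      qed
      have "integrable lborel (\<lambda>v. rho v * V (m + s * v))"
      proof (rule integrable_tail_bound(1))
        fix v
        have "\<bar>rho v\<bar> * \<bar>V (m + s * v)\<bar> \<le> (18 * tail v) * A"
          by (intro mult_mono kern_tail_bounds order_trans[OF Vb ta]) auto
        then show "\<bar>rho v * V (m + s * v)\<bar> \<le> (18 * A) * tail v"
          by (simp add: abs_mult mult_ac)
      qed measurable
      then show "integrable lborel (\<lambda>v. indicator {0..} v * ((1 - v) * exp (- v) * V (m + s * v)))"
        by (simp add: rho_def mult.assoc)
    qed
    also have "0 - ?F 0 = (s * n1 m + 2 * N m + s * N1 m) / 4"
      by (simp add: field_simps)
    finally show ?thesis .
  qed
  have "N m = (\<integral>b. V b * rkern (m - b) \<partial>lborel)" for m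
  proof -
    have ir: "integrable lborel (\<lambda>v. V (m - v) * rkern v)"
    proof (rule integrable_tail_bound(1))
      fix v
      have "\<bar>V (m - v)\<bar> * \<bar>rkern v\<bar> \<le> A * (18 * tail v)"
        by (intro mult_mono kern_tail_bounds order_trans[OF Vb ta] A) auto
      then show "\<bar>V (m - v) * rkern v\<bar> \<le> (18 * A) * tail v"
        by (simp add: abs_mult mult_ac)
    qed measurable
    have "(\<integral>b. V b * rkern (m - b) \<partial>lborel) = (\<integral>v. V (m - v) * rkern v \<partial>lborel)"
      using integral_reflect(1)[of "\<lambda>b. V b * rkern (m - b)" m] by simp
    also have "\<dots> = (\<integral>v. indicator {0..} v * (V (m - v) * rkern v) \<partial>lborel) + (\<integral>v. indicator {0..} v * (V (m + v) * rkern (- v)) \<partial>lborel)"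
      using integral_split_reflect[OF ir] by simp
    also have "(\<integral>v. indicator {0..} v * (V (m - v) * rkern v) \<partial>lborel) = (\<integral>v. indicator {0..} v * ((1 - v) * exp (- v) * V (m + (-1) * v)) \<partial>lborel)"
      by (rule Bochner_Integration.integral_cong) (auto simp: rkern_def indicator_def)
    also have "(\<integral>v. indicator {0..} v * (V (m + v) * rkern (- v)) \<partial>lborel) = (\<integral>v. indicator {0..} v * ((1 - v) * exp (- v) * V (m + 1 * v)) \<partial>lborel)"
      by (rule Bochner_Integration.integral_cong) (auto simp: rkern_def indicator_def)
    finally show ?thesis
      using half[of "-1" m] half[of 1 m] by simp
  qed
  with Vm Vb show ?thesis by (rule that)
qed

section \<open>An even averaging kernel\<close>

lemma scale_pair_of_derivative:
  assumes k: "\<And>v. (k has_real_derivative k1 v) (at v)" and c: "\<And>v. isCont k1 v"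
    and b: "\<And>v. \<bar>k v\<bar> \<le> C * tail v" "\<And>v. \<bar>k v + v * k1 v\<bar> \<le> C * tail v"
  shows "scale_pair C k (\<lambda>v. k v + v * k1 v)"
  unfolding scale_pair_def
proof (intro conjI allI impI)
  have ck: "isCont k v" for v using k DERIV_isCont by blast
  then show "k \<in> borel_measurable borel"
    by (auto intro!: borel_measurable_continuous_onI continuous_at_imp_continuous_on)
  show "continuous_on UNIV (\<lambda>v. k v + v * k1 v)"
    using ck c by (intro continuous_at_imp_continuous_on ballI continuous_intros) auto
  show "\<bar>k v\<bar> \<le> C * tail v" "\<bar>k v + v * k1 v\<bar> \<le> C * tail v" for v
    using b by auto
  fix t v :: real assume t: "0 < t"
  have "((\<lambda>s. v / s) has_real_derivative - v / t\<^sup>2) (at t)"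
    using t by (auto intro!: derivative_eq_intros simp: power2_eq_square)
  from DERIV_divide[OF DERIV_chain2[OF k this] DERIV_ident] t
  have "((\<lambda>s. k (v / s) / s) has_real_derivative (k1 (v / t) * (- v / t\<^sup>2) * t - k (v / t) * 1) / (t * t)) (at t)"
    by simp
  also have "(k1 (v / t) * (- v / t\<^sup>2) * t - k (v / t) * 1) / (t * t) = - dil t (\<lambda>v. k v + v * k1 v) v / t"
    using t by (simp add: dil_def field_simps power2_eq_square)
  finally show "((\<lambda>s. dil s k v) has_real_derivative - dil t (\<lambda>v. k v + v * k1 v) v / t) (at t)"
    unfolding dil_def .
qed

text \<open>The function \<open>\<xi>\<close> is the partner \<open>(v \<kappa>)'\<close> of the probability density \<open>\<kappa>\<close>; this is contained in the
  scale pair.  Two derivatives of both are needed for \<open>mean_zero_even_representation\<close>.\<close>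

locale averaging_pair =
  fixes C :: real and \<kappa> \<kappa>1 \<kappa>2 \<xi> \<xi>1 \<xi>2 :: "real \<Rightarrow> real"
  assumes averaging_nonneg: "0 \<le> C" and averaging_scale_pair: "scale_pair C \<kappa> \<xi>"
    and averaging_deriv: "\<And>v. (\<kappa> has_real_derivative \<kappa>1 v) (at v)" "\<And>v. (\<kappa>1 has_real_derivative \<kappa>2 v) (at v)" "\<And>v. isCont \<kappa>2 v"
    and dilated_deriv: "\<And>v. (\<xi> has_real_derivative \<xi>1 v) (at v)" "\<And>v. (\<xi>1 has_real_derivative \<xi>2 v) (at v)" "\<And>v. isCont \<xi>2 v"
    and averaging_decay: "\<And>v. \<bar>\<kappa> v\<bar> \<le> C / (1 + \<bar>v\<bar>) ^ 4" "\<And>v. \<bar>\<kappa>1 v\<bar> \<le> C / (1 + \<bar>v\<bar>) ^ 4" "\<And>v. \<bar>\<kappa>2 v\<bar> \<le> C / (1 + \<bar>v\<bar>) ^ 4"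
    and dilated_decay: "\<And>v. \<bar>\<xi> v\<bar> \<le> C / (1 + \<bar>v\<bar>) ^ 4" "\<And>v. \<bar>\<xi>1 v\<bar> \<le> C / (1 + \<bar>v\<bar>) ^ 4" "\<And>v. \<bar>\<xi>2 v\<bar> \<le> C / (1 + \<bar>v\<bar>) ^ 4"
    and averaging_even: "\<And>v. \<kappa> (- v) = \<kappa> v" "\<And>v. \<xi> (- v) = \<xi> v"
    and averaging_integral: "(\<integral>v. \<kappa> v \<partial>lborel) = 1" "(\<integral>v. \<xi> v \<partial>lborel) = 0" "integrable lborel \<kappa>" "integrable lborel \<xi>"

text \<open>A normalised Gaussian.  Its derivatives are polynomials of degree at most four times the Gaussian itself.\<close>

lemma averaging_pair_exists: "\<exists>C \<kappa> \<kappa>1 \<kappa>2 \<xi> \<xi>1 \<xi>2. averaging_pair C \<kappa> \<kappa>1 \<kappa>2 \<xi> \<xi>1 \<xi>2"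
proof -
  define g where "g = (\<lambda>v::real. exp (- v\<^sup>2))"
  have gb: "g v \<le> 9 * fact 8 / (1 + \<bar>v\<bar>) ^ 8" for v
  proof -
    \<comment> \<open>Comparison of the Gaussian with \<open>e\<^bsup>-|v|\<^esup>\<close>, for which powers are already under control.\<close>
    have "(\<bar>v\<bar> - 1 / 2)\<^sup>2 = v\<^sup>2 - \<bar>v\<bar> + 1 / 4"
      by (simp add: power2_diff power_divide)
    then have "- v\<^sup>2 \<le> 1 - \<bar>v\<bar>"
      using zero_le_power2[of "\<bar>v\<bar> - 1 / 2"] by linarith
    then have "g v \<le> exp (1 - \<bar>v\<bar>)" by (simp add: g_def)
    also have "\<dots> = exp 1 * exp (- \<bar>v\<bar>)" by (simp add: exp_add[symmetric])
    also have "\<dots> \<le> 3 * exp (- \<bar>v\<bar>)" using exp_le by (intro mult_right_mono) auto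
    also have "\<dots> \<le> 9 * fact 8 / (1 + \<bar>v\<bar>) ^ 8"
      using power_exp_bound[of "\<bar>v\<bar>" 8] by (subst pos_le_divide_eq) (auto simp: mult_ac intro!: zero_less_power)
    finally show ?thesis .
  qed
  \<comment> \<open>The number \<open>38\<close> is the largest sum of absolute values of the coefficients of the polynomials below; four of the eight
  powers of decay are spent on them.\<close>
  define C0 :: real where "C0 = 38 * (9 * fact 8)"
  have pb: "\<bar>p * g v\<bar> \<le> C0 / (1 + \<bar>v\<bar>) ^ 4" if p: "\<bar>p\<bar> \<le> 38 * (1 + \<bar>v\<bar>) ^ 4" for p v
  proof -
    have "\<bar>p * g v\<bar> \<le> (38 * (1 + \<bar>v\<bar>) ^ 4) * (9 * fact 8 / (1 + \<bar>v\<bar>) ^ 8)"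
      unfolding abs_mult using gb[of v] by (intro mult_mono p) (auto simp: g_def)
    also have "\<dots> = C0 / (1 + \<bar>v\<bar>) ^ 4"
    proof -
      have "(38 * S ^ 4) * (9 * fact 8 / S ^ 8) = C0 / S ^ 4" if "0 < S" for S :: real
      proof -
        have "S ^ 8 = S ^ 4 * S ^ 4" by (simp add: power_add[symmetric])
        moreover have "(38 * T) * (X / (T * T)) = 38 * X / T" if "0 < T" for T X :: real
          using that by simp
        ultimately show ?thesis
          unfolding C0_def using zero_less_power[OF that, of 4] by (simp only:)
      qed
      from this[of "1 + \<bar>v\<bar>"] show ?thesis by simp
    qed
    finally show ?thesis .
  qed
  have poly: "\<bar>a + b * v + c * v\<^sup>2 + d * v ^ 3 + e * v ^ 4\<bar> \<le> 38 * (1 + \<bar>v\<bar>) ^ 4"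
    if "\<bar>a\<bar> + \<bar>b\<bar> + \<bar>c\<bar> + \<bar>d\<bar> + \<bar>e\<bar> \<le> 38" for a b c d e v :: real
  proof -
    let ?S = "(1 + \<bar>v\<bar>) ^ 4"
    have pw: "\<bar>v\<bar> ^ n \<le> ?S" if "n \<le> 4" for n
      using power_mono[of "\<bar>v\<bar>" "1 + \<bar>v\<bar>" n] power_increasing[OF that, of "1 + \<bar>v\<bar>"] by simp
    have x: "\<bar>k * v ^ n\<bar> \<le> \<bar>k\<bar> * ?S" if "n \<le> 4" for k n
      unfolding abs_mult power_abs by (intro mult_left_mono pw that) simp
    have "\<bar>a + b * v + c * v\<^sup>2 + d * v ^ 3 + e * v ^ 4\<bar> \<le> \<bar>a\<bar> * ?S + \<bar>b\<bar> * ?S + \<bar>c\<bar> * ?S + \<bar>d\<bar> * ?S + \<bar>e\<bar> * ?S"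
    proof -
      have "\<bar>a + b * v + c * v\<^sup>2 + d * v ^ 3 + e * v ^ 4\<bar>
          \<le> \<bar>a * v ^ 0\<bar> + \<bar>b * v ^ 1\<bar> + \<bar>c * v\<^sup>2\<bar> + \<bar>d * v ^ 3\<bar> + \<bar>e * v ^ 4\<bar>"
        unfolding power_0 power_one_right mult_1_right by linarith
      also have "\<dots> \<le> \<bar>a\<bar> * ?S + \<bar>b\<bar> * ?S + \<bar>c\<bar> * ?S + \<bar>d\<bar> * ?S + \<bar>e\<bar> * ?S"
        by (intro add_mono x) auto
      finally show ?thesis .
    qed
    also have "\<dots> \<le> 38 * ?S"
      using mult_right_mono[OF that, of ?S] by (simp add: distrib_right)
    finally show ?thesis .
  qed
  define p\<kappa> where "p\<kappa> = (\<lambda>v::real. 1 + 0 * v + 0 * v\<^sup>2 + 0 * v ^ 3 + 0 * v ^ 4)"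
  define p\<kappa>1 where "p\<kappa>1 = (\<lambda>v::real. 0 + (-2) * v + 0 * v\<^sup>2 + 0 * v ^ 3 + 0 * v ^ 4)"
  define p\<kappa>2 where "p\<kappa>2 = (\<lambda>v::real. (-2) + 0 * v + 4 * v\<^sup>2 + 0 * v ^ 3 + 0 * v ^ 4)"
  define p\<xi> where "p\<xi> = (\<lambda>v::real. 1 + 0 * v + (-2) * v\<^sup>2 + 0 * v ^ 3 + 0 * v ^ 4)"
  define p\<xi>1 where "p\<xi>1 = (\<lambda>v::real. 0 + (-6) * v + 0 * v\<^sup>2 + 4 * v ^ 3 + 0 * v ^ 4)"
  define p\<xi>2 where "p\<xi>2 = (\<lambda>v::real. (-6) + 0 * v + 24 * v\<^sup>2 + 0 * v ^ 3 + (-8) * v ^ 4)"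
  note pdefs = p\<kappa>_def p\<kappa>1_def p\<kappa>2_def p\<xi>_def p\<xi>1_def p\<xi>2_def
  have pp: "\<bar>p v\<bar> \<le> 38 * (1 + \<bar>v\<bar>) ^ 4" if "p \<in> {p\<kappa>, p\<kappa>1, p\<kappa>2, p\<xi>, p\<xi>1, p\<xi>2}" for p v
    using that unfolding pdefs by (elim insertE emptyE; hypsubst; intro poly; simp)
  have gm: "g \<in> borel_measurable borel" unfolding g_def by measurable
  have C0: "0 \<le> C0" by (simp add: C0_def)
  have t4: "C0 / (1 + \<bar>v\<bar>) ^ 4 \<le> C0 * tail v" for v
    using mult_left_mono[OF inverse_power_le_tail[of 4 v] C0] by simp
  have ig: "integrable lborel g"
  proof (rule integrable_tail_bound(1)[OF gm])
    fix v :: real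
    have "1 \<le> (1 + \<bar>v\<bar>) ^ 4" by (rule one_le_power) simp
    then have "\<bar>1 * g v\<bar> \<le> C0 / (1 + \<bar>v\<bar>) ^ 4" by (intro pb) linarith
    then show "\<bar>g v\<bar> \<le> C0 * tail v"
      using t4[of v] by simp
  qed
  define c where "c = (\<integral>v. g v \<partial>lborel)"
  have c: "0 < c"
  proof -
    have "c \<noteq> 0"
    proof
      assume "c = 0"
      then have "AE v in lborel. g v = 0"
        unfolding c_def by (subst (asm) integral_nonneg_eq_0_iff_AE[OF ig]) (auto simp: g_def)
      then have "AE v in (lborel :: real measure). False" by (simp add: g_def)
      then show False by (simp add: AE_iff_null null_sets_def emeasure_lborel_UNIV)
    qed
    moreover have "0 \<le> c" unfolding c_def by (intro Bochner_Integration.integral_nonneg) (simp add: g_def)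
    ultimately show ?thesis by simp
  qed
  define C where "C = C0 / c"
  define h where "h = (\<lambda>p v. (p::real\<Rightarrow>real) v * g v / c)"
  have hb: "\<bar>h p v\<bar> \<le> C / (1 + \<bar>v\<bar>) ^ 4" if "p \<in> {p\<kappa>, p\<kappa>1, p\<kappa>2, p\<xi>, p\<xi>1, p\<xi>2}" for p v
    using divide_right_mono[OF pb[OF pp[OF that, of v]], of c] c
    by (simp add: h_def C_def abs_mult field_simps)
  have Cn: "0 \<le> C" using C0 c by (simp add: C_def)
  have hbt: "\<bar>h p v\<bar> \<le> C * tail v" if "p \<in> {p\<kappa>, p\<kappa>1, p\<kappa>2, p\<xi>, p\<xi>1, p\<xi>2}" for p v
    using hb[OF that, of v] mult_left_mono[OF inverse_power_le_tail[of 4 v] Cn] by simp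
  have gd: "(g has_real_derivative - 2 * v * g v) (at v)" for v
    unfolding g_def by (auto intro!: derivative_eq_intros)
  have hd: "(h p has_real_derivative (p' v * g v + (- 2 * v * g v) * p v) / c) (at v)"
    if "(p has_real_derivative p' v) (at v)" for p p' v
    unfolding h_def by (rule DERIV_cdivide[OF DERIV_mult[OF that gd]])
  have d1: "(h p\<kappa> has_real_derivative h p\<kappa>1 v) (at v)" for v
  proof -
    have "(p\<kappa> has_real_derivative 0) (at v)" unfolding pdefs by (auto intro!: derivative_eq_intros)
    from hd[of p\<kappa> "\<lambda>_. 0", OF this] show ?thesis by (simp add: h_def pdefs)
  qed
  have d2: "(h p\<kappa>1 has_real_derivative h p\<kappa>2 v) (at v)" for v
  proof -
    have "(p\<kappa>1 has_real_derivative -2) (at v)" unfolding pdefs by (auto intro!: derivative_eq_intros)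
    from hd[of p\<kappa>1 "\<lambda>_. -2", OF this] show ?thesis
      by (rule DERIV_cong) (simp add: h_def pdefs algebra_simps power2_eq_square)
  qed
  have d3: "(h p\<xi> has_real_derivative h p\<xi>1 v) (at v)" for v
  proof -
    have "(p\<xi> has_real_derivative -4 * v) (at v)" unfolding pdefs by (auto intro!: derivative_eq_intros)
    from hd[of p\<xi> "\<lambda>v. -4 * v", OF this] show ?thesis
      by (rule DERIV_cong) (simp add: h_def pdefs algebra_simps power2_eq_square power3_eq_cube)
  qed
  have d4: "(h p\<xi>1 has_real_derivative h p\<xi>2 v) (at v)" for v
  proof -
    have "(p\<xi>1 has_real_derivative -6 + 12 * v\<^sup>2) (at v)" unfolding pdefs by (auto intro!: derivative_eq_intros)
    from hd[of p\<xi>1 "\<lambda>v. -6 + 12 * v\<^sup>2", OF this] show ?thesis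
      by (rule DERIV_cong) (simp add: h_def pdefs algebra_simps power2_eq_square power3_eq_cube power4_eq_xxxx)
  qed
  have cont: "isCont (h p) v" if "p \<in> {p\<kappa>, p\<kappa>1, p\<kappa>2, p\<xi>, p\<xi>1, p\<xi>2}" for p v
    using that c unfolding h_def pdefs g_def by (elim insertE emptyE; hypsubst; intro continuous_intros; simp)
  have meas: "h p \<in> borel_measurable borel" if "p \<in> {p\<kappa>, p\<kappa>1, p\<kappa>2, p\<xi>, p\<xi>1, p\<xi>2}" for p
    using cont[OF that] by (auto intro!: borel_measurable_continuous_onI continuous_at_imp_continuous_on)
  have int: "integrable lborel (h p)" if "p \<in> {p\<kappa>, p\<kappa>1, p\<kappa>2, p\<xi>, p\<xi>1, p\<xi>2}" for p
    by (rule integrable_tail_bound(1)[OF meas[OF that] hbt[OF that]])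
  have \<xi>: "h p\<kappa> v + v * h p\<kappa>1 v = h p\<xi> v" for v
    by (simp add: h_def pdefs algebra_simps power2_eq_square diff_divide_distrib add_divide_distrib)
  have sp: "scale_pair C (h p\<kappa>) (\<lambda>v. h p\<kappa> v + v * h p\<kappa>1 v)"
    by (rule scale_pair_of_derivative[OF d1 cont]) (simp_all only: \<xi>, auto intro!: hbt)
  have one: "(\<integral>v. h p\<kappa> v \<partial>lborel) = 1"
    using c by (simp add: h_def pdefs c_def)
  have zero: "(\<integral>v. h p\<xi> v \<partial>lborel) = 0 - 0"
  proof (rule integral_FTC_real_line[where F = "\<lambda>v. v * h p\<kappa> v"])
    show "((\<lambda>v. v * h p\<kappa> v) has_real_derivative h p\<xi> v) (at v)" for v
      using DERIV_mult[OF DERIV_ident d1[of v]] \<xi>[of v] by (simp add: add.commute mult.commute)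
    show "isCont (h p\<xi>) v" for v by (rule cont) simp
    show "integrable lborel (h p\<xi>)" by (rule int) simp
    show "((\<lambda>v. v * h p\<kappa> v) \<longlongrightarrow> 0) at_top" "((\<lambda>v. - v * h p\<kappa> (- v)) \<longlongrightarrow> 0) at_top"
      unfolding h_def pdefs g_def using c by real_asymp+
  qed
  have "averaging_pair C (h p\<kappa>) (h p\<kappa>1) (h p\<kappa>2) (h p\<xi>) (h p\<xi>1) (h p\<xi>2)"
  proof
    show "scale_pair C (h p\<kappa>) (h p\<xi>)" using sp unfolding \<xi> .
    show "h p\<kappa> (- v) = h p\<kappa> v" "h p\<xi> (- v) = h p\<xi> v" for v
      by (simp_all add: h_def pdefs g_def)
    show "(\<integral>v. h p\<xi> v \<partial>lborel) = 0" using zero by simp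
  qed (auto intro!: Cn d1 d2 d3 d4 cont hb one int)
  then show ?thesis by blast
qed

section \<open>Autocorrelations\<close>

text \<open>In the applications \<open>X = 1 + |u|\<close>, \<open>Y = 1 + |u'|\<close>, while \<open>D\<close> and \<open>E\<close> measure the difference of \<open>u\<close> and \<open>u'\<close> and
  a further combination of the two.  As \<open>X Y\<close> exceeds both, six powers can be distributed between them.\<close>

lemma decay_mult:
  fixes X Y D E :: real
  assumes "1 \<le> E" "1 \<le> D" "E \<le> X * Y" "D \<le> X * Y" "0 < X" "0 < Y"
    and "\<bar>a\<bar> \<le> K / X ^ 6" "\<bar>b\<bar> \<le> K / Y ^ 6"
  shows "\<bar>a * b\<bar> \<le> K\<^sup>2 / E ^ 4 * (1 / D\<^sup>2)"
proof -
  have "E ^ 4 * D\<^sup>2 \<le> (X * Y) ^ 4 * (X * Y)\<^sup>2"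
    using assms by (intro mult_mono power_mono) auto
  also have "\<dots> = X ^ 6 * Y ^ 6"
    by (simp add: power_mult_distrib power_add[symmetric] flip: mult.assoc) (simp add: power_add[symmetric] mult_ac)
  finally have le: "E ^ 4 * D\<^sup>2 \<le> X ^ 6 * Y ^ 6" .
  have "\<bar>a * b\<bar> \<le> K / X ^ 6 * (K / Y ^ 6)"
    unfolding abs_mult using assms by (intro mult_mono) (auto intro: order_trans[OF abs_ge_zero])
  also have "\<dots> = K\<^sup>2 / (X ^ 6 * Y ^ 6)"
    by (simp add: power2_eq_square)
  also have "\<dots> \<le> K\<^sup>2 / (E ^ 4 * D\<^sup>2)"
    using assms by (intro divide_left_mono le) (auto intro!: mult_pos_pos zero_less_power)
  finally show ?thesis by simp
qed

definition corr :: "(real \<Rightarrow> real) \<Rightarrow> (real \<Rightarrow> real) \<Rightarrow> real \<Rightarrow> real" where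
  "corr a b d = (\<integral>u. a u * b (u - d) \<partial>lborel)"

lemma corr_bounds:
  assumes [measurable]: "a \<in> borel_measurable borel" "b \<in> borel_measurable borel"
    and a: "\<And>v. \<bar>a v\<bar> \<le> K / (1 + \<bar>v\<bar>) ^ 6" and b: "\<And>v. \<bar>b v\<bar> \<le> K / (1 + \<bar>v\<bar>) ^ 6"
  shows "integrable lborel (\<lambda>u. a u * b (u - d))" "\<bar>corr a b d\<bar> \<le> 2 * K\<^sup>2 * tail d"
proof -
  have pt: "\<bar>a u * b (u - d)\<bar> \<le> (K\<^sup>2 * tail d) * tail u" for u
  proof -
    have "\<bar>a u * b (u - d)\<bar> \<le> K\<^sup>2 / (1 + \<bar>u\<bar>) ^ 4 * (1 / (1 + \<bar>d\<bar>)\<^sup>2)"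
    proof (rule decay_mult[OF _ _ _ _ _ _ a b])
      show "1 + \<bar>u\<bar> \<le> (1 + \<bar>u\<bar>) * (1 + \<bar>u - d\<bar>)"
        using mult_left_mono[of 1 "1 + \<bar>u - d\<bar>" "1 + \<bar>u\<bar>"] by simp
      have "1 + \<bar>d\<bar> \<le> 1 + \<bar>u\<bar> + \<bar>u - d\<bar>" by linarith
      also have "\<dots> \<le> (1 + \<bar>u\<bar>) * (1 + \<bar>u - d\<bar>)" by (simp add: algebra_simps)
      finally show "1 + \<bar>d\<bar> \<le> (1 + \<bar>u\<bar>) * (1 + \<bar>u - d\<bar>)" .
    qed auto
    also have "\<dots> = K\<^sup>2 * (1 / (1 + \<bar>u\<bar>) ^ 4) * tail d"
      by (simp add: tail_def)
    also have "\<dots> \<le> K\<^sup>2 * tail u * tail d"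
      by (intro mult_right_mono mult_left_mono inverse_power_le_tail) auto
    finally show ?thesis by (simp add: mult_ac)
  qed
  show i: "integrable lborel (\<lambda>u. a u * b (u - d))"
    by (rule integrable_tail_bound(1)[OF _ pt]) measurable
  show "\<bar>corr a b d\<bar> \<le> 2 * K\<^sup>2 * tail d"
  proof -
    have "\<bar>corr a b d\<bar> \<le> (\<integral>u. \<bar>a u * b (u - d)\<bar> \<partial>lborel)"
      unfolding corr_def by (rule integral_abs_bound)
    also have "\<dots> \<le> 2 * (K\<^sup>2 * tail d)"
      by (rule integrable_tail_bound(3)[OF _ pt]) measurable
    finally show ?thesis by simp
  qed
qed

lemma DERIV_of_quadratic_remainder:
  fixes f :: "real \<Rightarrow> real"
  assumes "\<And>h. \<bar>f (x + h) - f x - h * D\<bar> \<le> M * h\<^sup>2"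
  shows "(f has_real_derivative D) (at x)"
  unfolding DERIV_def
proof (rule LIM_zero_cancel, rule Lim_null_comparison)
  show "\<forall>\<^sub>F h in at 0. norm ((f (x + h) - f x) / h - D) \<le> M * \<bar>h\<bar>"
  proof (rule eventually_at_ball'[of 1 "0::real" UNIV, THEN eventually_mono])
    fix h :: real assume "h \<in> ball 0 1 \<and> h \<noteq> 0 \<and> h \<in> UNIV"
    then have h: "h \<noteq> 0" by simp
    have "norm ((f (x + h) - f x) / h - D) = \<bar>f (x + h) - f x - h * D\<bar> / \<bar>h\<bar>"
      using h by (simp add: abs_divide[symmetric] diff_divide_distrib)
    also have "\<dots> \<le> M * h\<^sup>2 / \<bar>h\<bar>"
      using assms by (intro divide_right_mono) auto
    also have "\<dots> = M * \<bar>h\<bar>"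
      using h by (simp add: power2_eq_square abs_if)
    finally show "norm ((f (x + h) - f x) / h - D) \<le> M * \<bar>h\<bar>" .
  qed simp
  have "((\<lambda>h. M * \<bar>h\<bar>) \<longlongrightarrow> M * \<bar>0\<bar>) (at 0)"
    by (intro tendsto_intros)
  then show "((\<lambda>h. M * \<bar>h\<bar>) \<longlongrightarrow> 0) (at 0)" by simp
qed

lemma lipschitz_of_derivative_bound:
  fixes f :: "real \<Rightarrow> real"
  assumes "\<And>v. (f has_real_derivative f' v) (at v)" "\<And>v. \<bar>f' v\<bar> \<le> K"
  shows "\<bar>f y - f x\<bar> \<le> K * \<bar>y - x\<bar>"
  using field_differentiable_bound[of UNIV f f' K x y] assms
  by (auto simp: abs_minus_commute has_field_derivative_at_within)

lemma quadratic_remainder: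
  fixes f :: "real \<Rightarrow> real"
  assumes f: "\<And>v. (f has_real_derivative f' v) (at v)" "\<And>v. (f' has_real_derivative f'' v) (at v)"
    and b: "\<And>v. \<bar>f'' v\<bar> \<le> K"
  shows "\<bar>f (x + h) - f x - h * f' x\<bar> \<le> K * h\<^sup>2"
proof -
  let ?g = "\<lambda>v. f v - v * f' x"
  have K: "0 \<le> K" using b[of 0] by linarith
  let ?S = "cball x \<bar>h\<bar>"
  have "norm (?g (x + h) - ?g x) \<le> (K * \<bar>h\<bar>) * norm (x + h - x)"
  proof (rule field_differentiable_bound[of ?S])
    show "(?g has_field_derivative f' v - f' x) (at v within ?S)" for v
      by (rule has_field_derivative_at_within) (use f(1)[of v] in \<open>auto intro!: derivative_eq_intros\<close>)
    fix v assume "v \<in> ?S"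
    then have "\<bar>v - x\<bar> \<le> \<bar>h\<bar>" by (simp add: dist_real_def abs_minus_commute)
    then show "norm (f' v - f' x) \<le> K * \<bar>h\<bar>"
      using lipschitz_of_derivative_bound[OF f(2) b, of v x] mult_left_mono[OF _ K, of "\<bar>v - x\<bar>" "\<bar>h\<bar>"] by simp
  qed (auto simp: dist_real_def)
  then show ?thesis
    by (simp add: algebra_simps power2_eq_square)
qed

text \<open>The quadratic Taylor remainder of \<open>b\<close>, integrated against \<open>a\<close>, is again quadratic in the increment.\<close>

lemma DERIV_corr:
  assumes [measurable]: "a \<in> borel_measurable borel"
    and a: "\<And>v. \<bar>a v\<bar> \<le> K / (1 + \<bar>v\<bar>) ^ 6" and b: "\<And>v. \<bar>b v\<bar> \<le> K / (1 + \<bar>v\<bar>) ^ 6"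
    and b1: "\<And>v. \<bar>b1 v\<bar> \<le> K / (1 + \<bar>v\<bar>) ^ 6" and b2: "\<And>v. \<bar>b2 v\<bar> \<le> K / (1 + \<bar>v\<bar>) ^ 6"
    and d: "\<And>v. (b has_real_derivative b1 v) (at v)" "\<And>v. (b1 has_real_derivative b2 v) (at v)"
  shows "(corr a b has_real_derivative - corr a b1 x) (at x)"
proof (rule DERIV_of_quadratic_remainder)
  fix h :: real
  have K: "0 \<le> K" using a[of 0] by simp
  have [measurable]: "b \<in> borel_measurable borel" "b1 \<in> borel_measurable borel"
    using d DERIV_isCont by (blast intro!: borel_measurable_continuous_onI continuous_at_imp_continuous_on)+
  have b2': "\<bar>b2 v\<bar> \<le> K" for v
  proof -
    have "K / (1 + \<bar>v\<bar>) ^ 6 \<le> K / 1"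
      using K by (intro divide_left_mono) (auto intro!: one_le_power)
    with b2[of v] show ?thesis by simp
  qed
  have at: "\<bar>a v\<bar> \<le> K * tail v" for v
    using a[of v] mult_left_mono[OF inverse_power_le_tail[of 6 v] K] by simp
  note i = corr_bounds(1)[OF _ _ a b] corr_bounds(1)[OF _ _ a b1]
  have "corr a b (x + h) - corr a b x - h * - corr a b1 x
    = (\<integral>u. a u * (b ((u - x) + (- h)) - b (u - x) - (- h) * b1 (u - x)) \<partial>lborel)"
  proof -
    have "(\<integral>u. a u * (b ((u - x) + (- h)) - b (u - x) - (- h) * b1 (u - x)) \<partial>lborel)
      = (\<integral>u. a u * b (u - (x + h)) - a u * b (u - x) + h * (a u * b1 (u - x)) \<partial>lborel)"
      by (rule Bochner_Integration.integral_cong) (simp_all add: algebra_simps)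
    also have "\<dots> = corr a b (x + h) - corr a b x + h * corr a b1 x"
      unfolding corr_def using i by simp
    finally show ?thesis by simp
  qed
  also have "\<bar>\<dots>\<bar> \<le> (2 * K * K) * h\<^sup>2"
  proof -
    have pt: "\<bar>a u * (b ((u - x) + (- h)) - b (u - x) - (- h) * b1 (u - x))\<bar> \<le> (K * (K * h\<^sup>2)) * tail u" for u
    proof -
      have "\<bar>b ((u - x) + (- h)) - b (u - x) - (- h) * b1 (u - x)\<bar> \<le> K * h\<^sup>2"
        using quadratic_remainder[OF d b2', of "u - x" "- h"] by simp
      from mult_mono[OF at[of u] this] show ?thesis
        using K by (simp add: abs_mult mult_ac)
    qed
    have "\<bar>\<integral>u. a u * (b ((u - x) + (- h)) - b (u - x) - (- h) * b1 (u - x)) \<partial>lborel\<bar>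
       \<le> (\<integral>u. \<bar>a u * (b ((u - x) + (- h)) - b (u - x) - (- h) * b1 (u - x))\<bar> \<partial>lborel)"
      by (rule integral_abs_bound)
    also have "\<dots> \<le> 2 * (K * (K * h\<^sup>2))"
      by (rule integrable_tail_bound(3)[OF _ pt]) measurable
    finally show ?thesis by (simp add: mult_ac)
  qed
  finally show "\<bar>corr a b (x + h) - corr a b x - h * - corr a b1 x\<bar> \<le> (2 * K * K) * h\<^sup>2" .
qed

text \<open>A derivative \<open>\<zeta> = \<eta>'\<close> of definite parity with polynomial decay.  The parity makes products
  \<open>\<zeta>(m + d/2) \<zeta>(m - d/2)\<close> even in \<open>m\<close>.\<close>

locale profile =
  fixes K \<sigma> :: real and \<eta> \<zeta> \<zeta>1 \<zeta>2 :: "real \<Rightarrow> real"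
  assumes deriv: "\<And>v. (\<eta> has_real_derivative \<zeta> v) (at v)" "\<And>v. (\<zeta> has_real_derivative \<zeta>1 v) (at v)"
      "\<And>v. (\<zeta>1 has_real_derivative \<zeta>2 v) (at v)" "\<And>v. isCont \<zeta>2 v"
    and decay: "\<And>v. \<bar>\<eta> v\<bar> \<le> K / (1 + \<bar>v\<bar>) ^ 6" "\<And>v. \<bar>\<zeta> v\<bar> \<le> K / (1 + \<bar>v\<bar>) ^ 6"
      "\<And>v. \<bar>\<zeta>1 v\<bar> \<le> K / (1 + \<bar>v\<bar>) ^ 6" "\<And>v. \<bar>\<zeta>2 v\<bar> \<le> K / (1 + \<bar>v\<bar>) ^ 6"
    and parity: "\<bar>\<sigma>\<bar> = 1" "\<And>v. \<zeta> (- v) = \<sigma> * \<zeta> v"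
begin

lemma K_nonneg: "0 \<le> K"
  using decay(1)[of 0] by simp

lemma profile_cont: "isCont \<eta> v" "isCont \<zeta> v" "isCont \<zeta>1 v"
  using deriv DERIV_isCont by blast+

lemma profile_measurable [measurable]:
  "\<eta> \<in> borel_measurable borel" "\<zeta> \<in> borel_measurable borel"
  "\<zeta>1 \<in> borel_measurable borel" "\<zeta>2 \<in> borel_measurable borel"
  using profile_cont deriv(4) by (auto intro!: borel_measurable_continuous_onI continuous_at_imp_continuous_on)

text \<open>The autocorrelation \<open>q\<close> of \<open>\<zeta>\<close>, its decaying primitive \<open>P\<close>, and \<open>Q(d) = P(d)/d\<close>, for which \<open>q = (d Q)'\<close>.\<close>

definition q :: "real \<Rightarrow> real" where "q = corr \<zeta> \<zeta>"
definition P :: "real \<Rightarrow> real" where "P d = - corr \<zeta> \<eta> d"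
definition Q :: "real \<Rightarrow> real" where "Q d = (if d = 0 then q 0 else P d / d)"

lemma P_deriv: "(P has_real_derivative q d) (at d)"
  using DERIV_minus[OF DERIV_corr[OF profile_measurable(2) decay(2) decay(1) decay(2) decay(3) deriv(1,2)], of d]
  unfolding P_def[abs_def] q_def by simp

lemma q_cont: "isCont q d"
  using DERIV_corr[OF profile_measurable(2) decay(2) decay(2) decay(3) decay(4) deriv(2,3), of d]
  unfolding q_def by (rule DERIV_isCont)

lemma q_bound: "\<bar>q d\<bar> \<le> 2 * K\<^sup>2 * tail d"
  unfolding q_def by (rule corr_bounds(2)[OF _ _ decay(2) decay(2)]) measurable

lemma P_bound: "\<bar>P d\<bar> \<le> 2 * K\<^sup>2 * tail d"
  unfolding P_def using corr_bounds(2)[OF _ _ decay(2) decay(1), of d] by simp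

lemma eta_tendsto: "(\<eta> \<longlongrightarrow> 0) at_top" "((\<lambda>v. \<eta> (- v)) \<longlongrightarrow> 0) at_top"
proof -
  have "((\<lambda>v. K / (1 + \<bar>v\<bar>) ^ 6) \<longlongrightarrow> 0) at_top"
    by real_asymp
  then show "(\<eta> \<longlongrightarrow> 0) at_top" "((\<lambda>v. \<eta> (- v)) \<longlongrightarrow> 0) at_top"
    using decay(1) decay(1)[of "- _"] by (auto intro!: Lim_null_comparison[where g = "\<lambda>v. K / (1 + \<bar>v\<bar>) ^ 6"])
qed

text \<open>The integral of \<open>\<zeta> \<eta> = (\<eta>\<^sup>2)'/2\<close> vanishes.  Without it, \<open>Q\<close> would have a nonintegrable singularity at \<open>0\<close>.\<close>

lemma P_zero: "P 0 = 0"
proof -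
  have "(\<integral>u. \<zeta> u * \<eta> u \<partial>lborel) = 0\<^sup>2 / 2 - 0\<^sup>2 / 2"
  proof (rule integral_FTC_real_line)
    show "((\<lambda>u. (\<eta> u)\<^sup>2 / 2) has_real_derivative \<zeta> v * \<eta> v) (at v)" for v
      using deriv(1)[of v] by (auto intro!: derivative_eq_intros)
    show "isCont (\<lambda>u. \<zeta> u * \<eta> u) v" for v
      by (intro continuous_intros profile_cont)
    show "integrable lborel (\<lambda>u. \<zeta> u * \<eta> u)"
      using corr_bounds(1)[OF _ _ decay(2) decay(1), of 0] by simp
    show "((\<lambda>u. (\<eta> u)\<^sup>2 / 2) \<longlongrightarrow> 0\<^sup>2 / 2) at_top" "((\<lambda>v. (\<eta> (- v))\<^sup>2 / 2) \<longlongrightarrow> 0\<^sup>2 / 2) at_top"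
      by (intro tendsto_intros eta_tendsto; simp)+
  qed
  then show ?thesis by (simp add: P_def corr_def)
qed

lemma Q_bound: "\<bar>Q d\<bar> \<le> 8 * K\<^sup>2 * tail d"
proof (cases "\<bar>d\<bar> \<le> 1")
  case True
  have "\<bar>Q d\<bar> \<le> 2 * K\<^sup>2"
  proof (cases "d = 0")
    case True
    then show ?thesis using q_bound[of 0] by (simp add: Q_def tail_def)
  next
    case False
    have "\<bar>q v\<bar> \<le> 2 * K\<^sup>2" for v
      using q_bound[of v] mult_left_mono[OF tail_le_one[of v], of "2 * K\<^sup>2"] by simp
    from lipschitz_of_derivative_bound[OF P_deriv this, of d 0]
    have "\<bar>P d\<bar> \<le> 2 * K\<^sup>2 * \<bar>d\<bar>" by (simp add: P_zero)
    then show ?thesis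
      using False by (simp add: Q_def pos_divide_le_eq)
  qed
  also have "\<dots> \<le> 8 * K\<^sup>2 * tail d"
  proof -
    have "(1 + \<bar>d\<bar>)\<^sup>2 \<le> 2\<^sup>2" using True by (intro power_mono) auto
    then have "1 / 2\<^sup>2 \<le> tail d"
      unfolding tail_def by (intro divide_left_mono) (auto intro!: mult_pos_pos zero_less_power)
    from mult_left_mono[OF this, of "8 * K\<^sup>2"] show ?thesis by simp
  qed
  finally show ?thesis .
next
  case False
  then have "\<bar>Q d\<bar> = \<bar>P d\<bar> / \<bar>d\<bar>" by (auto simp: Q_def)
  also have "\<dots> \<le> \<bar>P d\<bar> / 1" using False by (intro divide_left_mono) auto
  also have "\<dots> \<le> 8 * K\<^sup>2 * tail d"
    using P_bound[of d] mult_right_mono[of "2 * K\<^sup>2" "8 * K\<^sup>2" "tail d"] by simp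
  finally show ?thesis .
qed

lemma scale_pair_Q: "scale_pair (8 * K\<^sup>2) Q q"
  unfolding scale_pair_def
proof (intro conjI allI impI)
  have [measurable]: "P \<in> borel_measurable borel"
    using P_deriv DERIV_isCont by (blast intro!: borel_measurable_continuous_onI continuous_at_imp_continuous_on)
  show "Q \<in> borel_measurable borel" unfolding Q_def[abs_def] by measurable
  show "continuous_on UNIV q" using q_cont by (simp add: continuous_at_imp_continuous_on)
  show "\<bar>Q v\<bar> \<le> 8 * K\<^sup>2 * tail v" for v by (rule Q_bound)
  show "\<bar>q v\<bar> \<le> 8 * K\<^sup>2 * tail v" for v
    using q_bound[of v] mult_right_mono[of "2 * K\<^sup>2" "8 * K\<^sup>2" "tail v"] by simp
  fix t v :: real assume t: "0 < t"
  show "((\<lambda>s. dil s Q v) has_real_derivative - dil t q v / t) (at t)"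
  proof (cases "v = 0")
    case True
    have "((\<lambda>s. q 0 / s) has_real_derivative - (q 0 / t) / t) (at t)"
      using t by (auto intro!: derivative_eq_intros)
    then show ?thesis using True by (simp add: dil_def Q_def)
  next
    case False
    have "((\<lambda>s. v / s) has_real_derivative - v / t\<^sup>2) (at t)"
      using t by (auto intro!: derivative_eq_intros simp: power2_eq_square)
    from DERIV_cdivide[OF DERIV_chain2[OF P_deriv this], of v]
    have "((\<lambda>s. P (v / s) / v) has_real_derivative - dil t q v / t) (at t)"
      using t False by (simp add: dil_def power2_eq_square)
    moreover have "eventually (\<lambda>s. dil s Q v = P (v / s) / v) (nhds t)"
    proof (rule eventually_mono[OF eventually_nhds_in_open[of "{0<..}" t]])
      fix s :: real assume "s \<in> {0<..}"
      then show "dil s Q v = P (v / s) / v"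
        using False by (simp add: dil_def Q_def)
    qed (use t in auto)
    ultimately show ?thesis
      by (subst DERIV_cong_ev[OF refl _ refl]) auto
  qed
qed

text \<open>For fixed \<open>d\<close>, the difference of the left-hand side and \<open>q(d) \<kappa> + Q(d) \<xi>\<close> is even in \<open>m\<close> and has integral
  \<open>q(d) - q(d) - 0 = 0\<close>, so it is a convolution with \<open>rkern\<close>.  The decay in \<open>d\<close> of all three terms passes to \<open>V\<close>.\<close>

lemma kernel_decomposition:
  assumes "averaging_pair C \<kappa> \<kappa>1 \<kappa>2 \<xi> \<xi>1 \<xi>2"
  obtains V where "V \<in> borel_measurable borel" "\<And>v. \<bar>V v\<bar> \<le> (4 * K\<^sup>2 + 10 * K\<^sup>2 * C) * tail d * tail v"
    "\<And>m. \<zeta> (m + d / 2) * \<zeta> (m - d / 2) = q d * \<kappa> m + Q d * \<xi> m + (\<integral>b. V b * rkern (m - b) \<partial>lborel)"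
proof -
  interpret averaging_pair C \<kappa> \<kappa>1 \<kappa>2 \<xi> \<xi>1 \<xi>2 by fact
  note \<kappa> = averaging_deriv and \<xi> = dilated_deriv and b\<kappa> = averaging_decay and b\<xi> = dilated_decay
    and ev = averaging_even and int = averaging_integral
  let ?A = "(4 * K\<^sup>2 + 10 * K\<^sup>2 * C) * tail d"
  define N where "N = (\<lambda>m. \<zeta> (d / 2 + 1 * m) * \<zeta> (- d / 2 + 1 * m) - (q d * \<kappa> m + Q d * \<xi> m))"
  define N1 where "N1 = (\<lambda>m. (\<zeta>1 (d / 2 + 1 * m) * \<zeta> (- d / 2 + 1 * m) + \<zeta>1 (- d / 2 + 1 * m) * \<zeta> (d / 2 + 1 * m)) - (q d * \<kappa>1 m + Q d * \<xi>1 m))"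
  define N2 where "N2 = (\<lambda>m. (\<zeta>2 (d / 2 + 1 * m) * \<zeta> (- d / 2 + 1 * m) + \<zeta>1 (- d / 2 + 1 * m) * \<zeta>1 (d / 2 + 1 * m)
     + (\<zeta>2 (- d / 2 + 1 * m) * \<zeta> (d / 2 + 1 * m) + \<zeta>1 (d / 2 + 1 * m) * \<zeta>1 (- d / 2 + 1 * m))) - (q d * \<kappa>2 m + Q d * \<xi>2 m))"
  have C: "0 \<le> C" using b\<kappa>(1)[of 0] by simp
  have dN: "(N has_real_derivative N1 v) (at v)" for v
    unfolding N_def N1_def
    using DERIV_diff[OF DERIV_mult[OF DERIV_affine_compose[OF deriv(2), of "d / 2" 1 v] DERIV_affine_compose[OF deriv(2), of "- d / 2" 1 v]]
      DERIV_add[OF DERIV_cmult[OF \<kappa>(1)[of v], of "q d"] DERIV_cmult[OF \<xi>(1)[of v], of "Q d"]]] by simp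
  have dN1: "(N1 has_real_derivative N2 v) (at v)" for v
    unfolding N1_def N2_def
    using DERIV_diff[OF DERIV_add[OF DERIV_mult[OF DERIV_affine_compose[OF deriv(3), of "d / 2" 1 v] DERIV_affine_compose[OF deriv(2), of "- d / 2" 1 v]]
       DERIV_mult[OF DERIV_affine_compose[OF deriv(3), of "- d / 2" 1 v] DERIV_affine_compose[OF deriv(2), of "d / 2" 1 v]]]
      DERIV_add[OF DERIV_cmult[OF \<kappa>(2)[of v], of "q d"] DERIV_cmult[OF \<xi>(2)[of v], of "Q d"]]] by simp
  have cN2: "isCont N2 v" for v
    unfolding N2_def
    by (intro continuous_intros isCont_o2[of v "\<lambda>m. _ + 1 * m"] profile_cont deriv(4) \<kappa>(3) \<xi>(3))
  have pr: "\<bar>a (d / 2 + 1 * m) * b (- d / 2 + 1 * m)\<bar> \<le> K\<^sup>2 * (tail d / (1 + \<bar>m\<bar>) ^ 4)"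
    if "\<And>v. \<bar>a v\<bar> \<le> K / (1 + \<bar>v\<bar>) ^ 6" "\<And>v. \<bar>b v\<bar> \<le> K / (1 + \<bar>v\<bar>) ^ 6" for a b m
  proof -
    let ?X = "1 + \<bar>d / 2 + 1 * m\<bar>" and ?Y = "1 + \<bar>- d / 2 + 1 * m\<bar>"
    have XY: "1 + \<bar>d / 2 + 1 * m\<bar> + \<bar>- d / 2 + 1 * m\<bar> \<le> ?X * ?Y"
      by (simp add: algebra_simps)
    have "\<bar>a (d / 2 + 1 * m) * b (- d / 2 + 1 * m)\<bar> \<le> K\<^sup>2 / (1 + \<bar>m\<bar>) ^ 4 * (1 / (1 + \<bar>d\<bar>)\<^sup>2)"
    proof (rule decay_mult[OF _ _ _ _ _ _ that])
      have "\<bar>m\<bar> \<le> \<bar>d / 2 + 1 * m\<bar> + \<bar>- d / 2 + 1 * m\<bar>" "\<bar>d\<bar> \<le> \<bar>d / 2 + 1 * m\<bar> + \<bar>- d / 2 + 1 * m\<bar>"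
        by linarith+
      with XY show "1 + \<bar>m\<bar> \<le> ?X * ?Y" "1 + \<bar>d\<bar> \<le> ?X * ?Y" by linarith+
    qed auto
    then show ?thesis by (simp add: tail_def mult.commute)
  qed
  have pr': "\<bar>a (- d / 2 + 1 * m) * b (d / 2 + 1 * m)\<bar> \<le> K\<^sup>2 * (tail d / (1 + \<bar>m\<bar>) ^ 4)"
    if "\<And>v. \<bar>a v\<bar> \<le> K / (1 + \<bar>v\<bar>) ^ 6" "\<And>v. \<bar>b v\<bar> \<le> K / (1 + \<bar>v\<bar>) ^ 6" for a b m
    using pr[OF that(2,1), of m] by (simp only: mult.commute)
  have qx: "\<bar>q d * x + Q d * y\<bar> \<le> 10 * K\<^sup>2 * C * (tail d / (1 + \<bar>m\<bar>) ^ 4)"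
    if "\<bar>x\<bar> \<le> C / (1 + \<bar>m\<bar>) ^ 4" "\<bar>y\<bar> \<le> C / (1 + \<bar>m\<bar>) ^ 4" for x y m
  proof -
    have "\<bar>q d * x\<bar> \<le> (2 * K\<^sup>2 * tail d) * (C / (1 + \<bar>m\<bar>) ^ 4)"
      unfolding abs_mult by (intro mult_mono q_bound that) auto
    moreover have "\<bar>Q d * y\<bar> \<le> (8 * K\<^sup>2 * tail d) * (C / (1 + \<bar>m\<bar>) ^ 4)"
      unfolding abs_mult by (intro mult_mono Q_bound that) auto
    moreover have "(2 * K\<^sup>2 * tail d) * (C / (1 + \<bar>m\<bar>) ^ 4) + (8 * K\<^sup>2 * tail d) * (C / (1 + \<bar>m\<bar>) ^ 4) = 10 * K\<^sup>2 * C * (tail d / (1 + \<bar>m\<bar>) ^ 4)"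
      by (simp add: field_simps)
    ultimately show ?thesis by linarith
  qed
  have comb: "\<bar>x - y\<bar> \<le> ?A / (1 + \<bar>m\<bar>) ^ 4"
    if "\<bar>x\<bar> \<le> 4 * (K\<^sup>2 * (tail d / (1 + \<bar>m\<bar>) ^ 4))" "\<bar>y\<bar> \<le> 10 * K\<^sup>2 * C * (tail d / (1 + \<bar>m\<bar>) ^ 4)" for x y m
  proof -
    have "4 * (K\<^sup>2 * (tail d / (1 + \<bar>m\<bar>) ^ 4)) + 10 * K\<^sup>2 * C * (tail d / (1 + \<bar>m\<bar>) ^ 4) = ?A / (1 + \<bar>m\<bar>) ^ 4"
      by (simp add: field_simps)
    with that show ?thesis by linarith
  qed
  have KT: "0 \<le> K\<^sup>2 * (tail d / (1 + \<bar>m\<bar>) ^ 4)" for m by simp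
  have bN: "\<bar>N m\<bar> \<le> ?A / (1 + \<bar>m\<bar>) ^ 4" for m
    unfolding N_def by (rule comb[OF _ qx[OF b\<kappa>(1) b\<xi>(1)]]) (use pr[OF decay(2) decay(2), of m] KT[of m] in linarith)
  have bN1: "\<bar>N1 m\<bar> \<le> ?A / (1 + \<bar>m\<bar>) ^ 4" for m
    unfolding N1_def by (rule comb[OF _ qx[OF b\<kappa>(2) b\<xi>(2)]])
      (use pr[OF decay(3) decay(2), of m] pr'[OF decay(3) decay(2), of m] KT[of m] in linarith)
  have bN2: "\<bar>N2 m\<bar> \<le> ?A / (1 + \<bar>m\<bar>) ^ 4" for m
    unfolding N2_def by (rule comb[OF _ qx[OF b\<kappa>(3) b\<xi>(3)]])
      (use pr[OF decay(4) decay(2), of m] pr'[OF decay(4) decay(2), of m] pr[OF decay(3) decay(3), of m] pr'[OF decay(3) decay(3), of m] KT[of m] in linarith)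
  have evN: "N (- m) = N m" for m
  proof -
    have "\<zeta> (d / 2 + 1 * - m) = \<sigma> * \<zeta> (- d / 2 + 1 * m)" "\<zeta> (- d / 2 + 1 * - m) = \<sigma> * \<zeta> (d / 2 + 1 * m)"
      using parity(2)[of "- d / 2 + 1 * m"] parity(2)[of "d / 2 + 1 * m"] by (simp_all add: algebra_simps)
    moreover have "\<sigma> * \<sigma> = 1" using parity(1) by (auto simp: abs_if split: if_splits)
    then have "(\<sigma> * x) * (\<sigma> * y) = y * x" for x y by (simp add: mult_ac)
    ultimately show ?thesis
      unfolding N_def by (simp add: ev)
  qed
  have zN: "(\<integral>m. N m \<partial>lborel) = 0"
  proof -
    have i0: "integrable lborel (\<lambda>u. \<zeta> u * \<zeta> (u - d))"
      by (rule corr_bounds(1)[OF _ _ decay(2) decay(2)]) measurable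
    have i1: "integrable lborel (\<lambda>m. \<zeta> (d / 2 + 1 * m) * \<zeta> ((d / 2 + 1 * m) - d))"
      by (rule lborel_integrable_real_affine[OF i0]) simp
    have "q d = (\<integral>m. \<zeta> (d / 2 + 1 * m) * \<zeta> ((d / 2 + 1 * m) - d) \<partial>lborel)"
      unfolding q_def corr_def using lborel_integral_real_affine[of 1 "\<lambda>u. \<zeta> u * \<zeta> (u - d)" "d / 2"] by simp
    also have "(\<lambda>m. \<zeta> (d / 2 + 1 * m) * \<zeta> ((d / 2 + 1 * m) - d)) = (\<lambda>m. \<zeta> (d / 2 + 1 * m) * \<zeta> (- d / 2 + 1 * m))"
      by (simp add: algebra_simps)
    finally have "(\<integral>m. \<zeta> (d / 2 + 1 * m) * \<zeta> (- d / 2 + 1 * m) \<partial>lborel) = q d" by simp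
    moreover have "integrable lborel (\<lambda>m. \<zeta> (d / 2 + 1 * m) * \<zeta> (- d / 2 + 1 * m))"
      using i1 by (simp add: algebra_simps)
    ultimately show ?thesis
      unfolding N_def using int by simp
  qed
  obtain V where V: "V \<in> borel_measurable borel" "\<And>v. \<bar>V v\<bar> \<le> ?A * tail v"
    "\<And>m. N m = (\<integral>b. V b * rkern (m - b) \<partial>lborel)"
    using mean_zero_even_representation[OF dN dN1 cN2 bN bN1 bN2 evN zN] by blast
  show ?thesis
  proof (rule that[OF V(1,2)])
    fix m
    show "\<zeta> (m + d / 2) * \<zeta> (m - d / 2) = q d * \<kappa> m + Q d * \<xi> m + (\<integral>b. V b * rkern (m - b) \<partial>lborel)"
      using V(3)[of m] by (simp add: N_def algebra_simps)
  qed
qed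

end

section \<open>The continuous square function\<close>

text \<open>The parameter \<open>r\<close> is the point \<open>(x, y)\<close>.\<close>

definition avg :: "(real \<Rightarrow> real) \<Rightarrow> (real \<Rightarrow> real \<Rightarrow> real) \<Rightarrow> (real \<Rightarrow> real \<Rightarrow> real) \<Rightarrow> real \<Rightarrow> real \<times> real \<Rightarrow> real" where
  "avg \<kappa> f g t r = (\<integral>z. f z (snd r) * g z (fst r) * dil t \<kappa> (z - fst r - snd r) \<partial>lborel)"

definition pair_kernel :: "(real \<Rightarrow> real) \<Rightarrow> real \<Rightarrow> (real \<times> real) \<times> (real \<times> real) \<Rightarrow> real" where
  "pair_kernel \<kappa> t p = dil t \<kappa> (fst (fst p) - fst (snd p) - snd (snd p)) * dil t \<kappa> (snd (fst p) - fst (snd p) - snd (snd p))"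

lemma measurable_pair_kernel [measurable]:
  assumes [measurable]: "\<kappa> \<in> borel_measurable borel"
  shows "(\<lambda>x. pair_kernel \<kappa> (fst x) (snd x)) \<in> borel_measurable borel"
    "pair_kernel \<kappa> t \<in> borel_measurable borel"
  unfolding pair_kernel_def[abs_def] by measurable

lemma measurable_avg [measurable]:
  assumes [measurable]: "\<kappa> \<in> borel_measurable borel"
    "case_prod f \<in> borel_measurable (borel \<Otimes>\<^sub>M borel)" "case_prod g \<in> borel_measurable (borel \<Otimes>\<^sub>M borel)"
  shows "(\<lambda>x. avg \<kappa> f g (fst x) (snd x)) \<in> borel_measurable borel" "avg \<kappa> f g t \<in> borel_measurable borel"
  unfolding avg_def[abs_def] by measurable

text \<open>Expansion of the square.  It is legitimate at almost every point, where the slice of the four-fold integrand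
  is integrable.\<close>

lemma avg_square:
  assumes i: "integrable lborel (\<lambda>p. cyc f g p * pair_kernel \<kappa> t p)"
  shows "(\<integral>\<^sup>+r. ennreal ((avg \<kappa> f g t r)\<^sup>2) \<partial>lborel) = ennreal (\<integral>p. cyc f g p * pair_kernel \<kappa> t p \<partial>lborel)"
    "0 \<le> (\<integral>p. cyc f g p * pair_kernel \<kappa> t p \<partial>lborel)"
proof -
  let ?I = "\<lambda>r. \<integral>q. cyc f g (q, r) * pair_kernel \<kappa> t (q, r) \<partial>lborel"
  have ae: "AE r in lborel. ?I r = (avg \<kappa> f g t r)\<^sup>2"
    using AE_integrable_lborel_snd[OF i]
  proof eventually_elim
    case (elim r)
    let ?a = "\<lambda>z. f z (snd r) * g z (fst r) * dil t \<kappa> (z - fst r - snd r)"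
    have "?I r = (\<integral>z. \<integral>z'. cyc f g ((z, z'), r) * pair_kernel \<kappa> t ((z, z'), r) \<partial>lborel \<partial>lborel)"
      using integral_lborel_fst[OF elim] by simp
    also have "\<dots> = (\<integral>z. \<integral>z'. ?a z * ?a z' \<partial>lborel \<partial>lborel)"
      by (simp add: cyc_def pair_kernel_def mult_ac)
    also have "\<dots> = (avg \<kappa> f g t r)\<^sup>2"
      by (simp add: avg_def power2_eq_square)
    finally show ?case .
  qed
  have ip: "integrable lborel ?I" by (rule integrable_lborel_snd[OF i])
  have nn: "AE r in lborel. 0 \<le> ?I r"
    using ae by eventually_elim simp
  have "(\<integral>\<^sup>+r. ennreal ((avg \<kappa> f g t r)\<^sup>2) \<partial>lborel) = (\<integral>\<^sup>+r. ennreal (?I r) \<partial>lborel)"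
    by (rule nn_integral_cong_AE) (use ae in eventually_elim, simp)
  also have "\<dots> = ennreal (\<integral>r. ?I r \<partial>lborel)"
    by (rule nn_integral_eq_integral[OF ip nn])
  finally show "(\<integral>\<^sup>+r. ennreal ((avg \<kappa> f g t r)\<^sup>2) \<partial>lborel) = ennreal (\<integral>p. cyc f g p * pair_kernel \<kappa> t p \<partial>lborel)"
    using integral_lborel_snd[OF i] by simp
  show "0 \<le> (\<integral>p. cyc f g p * pair_kernel \<kappa> t p \<partial>lborel)"
    using integral_nonneg_AE[OF nn] integral_lborel_snd[OF i] by simp
qed

lemma dil_convolution:
  assumes t: "0 < t" and N: "\<And>m. N m = (\<integral>b. V b * l (m - b) \<partial>lborel)"
  shows "dil t N m = (\<integral>b. dil t V b * dil t l (m - b) \<partial>lborel)"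
proof -
  have "(\<integral>b. dil t V b * dil t l (m - b) \<partial>lborel) = \<bar>t\<bar> * (\<integral>b. dil t V (0 + t * b) * dil t l (m - (0 + t * b)) \<partial>lborel)"
    using t lborel_integral_real_affine[of t "\<lambda>b. dil t V b * dil t l (m - b)" 0] by simp
  also have "\<dots> = t * (\<integral>b. (1 / t\<^sup>2) * (V b * l (m / t - b)) \<partial>lborel)"
    using t by (simp add: dil_def diff_divide_distrib power2_eq_square mult_ac)
  also have "\<dots> = dil t N m"
    using t by (simp add: N dil_def power2_eq_square)
  finally show ?thesis by simp
qed

context profile
begin

lemma pair_kernel_bound:
  assumes t: "0 < t"
  shows "\<bar>pair_kernel \<zeta> t p\<bar> \<le> K\<^sup>2 * (dil t tail (gap p) * dil t tail (slant 1 (- 1) p))"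
proof -
  define u where "u = (fst (fst p) - fst (snd p) - snd (snd p)) / t"
  define u' where "u' = (snd (fst p) - fst (snd p) - snd (snd p)) / t"
  have d: "gap p / t = u - u'"
    by (simp add: gap_def u_def u'_def diff_divide_distrib)
  have m: "slant 1 (- 1) p / t = (u + u') / 2"
    using t by (simp add: slant_def u_def u'_def field_simps)
  have XY: "1 + \<bar>u\<bar> + \<bar>u'\<bar> \<le> (1 + \<bar>u\<bar>) * (1 + \<bar>u'\<bar>)"
    by (simp add: algebra_simps)
  have "\<bar>\<zeta> u * \<zeta> u'\<bar> \<le> K\<^sup>2 / (1 + \<bar>(u + u') / 2\<bar>) ^ 4 * (1 / (1 + \<bar>u - u'\<bar>)\<^sup>2)"
  proof (rule decay_mult[OF _ _ _ _ _ _ decay(2) decay(2)])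
    have "\<bar>(u + u') / 2\<bar> \<le> \<bar>u\<bar> + \<bar>u'\<bar>"
      using abs_triangle_ineq[of u u'] by (simp only: abs_divide) simp
    moreover have "\<bar>u - u'\<bar> \<le> \<bar>u\<bar> + \<bar>u'\<bar>"
      by (rule abs_triangle_ineq4)
    ultimately
    show "1 + \<bar>(u + u') / 2\<bar> \<le> (1 + \<bar>u\<bar>) * (1 + \<bar>u'\<bar>)" "1 + \<bar>u - u'\<bar> \<le> (1 + \<bar>u\<bar>) * (1 + \<bar>u'\<bar>)"
      using XY by linarith+
  qed auto
  also have "\<dots> = K\<^sup>2 * (1 / (1 + \<bar>(u + u') / 2\<bar>) ^ 4) * tail (u - u')"
    by (simp add: tail_def)
  also have "\<dots> \<le> K\<^sup>2 * tail ((u + u') / 2) * tail (u - u')"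
    by (intro mult_right_mono mult_left_mono inverse_power_le_tail) auto
  finally have *: "\<bar>\<zeta> u * \<zeta> u'\<bar> \<le> K\<^sup>2 * tail ((u + u') / 2) * tail (u - u')" .
  have "\<bar>pair_kernel \<zeta> t p\<bar> = \<bar>\<zeta> u * \<zeta> u'\<bar> / t\<^sup>2"
    using t by (simp add: pair_kernel_def dil_def u_def u'_def abs_mult power2_eq_square)
  also have "\<dots> \<le> K\<^sup>2 * tail ((u + u') / 2) * tail (u - u') / t\<^sup>2"
    by (intro divide_right_mono *) simp
  also have "\<dots> = K\<^sup>2 * (dil t tail (gap p) * dil t tail (slant 1 (- 1) p))"
    by (simp add: dil_def d m power2_eq_square mult_ac)
  finally show ?thesis .
qed

text \<open>The kernel \<open>pair_kernel\<close> is split by \<open>kernel_decomposition\<close> into a telescoping part and a remainder.  The remainder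
  is bounded, separately at almost every \<open>(z, z')\<close>, by the one-function forms of \<open>f\<close> and of \<open>g\<close>.\<close>

lemma square_function_estimate:
  obtains C where "0 \<le> C"
    "\<And>f g B t0 t1. case_prod f \<in> borel_measurable (borel \<Otimes>\<^sub>M borel) \<Longrightarrow> case_prod g \<in> borel_measurable (borel \<Otimes>\<^sub>M borel) \<Longrightarrow>
      fourth f + fourth g \<le> ennreal B \<Longrightarrow> 0 \<le> B \<Longrightarrow> 0 < t0 \<Longrightarrow> t0 \<le> t1 \<Longrightarrow>
      (\<integral>\<^sup>+t. ennreal (indicator {t0..t1} t / t) * (\<integral>\<^sup>+r. ennreal ((avg \<zeta> f g t r)\<^sup>2) \<partial>lborel) \<partial>lborel) \<le> ennreal (C * B)"
proof -
  obtain C \<kappa> \<kappa>1 \<kappa>2 \<xi> \<xi>1 \<xi>2 where avp: "averaging_pair C \<kappa> \<kappa>1 \<kappa>2 \<xi> \<xi>1 \<xi>2"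
    using averaging_pair_exists by blast
  note C = averaging_pair.averaging_nonneg[OF avp] and sp = averaging_pair.averaging_scale_pair[OF avp]
  define A where "A = 4 * K\<^sup>2 + 10 * K\<^sup>2 * C"
  have A: "0 \<le> A" using C by (simp add: A_def)
  note p1 = scale_pairD[OF scale_pair_Q] and p2 = scale_pairD[OF sp]
  note [measurable] = p1(1,2) p2(1,2)
  define D where "D = 4 * (8 * K\<^sup>2 * C) + 288 * A"
  have main: "(\<integral>\<^sup>+t. ennreal (indicator {t0..t1} t / t) * (\<integral>\<^sup>+r. ennreal ((avg \<zeta> f g t r)\<^sup>2) \<partial>lborel) \<partial>lborel) \<le> ennreal (D * B)"
    if fm [measurable]: "case_prod f \<in> borel_measurable (borel \<Otimes>\<^sub>M borel)"
      and gm [measurable]: "case_prod g \<in> borel_measurable (borel \<Otimes>\<^sub>M borel)"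
      and B: "fourth f + fourth g \<le> ennreal B" "0 \<le> B" and t: "0 < t0" "t0 \<le> t1" for f g B t0 t1
  proof -
    have Bf: "fourth f \<le> ennreal B" and Bg: "fourth g \<le> ennreal B"
      using B(1) by (auto intro: order_trans[rotated])
    have ff: "fourth f < \<infinity>" "fourth g < \<infinity>"
      using Bf Bg by (auto intro: le_less_trans)
    have one: "\<bar>1::real\<bar> = 1" "\<bar>- 1::real\<bar> = 1" by simp_all
    let ?M = "\<lambda>t p. dil t q (gap p) * dil t \<kappa> (slant 1 (- 1) p) + dil t Q (gap p) * dil t \<xi> (slant 1 (- 1) p)"
    let ?Z = "pair_kernel \<zeta>"
    let ?E = "\<lambda>t p. ?Z t p - ?M t p"
    have Mb: "\<bar>?M t p\<bar> \<le> 2 * (8 * K\<^sup>2 * C) * (dil t tail (gap p) * dil t tail (slant 1 (- 1) p))" if t: "0 < t" for t p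
    proof -
      have prod: "\<bar>a * b\<bar> \<le> 8 * K\<^sup>2 * C * (c * d)" if "\<bar>a\<bar> \<le> 8 * K\<^sup>2 * c" "\<bar>b\<bar> \<le> C * d" for a b c d
        using mult_mono[OF that] that C by (simp add: abs_mult mult_ac)
      show ?thesis
        using prod[OF p1(11)[OF t, of "gap p"] p2(10)[OF t, of "slant 1 (- 1) p"]]
          prod[OF p1(10)[OF t, of "gap p"] p2(11)[OF t, of "slant 1 (- 1) p"]]
        by linarith
    qed
    have CC: "0 \<le> 2 * (8 * K\<^sup>2 * C)" using C by simp
    have iZ: "integrable lborel (\<lambda>p. cyc f g p * ?Z t p)" if "0 < t" for t
      by (rule integrable_cyc_kernel[OF fm gm _ that one(2) B pair_kernel_bound[OF that]]) auto
    have iM: "integrable lborel (\<lambda>p. cyc f g p * ?M t p)" if "0 < t" for t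
      by (rule integrable_cyc_kernel[OF fm gm _ that one(2) B Mb[OF that] CC]) measurable
    have iE: "integrable lborel (\<lambda>p. cyc f g p * ?E t p)" if "0 < t" for t
      using Bochner_Integration.integrable_diff[OF iZ[OF that] iM[OF that]] by (simp add: right_diff_distrib)
    let ?R = "\<lambda>h t. \<integral>p. cyc h h p * (dil t tail (gap p) * dil t rkern (slant 0 1 p)) \<partial>lborel"
    have iR: "integrable lborel (\<lambda>p. cyc h h p * (dil t tail (gap p) * dil t rkern (slant 0 1 p)))"
      if t: "0 < t" and hm: "case_prod h \<in> borel_measurable (borel \<Otimes>\<^sub>M borel)" and Bh: "fourth h \<le> ennreal B" for h t
    proof (rule integrable_cyc_kernel[OF hm hm _ t one(1)])
      show "fourth h + fourth h \<le> ennreal (2 * B)" "0 \<le> 2 * B"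
        using add_mono[OF Bh Bh] B(2) by (simp_all flip: ennreal_plus)
      show "\<bar>dil t tail (gap p) * dil t rkern (slant 0 1 p)\<bar> \<le> 18 * (dil t tail (gap p) * dil t tail (slant 0 1 p))" for p
      proof -
        have n: "0 \<le> dil t tail (gap p)" using t by (simp add: dil_def)
        then show ?thesis
          using mult_left_mono[OF scale_pairD(11)[OF scale_pair_ekern t] n, of "slant 0 1 p"] by (simp add: abs_mult mult_ac)
      qed
    qed simp_all
    have err: "(\<integral>p. cyc f g p * ?E t p \<partial>lborel) \<le> A * (?R f t + ?R g t)" if t: "0 < t" for t
    proof -
      let ?l = "dil t rkern"
      let ?h = "\<lambda>q y. f (fst q) y * f (snd q) y" and ?k = "\<lambda>q x. g (fst q) x * g (snd q) x"
      have "(\<integral>p. cyc f g p * ?E t p \<partial>lborel) = (\<integral>q. \<integral>r. cyc f g (q, r) * ?E t (q, r) \<partial>lborel \<partial>lborel)"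
        using integral_lborel_fst[OF iE[OF t]] by simp
      also have "\<dots> \<le> (\<integral>q. A * (dil t tail (fst q - snd q) * quad ?l (?h q) (?h q) + dil t tail (fst q - snd q) * quad ?l (?k q) (?k q)) \<partial>lborel)"
      proof (rule integral_mono_AE)
        show "integrable lborel (\<lambda>q. \<integral>r. cyc f g (q, r) * ?E t (q, r) \<partial>lborel)"
          by (rule integrable_lborel_fst[OF iE[OF t]])
        show "integrable lborel (\<lambda>q. A * (dil t tail (fst q - snd q) * quad ?l (?h q) (?h q) + dil t tail (fst q - snd q) * quad ?l (?k q) (?k q)))"
          using integral_cyc_quad(2)[OF fm iR[OF t fm Bf]] integral_cyc_quad(2)[OF gm iR[OF t gm Bg]] by simp
        show "AE q in lborel. (\<integral>r. cyc f g (q, r) * ?E t (q, r) \<partial>lborel)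
            \<le> A * (dil t tail (fst q - snd q) * quad ?l (?h q) (?h q) + dil t tail (fst q - snd q) * quad ?l (?k q) (?k q))"
          using AE_square_integrable[OF fm ff(1)] AE_square_integrable[OF gm ff(2)]
        proof eventually_elim
          case (elim w)
          define d where "d = (fst w - snd w) / t"
          obtain V where V: "V \<in> borel_measurable borel" "\<And>v. \<bar>V v\<bar> \<le> A * tail d * tail v"
            and dec: "\<And>m. \<zeta> (m + d / 2) * \<zeta> (m - d / 2) = q d * \<kappa> m + Q d * \<xi> m + (\<integral>b. V b * rkern (m - b) \<partial>lborel)"
            using kernel_decomposition[OF avp] unfolding A_def by blast
          note [measurable] = V(1)
          define N where "N = (\<lambda>m. \<integral>b. V b * rkern (m - b) \<partial>lborel)"
          let ?c = "(fst w + snd w) / 2"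
          \<comment> \<open>Both kernels in the pair are dilated, but only the variable \<open>m\<close> is integrated, hence the extra factor \<open>1/t\<close>.\<close>
          have E: "?E t (w, r) = (1 / t) * dil t N (?c - fst r - snd r)" for r
          proof -
            define m where "m = (?c - fst r - snd r) / t"
            have sl: "slant 1 (- 1) (w, r) / t = m" "gap (w, r) / t = d"
              by (simp_all add: slant_def gap_def m_def d_def algebra_simps)
            have u: "(fst w - fst r - snd r) / t = m + d / 2" "(snd w - fst r - snd r) / t = m - d / 2"
              using t by (simp_all add: m_def d_def field_simps)
            have "?E t (w, r) = (\<zeta> (m + d / 2) * \<zeta> (m - d / 2) - (q d * \<kappa> m + Q d * \<xi> m)) / (t * t)"
              unfolding pair_kernel_def dil_def fst_conv snd_conv u sl
              by (simp add: diff_divide_distrib add_divide_distrib)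
            also have "\<dots> = N m / (t * t)"
              using dec[of m] by (simp add: N_def)
            finally show ?thesis
              by (simp add: dil_def m_def)
          qed
          have nV: "(\<integral>\<^sup>+b. ennreal \<bar>dil t V b\<bar> \<partial>lborel) \<le> ennreal (2 * (A * tail d))"
          proof -
            have "(\<integral>\<^sup>+b. ennreal \<bar>dil t V b\<bar> \<partial>lborel) = (\<integral>\<^sup>+b. ennreal \<bar>V b\<bar> \<partial>lborel)"
              using nn_integral_dil[of "\<lambda>v. \<bar>V v\<bar>" t 1 0] t by (simp add: dil_def)
            then show ?thesis
              using integrable_tail_bound(2)[OF V] by simp
          qed
          have mh: "?h w \<in> borel_measurable borel" "?k w \<in> borel_measurable borel" by measurable
          have mV: "dil t V \<in> borel_measurable borel" unfolding dil_def[abs_def] by measurable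
          have conv: "\<bar>\<integral>r. ?h w (snd r) * ?k w (fst r) * dil t N (?c - fst r - snd r) \<partial>lborel\<bar>
            \<le> 2 * (A * tail d) * ((quad ?l (?h w) (?h w) + quad ?l (?k w) (?k w)) / 2)"
            by (rule quad_convolution_bound[OF psd_kernel_rkern[OF t] mV nV _ mh(1) elim(1) mh(2) elim(2) dil_convolution[OF t]])
              (use A in \<open>simp_all add: N_def\<close>)
          have "(\<integral>r. cyc f g (w, r) * ?E t (w, r) \<partial>lborel) = (1 / t) * (\<integral>r. ?h w (snd r) * ?k w (fst r) * dil t N (?c - fst r - snd r) \<partial>lborel)"
            unfolding E by (subst integral_mult_right_zero[symmetric]) (simp add: cyc_def mult_ac)
          also have "\<dots> \<le> (1 / t) * (2 * (A * tail d) * ((quad ?l (?h w) (?h w) + quad ?l (?k w) (?k w)) / 2))"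
            using conv t by (intro mult_left_mono) auto
          also have "\<dots> = A * (dil t tail (fst w - snd w) * quad ?l (?h w) (?h w) + dil t tail (fst w - snd w) * quad ?l (?k w) (?k w))"
            by (simp add: dil_def d_def algebra_simps add_divide_distrib)
          finally show ?case .
        qed
      qed
      also have "\<dots> = A * (?R f t + ?R g t)"
        using integral_cyc_quad(1,2)[OF fm iR[OF t fm Bf]] integral_cyc_quad(1,2)[OF gm iR[OF t gm Bg]] by simp
      finally show ?thesis .
    qed
    have zm: "(\<lambda>x. cyc f g (snd x) * ?Z (fst x) (snd x)) \<in> borel_measurable borel" by measurable
    have slabZ: "integrable lborel (\<lambda>(t, p). indicator {t0..t1} t / t * (cyc f g p * ?Z t p))"
    proof (rule integrable_slab[OF _ t(1), of _ _ "2 * K\<^sup>2 * B"])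
      show "(\<lambda>(t, p). cyc f g p * ?Z t p) \<in> borel_measurable borel"
        using zm by (simp add: case_prod_beta')
      fix s assume "t0 \<le> s"
      then have s: "0 < s" using t by simp
      show "(\<integral>\<^sup>+p. ennreal \<bar>cyc f g p * ?Z s p\<bar> \<partial>lborel) \<le> ennreal (2 * K\<^sup>2 * B)"
        by (rule nn_integral_cyc_kernel[OF fm gm s one(2) B pair_kernel_bound[OF s]]) simp
    qed
    have slabM: "integrable lborel (\<lambda>(t, p). indicator {t0..t1} t / t * (cyc f g p * ?M t p))"
    proof (rule integrable_slab[OF _ t(1), of _ _ "2 * (2 * (8 * K\<^sup>2 * C)) * B"])
      show "(\<lambda>(t, p). cyc f g p * ?M t p) \<in> borel_measurable borel"
        unfolding case_prod_beta' by measurable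
      fix s assume "t0 \<le> s"
      then have s: "0 < s" using t by simp
      show "(\<integral>\<^sup>+p. ennreal \<bar>cyc f g p * ?M s p\<bar> \<partial>lborel) \<le> ennreal (2 * (2 * (8 * K\<^sup>2 * C)) * B)"
        by (rule nn_integral_cyc_kernel[OF fm gm s one(2) B Mb[OF s] CC])
    qed
    let ?i = "\<lambda>t. indicator {t0..t1} t / t :: real"
    let ?JZ = "\<lambda>t. ?i t * (\<integral>p. cyc f g p * ?Z t p \<partial>lborel)" and ?JM = "\<lambda>t. ?i t * (\<integral>p. cyc f g p * ?M t p \<partial>lborel)"
    have JZ: "integrable lborel ?JZ" and JM: "integrable lborel ?JM"
      using integrable_lborel_fst[OF slabZ] integrable_lborel_fst[OF slabM] by simp_all
    note Jf = one_function_estimate[OF fm t Bf B(2)] and Jg = one_function_estimate[OF gm t Bg B(2)]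
    have i0: "0 \<le> ?i t" for t using t by (auto simp: indicator_def)
    have JZ0: "0 \<le> ?JZ s" for s
      using avg_square(2)[OF iZ, of s] i0[of s] t by (cases "s \<in> {t0..t1}") auto
    have "(\<integral>t. ?JZ t \<partial>lborel) \<le> (\<integral>t. ?JM t + A * (?i t * ?R f t + ?i t * ?R g t) \<partial>lborel)"
    proof (rule integral_mono[OF JZ])
      show "integrable lborel (\<lambda>t. ?JM t + A * (?i t * ?R f t + ?i t * ?R g t))"
        using JM Jf(2) Jg(2) by simp
      fix s :: real
      show "?JZ s \<le> ?JM s + A * (?i s * ?R f s + ?i s * ?R g s)"
      proof (cases "s \<in> {t0..t1}")
        case True
        then have s: "0 < s" using t by simp
        have "(\<integral>p. cyc f g p * ?Z s p \<partial>lborel) = (\<integral>p. cyc f g p * ?M s p \<partial>lborel) + (\<integral>p. cyc f g p * ?E s p \<partial>lborel)"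
          by (subst Bochner_Integration.integral_add[OF iM[OF s] iE[OF s], symmetric]) (simp add: algebra_simps)
        also have "\<dots> \<le> (\<integral>p. cyc f g p * ?M s p \<partial>lborel) + A * (?R f s + ?R g s)"
          using err[OF s] by simp
        finally have "?JZ s \<le> ?i s * ((\<integral>p. cyc f g p * ?M s p \<partial>lborel) + A * (?R f s + ?R g s))"
          by (rule mult_left_mono[OF _ i0])
        also have "\<dots> = ?JM s + A * (?i s * ?R f s + ?i s * ?R g s)"
          by (simp only: distrib_left mult.left_commute)
        finally show ?thesis .
      qed simp
    qed
    also have "\<dots> = (\<integral>t. ?JM t \<partial>lborel) + A * ((\<integral>t. ?i t * ?R f t \<partial>lborel) + (\<integral>t. ?i t * ?R g t \<partial>lborel))"
      using JM Jf(2) Jg(2) by simp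
    also have "\<dots> \<le> 4 * (8 * K\<^sup>2 * C) * B + A * (144 * B + 144 * B)"
    proof (intro add_mono mult_left_mono A Jf(1) Jg(1))
      show "(\<integral>t. ?JM t \<partial>lborel) \<le> 4 * (8 * K\<^sup>2 * C) * B"
        using telescoping_cyc[OF fm gm t one(2) B scale_pair_Q sp, of 1] by linarith
    qed
    also have "\<dots> = D * B"
      by (simp add: D_def algebra_simps)
    finally have fin: "(\<integral>t. ?JZ t \<partial>lborel) \<le> D * B" .
    have "(\<integral>\<^sup>+t. ennreal (?i t) * (\<integral>\<^sup>+r. ennreal ((avg \<zeta> f g t r)\<^sup>2) \<partial>lborel) \<partial>lborel) = (\<integral>\<^sup>+t. ennreal (?JZ t) \<partial>lborel)"
    proof (rule nn_integral_cong)
      fix s :: real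
      show "ennreal (?i s) * (\<integral>\<^sup>+r. ennreal ((avg \<zeta> f g s r)\<^sup>2) \<partial>lborel) = ennreal (?JZ s)"
      proof (cases "s \<in> {t0..t1}")
        case True
        then have s: "0 < s" using t by simp
        show ?thesis
          unfolding avg_square(1)[OF iZ[OF s]] by (rule ennreal_mult'[symmetric, OF i0])
      qed simp
    qed
    also have "\<dots> = ennreal (\<integral>t. ?JZ t \<partial>lborel)"
      by (rule nn_integral_eq_integral[OF JZ]) (use JZ0 in simp)
    also have "\<dots> \<le> ennreal (D * B)"
      using fin by (rule ennreal_leI)
    finally show ?thesis .
  qed
  have "0 \<le> D" using A C by (simp add: D_def)
  then show ?thesis
    using main by (rule that)
qed

end

section \<open>From the continuous to the dyadic square function\<close>

text \<open>Dilations of the weight are comparable to the weight itself.  Hence one exceptional null set of points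
  serves all scales and all kernels at once.\<close>

lemma dil_tail_le:
  assumes t: "0 < t"
  shows "dil t tail v \<le> (t + 1 / t) * tail v"
proof -
  have eq: "dil t tail v = t / (t + \<bar>v\<bar>)\<^sup>2"
  proof -
    have "1 + \<bar>v / t\<bar> = (t + \<bar>v\<bar>) / t" using t by (simp add: field_simps)
    then show ?thesis using t by (simp add: dil_def tail_def power_divide power2_eq_square)
  qed
  show ?thesis
  proof (cases "1 \<le> t")
    case True
    have "t / (t + \<bar>v\<bar>)\<^sup>2 \<le> t / (1 + \<bar>v\<bar>)\<^sup>2"
      using True by (intro divide_left_mono power_mono) (auto intro!: mult_pos_pos zero_less_power)
    also have "\<dots> = t * tail v" by (simp add: tail_def)
    also have "\<dots> \<le> (t + 1 / t) * tail v" using t by (intro mult_right_mono) auto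
    finally show ?thesis unfolding eq .
  next
    case False
    have "tail (v / t) \<le> tail v"
      unfolding tail_def
    proof (intro divide_left_mono power_mono)
      have "\<bar>v\<bar> * 1 \<le> \<bar>v\<bar> * (1 / t)" using False t by (intro mult_left_mono) auto
      then show "1 + \<bar>v\<bar> \<le> 1 + \<bar>v / t\<bar>" using t by (simp add: abs_divide)
    qed (auto intro!: mult_pos_pos zero_less_power add_pos_nonneg)
    then have "dil t tail v \<le> tail v / t" unfolding dil_def using t by (intro divide_right_mono) auto
    also have "\<dots> = 1 / t * tail v" by simp
    also have "\<dots> \<le> (t + 1 / t) * tail v" using t by (intro mult_right_mono) auto
    finally show ?thesis .
  qed
qed

lemma AE_weighted_product_finite:
  assumes [measurable]: "case_prod f \<in> borel_measurable (borel \<Otimes>\<^sub>M borel)"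
    "case_prod g \<in> borel_measurable (borel \<Otimes>\<^sub>M borel)"
    and fin: "fourth f < \<infinity>" "fourth g < \<infinity>"
  shows "AE r in lborel. (\<integral>\<^sup>+z. ennreal \<bar>f z (snd r) * g z (fst r) * tail (z - fst r - snd r)\<bar> \<partial>lborel) < \<infinity>"
proof -
  let ?w = "\<lambda>z r. ennreal (tail (z - fst r - snd r))"
  let ?f = "\<lambda>z y. ennreal (f z y ^ 4)" and ?g = "\<lambda>z y. ennreal (g z y ^ 4)"
  have wx: "(\<integral>\<^sup>+x. ennreal (tail (z - x - y)) \<partial>lborel) = 2" for z y
    using nn_integral_dil_tail[of 1 "-1" "z - y"] by (simp add: dil_def algebra_simps)
  have wy: "(\<integral>\<^sup>+y. ennreal (tail (z - x - y)) \<partial>lborel) = 2" for z x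
    using nn_integral_dil_tail[of 1 "-1" "z - x"] by (simp add: dil_def)
  have wz: "(\<integral>\<^sup>+z. ?w z r \<partial>lborel) = 2" for r
    using nn_integral_dil_tail[of 1 "1" "- fst r - snd r"] by (simp add: dil_def algebra_simps)
  have pt: "ennreal \<bar>f z (snd r) * g z (fst r) * tail (z - fst r - snd r)\<bar>
      \<le> ?w z r + (?f z (snd r) * ?w z r + ?g z (fst r) * ?w z r)" for z r
  proof -
    have "\<bar>a * b\<bar> \<le> 1 + (a ^ 4 + b ^ 4)" for a b :: real
    proof -
      have "\<bar>a * b\<bar> \<le> 1\<^sup>2 + (a * b)\<^sup>2" using abs_mult_le_squares[of 1 "a * b"] by simp
      moreover have "(a * b)\<^sup>2 \<le> a ^ 4 + b ^ 4"
        using abs_mult_le_squares[of "a\<^sup>2" "b\<^sup>2"] by (simp add: power_mult_distrib power_mult[symmetric])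
      ultimately show ?thesis by simp
    qed
    from mult_right_mono[OF this[of "f z (snd r)" "g z (fst r)"], of "tail (z - fst r - snd r)"]
    have "\<bar>f z (snd r) * g z (fst r) * tail (z - fst r - snd r)\<bar>
      \<le> tail (z - fst r - snd r) + (f z (snd r) ^ 4 * tail (z - fst r - snd r) + g z (fst r) ^ 4 * tail (z - fst r - snd r))"
      by (simp add: abs_mult algebra_simps)
    then show ?thesis
      by (simp add: ennreal_mult'[symmetric] ennreal_plus[symmetric] ennreal_leI del: ennreal_plus)
  qed
  let ?X = "\<lambda>r. \<integral>\<^sup>+z. (?f z (snd r) * ?w z r + ?g z (fst r) * ?w z r) \<partial>lborel"
  have "(\<integral>\<^sup>+r. ?X r \<partial>lborel) = (\<integral>\<^sup>+z. \<integral>\<^sup>+r. (?f z (snd r) * ?w z r + ?g z (fst r) * ?w z r) \<partial>lborel \<partial>lborel)"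
    by (rule nn_integral_lborel_swap) (unfold case_prod_beta', measurable)
  also have "\<dots> = (\<integral>\<^sup>+z. (2 * (\<integral>\<^sup>+y. ?f z y \<partial>lborel) + 2 * (\<integral>\<^sup>+x. ?g z x \<partial>lborel)) \<partial>lborel)"
  proof (rule nn_integral_cong)
    fix z
    have m: "(\<lambda>r. ?f z (snd r) * ?w z r) \<in> borel_measurable borel" "(\<lambda>r. ?g z (fst r) * ?w z r) \<in> borel_measurable borel"
      by measurable
    have "(\<integral>\<^sup>+r. ?f z (snd r) * ?w z r \<partial>lborel) = 2 * (\<integral>\<^sup>+y. ?f z y \<partial>lborel)"
      unfolding nn_integral_lborel_snd[OF m(1), symmetric] fst_conv snd_conv
      by (simp add: nn_integral_cmult wx nn_integral_multc mult.commute)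
    moreover have "(\<integral>\<^sup>+r. ?g z (fst r) * ?w z r \<partial>lborel) = 2 * (\<integral>\<^sup>+y. ?g z y \<partial>lborel)"
      unfolding nn_integral_lborel_fst[OF m(2), symmetric] fst_conv snd_conv
      by (simp add: nn_integral_cmult wy nn_integral_multc mult.commute)
    ultimately show "(\<integral>\<^sup>+r. (?f z (snd r) * ?w z r + ?g z (fst r) * ?w z r) \<partial>lborel) = 2 * (\<integral>\<^sup>+y. ?f z y \<partial>lborel) + 2 * (\<integral>\<^sup>+x. ?g z x \<partial>lborel)"
      by (subst nn_integral_add) auto
  qed
  also have "\<dots> = 2 * fourth f + 2 * fourth g"
    unfolding fourth_def by (simp add: nn_integral_add nn_integral_cmult)
  also have "\<dots> < \<infinity>" using fin by (simp add: ennreal_mult_less_top)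
  finally have "AE r in lborel. ?X r \<noteq> \<infinity>"
    by (intro nn_integral_PInf_AE) (auto simp: less_top)
  then show ?thesis
  proof eventually_elim
    case (elim r)
    have "(\<integral>\<^sup>+z. ennreal \<bar>f z (snd r) * g z (fst r) * tail (z - fst r - snd r)\<bar> \<partial>lborel)
      \<le> (\<integral>\<^sup>+z. ?w z r + (?f z (snd r) * ?w z r + ?g z (fst r) * ?w z r) \<partial>lborel)"
      by (intro nn_integral_mono pt)
    also have "\<dots> = 2 + ?X r"
      by (subst nn_integral_add) (auto simp: wz)
    also have "\<dots> < \<infinity>" using elim by (simp add: less_top)
    finally show ?case .
  qed
qed

lemma finite_int_subset_interval:
  assumes "finite (J :: int set)"
  shows "\<exists>n::nat. J \<subseteq> {- int n..int n}"
proof -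
  have "finite ((\<lambda>k. nat \<bar>k\<bar>) ` J)" using assms by simp
  then obtain n where n: "\<forall>k\<in>(\<lambda>k. nat \<bar>k\<bar>) ` J. k \<le> n"
    by (meson finite_nat_set_iff_bounded_le)
  have "- int n \<le> k \<and> k \<le> int n" if "k \<in> J" for k
  proof -
    have "nat \<bar>k\<bar> \<le> n" using n that by blast
    then show ?thesis by arith
  qed
  then show ?thesis by force
qed

lemma integrable_weighted:
  assumes [measurable]: "h \<in> borel_measurable borel"
    and fin: "(\<integral>\<^sup>+z. ennreal \<bar>h z * tail (z - c)\<bar> \<partial>lborel) < \<infinity>"
    and k [measurable]: "k \<in> borel_measurable borel" and kb: "\<And>v. \<bar>k v\<bar> \<le> M * tail v" and t: "0 < t"
  shows "(\<integral>\<^sup>+z. ennreal \<bar>h z * dil t k (z - c)\<bar> \<partial>lborel) \<le> ennreal (M * (t + 1 / t)) * (\<integral>\<^sup>+z. ennreal \<bar>h z * tail (z - c)\<bar> \<partial>lborel)"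
    "integrable lborel (\<lambda>z. h z * dil t k (z - c))"
proof -
  have M: "0 \<le> M" using kb[of 0] by (simp add: tail_def)
  have "\<bar>dil t k v\<bar> \<le> (M * (t + 1 / t)) * tail v" for v
  proof -
    have "\<bar>dil t k v\<bar> \<le> M * dil t tail v"
      unfolding dil_def abs_divide using kb[of "v / t"] t divide_right_mono[of "\<bar>k (v / t)\<bar>" "M * tail (v / t)" t] by simp
    also have "\<dots> \<le> M * ((t + 1 / t) * tail v)"
      by (intro mult_left_mono dil_tail_le t M)
    finally show ?thesis by (simp only: mult.assoc)
  qed
  then have pt: "\<bar>h z * dil t k (z - c)\<bar> \<le> (M * (t + 1 / t)) * \<bar>h z * tail (z - c)\<bar>" for z
    using mult_left_mono[of "\<bar>dil t k (z - c)\<bar>" "(M * (t + 1 / t)) * tail (z - c)" "\<bar>h z\<bar>"]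
    by (simp only: abs_mult mult_ac abs_ge_zero) (simp add: mult_ac)
  have Mt: "0 \<le> M * (t + 1 / t)" using M t by simp
  have "(\<integral>\<^sup>+z. ennreal \<bar>h z * dil t k (z - c)\<bar> \<partial>lborel) \<le> (\<integral>\<^sup>+z. ennreal (M * (t + 1 / t)) * ennreal \<bar>h z * tail (z - c)\<bar> \<partial>lborel)"
    by (intro nn_integral_mono) (use pt Mt in \<open>simp only: ennreal_mult'[symmetric] ennreal_leI\<close>)
  also have "\<dots> = ennreal (M * (t + 1 / t)) * (\<integral>\<^sup>+z. ennreal \<bar>h z * tail (z - c)\<bar> \<partial>lborel)"
    by (rule nn_integral_cmult) measurable
  finally show *: "(\<integral>\<^sup>+z. ennreal \<bar>h z * dil t k (z - c)\<bar> \<partial>lborel) \<le> ennreal (M * (t + 1 / t)) * (\<integral>\<^sup>+z. ennreal \<bar>h z * tail (z - c)\<bar> \<partial>lborel)" .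
  show "integrable lborel (\<lambda>z. h z * dil t k (z - c))"
    using le_less_trans[OF *] fin by (intro integrableI_bounded) (auto simp: ennreal_mult_less_top)
qed

definition difference :: "(real \<Rightarrow> real) \<Rightarrow> real \<Rightarrow> real" where
  "difference u v = u v - 2 * u (2 * v)"

lemma measurable_difference [measurable]:
  assumes [measurable]: "u \<in> borel_measurable borel"
  shows "difference u \<in> borel_measurable borel"
  unfolding difference_def[abs_def] by measurable

text \<open>The conditions on \<open>u\<close> that make \<open>\<zeta> = (v u)'\<close> a profile.\<close>

locale parity_bump =
  fixes K \<sigma> :: real and u u1 u2 u3 :: "real \<Rightarrow> real"
  assumes bump_deriv: "\<And>v. (u has_real_derivative u1 v) (at v)" "\<And>v. (u1 has_real_derivative u2 v) (at v)"
      "\<And>v. (u2 has_real_derivative u3 v) (at v)" "\<And>v. isCont u3 v"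
    and bump_decay: "\<And>v. \<bar>u v\<bar> \<le> K / (1 + \<bar>v\<bar>) ^ 7" "\<And>v. \<bar>u1 v\<bar> \<le> K / (1 + \<bar>v\<bar>) ^ 7"
      "\<And>v. \<bar>u2 v\<bar> \<le> K / (1 + \<bar>v\<bar>) ^ 7" "\<And>v. \<bar>u3 v\<bar> \<le> K / (1 + \<bar>v\<bar>) ^ 7"
    and bump_parity: "\<bar>\<sigma>\<bar> = 1" "\<And>v. u (- v) = \<sigma> * u v"
begin

lemma bump_combination_bound:
  assumes "\<bar>a\<bar> \<le> K / (1 + \<bar>v\<bar>) ^ 7" "\<bar>b\<bar> \<le> K / (1 + \<bar>v\<bar>) ^ 7" and c: "0 \<le> c" "c \<le> 3"
  shows "\<bar>c * a + v * b\<bar> \<le> 4 * K / (1 + \<bar>v\<bar>) ^ 6"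
proof -
  let ?S = "1 + \<bar>v\<bar>"
  have K: "0 \<le> K" using bump_decay(1)[of 0] by simp
  have "\<bar>c * a + v * b\<bar> \<le> c * \<bar>a\<bar> + \<bar>v\<bar> * \<bar>b\<bar>"
    using abs_triangle_ineq[of "c * a" "v * b"] c by (simp add: abs_mult)
  also have "\<dots> \<le> 3 * (K / ?S ^ 7) + \<bar>v\<bar> * (K / ?S ^ 7)"
    using assms K by (intro add_mono mult_mono) auto
  also have "\<dots> = (3 + \<bar>v\<bar>) * (K / ?S ^ 7)" by (rule distrib_right[symmetric])
  also have "\<dots> \<le> (4 * ?S) * (K / ?S ^ 7)" using K by (intro mult_right_mono) auto
  also have "\<dots> = 4 * K / ?S ^ 6"
  proof -
    have "(4 * S) * (K / S ^ 7) = 4 * K / S ^ 6" if "0 < S" for S :: real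
    proof -
      have "S ^ 7 = S * S ^ 6" by (simp add: power_Suc[symmetric] del: power_Suc)
      moreover have "(4 * S) * (K / (S * T)) = 4 * K / T" for T using that by simp
      ultimately show ?thesis by (simp only:)
    qed
    from this[of ?S] show ?thesis by simp
  qed
  finally show ?thesis .
qed

abbreviation "\<eta> v \<equiv> v * u v"
abbreviation "\<zeta> v \<equiv> u v + v * u1 v"
abbreviation "\<zeta>1 v \<equiv> 2 * u1 v + v * u2 v"
abbreviation "\<zeta>2 v \<equiv> 3 * u2 v + v * u3 v"

lemma bump_cont: "isCont u v" "isCont u1 v" "isCont u2 v"
  using bump_deriv DERIV_isCont by blast+

sublocale profile "4 * K" \<sigma> "\<lambda>v. \<eta> v" "\<lambda>v. \<zeta> v" "\<lambda>v. \<zeta>1 v" "\<lambda>v. \<zeta>2 v"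
proof
  fix v
  show "((\<lambda>v. \<eta> v) has_real_derivative \<zeta> v) (at v)"
    using DERIV_mult[OF DERIV_ident bump_deriv(1)[of v]] by (simp add: mult.commute add.commute)
  show "((\<lambda>v. \<zeta> v) has_real_derivative \<zeta>1 v) (at v)"
    using DERIV_add[OF bump_deriv(1)[of v] DERIV_mult[OF DERIV_ident bump_deriv(2)[of v]]] by (rule DERIV_cong) simp
  show "((\<lambda>v. \<zeta>1 v) has_real_derivative \<zeta>2 v) (at v)"
    using DERIV_add[OF DERIV_cmult[OF bump_deriv(2)[of v], of 2] DERIV_mult[OF DERIV_ident bump_deriv(3)[of v]]] by (rule DERIV_cong) simp
  show "isCont (\<lambda>v. \<zeta>2 v) v"
    by (intro continuous_intros bump_cont bump_deriv(4))
  show "\<bar>\<eta> v\<bar> \<le> 4 * K / (1 + \<bar>v\<bar>) ^ 6"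
    using bump_combination_bound[OF bump_decay(1,1), of 0] by simp
  show "\<bar>\<zeta> v\<bar> \<le> 4 * K / (1 + \<bar>v\<bar>) ^ 6"
    using bump_combination_bound[OF bump_decay(1,2), of 1] by simp
  show "\<bar>\<zeta>1 v\<bar> \<le> 4 * K / (1 + \<bar>v\<bar>) ^ 6"
    using bump_combination_bound[OF bump_decay(2,3), of 2] by simp
  show "\<bar>\<zeta>2 v\<bar> \<le> 4 * K / (1 + \<bar>v\<bar>) ^ 6"
    using bump_combination_bound[OF bump_decay(3,4), of 3] by simp
  show "\<bar>\<sigma>\<bar> = 1" by (rule bump_parity)
  have "u1 (- v) = - \<sigma> * u1 v"
  proof -
    have "((\<lambda>v. u (0 + (-1) * v)) has_real_derivative (-1) * u1 (0 + (-1) * v)) (at v)"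
      by (rule DERIV_affine_compose[OF bump_deriv(1)])
    moreover have "((\<lambda>v. \<sigma> * u v) has_real_derivative \<sigma> * u1 v) (at v)"
      by (rule DERIV_cmult[OF bump_deriv(1)])
    ultimately have "(-1) * u1 (- v) = \<sigma> * u1 v"
      using DERIV_unique by (fastforce simp: bump_parity(2))
    then show ?thesis by simp
  qed
  then show "\<zeta> (- v) = \<sigma> * \<zeta> v"
    by (simp add: bump_parity(2) algebra_simps)
qed

lemma bump_measurable [measurable]: "u \<in> borel_measurable borel" "u1 \<in> borel_measurable borel"
  using bump_cont by (auto intro!: borel_measurable_continuous_onI continuous_at_imp_continuous_on)

lemma four_K_tail: "4 * K / (1 + \<bar>v\<bar>) ^ 6 \<le> 4 * K * tail v"
  using mult_left_mono[OF inverse_power_le_tail[of 6 v], of "4 * K"] K_nonneg by simp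

lemma scale_pair_bump: "scale_pair (4 * K) u (\<lambda>v. \<zeta> v)"
proof (rule scale_pair_of_derivative[OF bump_deriv(1) bump_cont(2)])
  fix v
  show "\<bar>\<zeta> v\<bar> \<le> 4 * K * tail v"
    using decay(2)[of v] four_K_tail[of v] by linarith
  have "\<bar>u v\<bar> \<le> K / (1 + \<bar>v\<bar>) ^ 7" by (rule bump_decay)
  also have "\<dots> \<le> K * tail v"
    using mult_left_mono[OF inverse_power_le_tail[of 7 v], of K] K_nonneg by simp
  also have "\<dots> \<le> 4 * K * tail v"
    using K_nonneg by (intro mult_right_mono) auto
  finally show "\<bar>u v\<bar> \<le> 4 * K * tail v" .
qed

lemma difference_bound: "\<bar>difference u v\<bar> \<le> 12 * K * tail v"
proof -
  have b: "\<bar>u w\<bar> \<le> 4 * K * tail w" for w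
    using scale_pairD(5)[OF scale_pair_bump] .
  have "tail (2 * v) \<le> tail v"
    unfolding tail_def by (intro divide_left_mono power_mono) (auto intro!: mult_pos_pos zero_less_power)
  then have "4 * K * tail (2 * v) \<le> 4 * K * tail v"
    using K_nonneg by (intro mult_left_mono) auto
  with b[of v] b[of "2 * v"] show ?thesis
    unfolding difference_def by linarith
qed

lemma dil_difference:
  assumes t: "0 < t"
  shows "dil t (difference u) v = - (\<integral>s. (dil s (\<lambda>v. \<zeta> v) v / s) * indicator {t / 2..t} s \<partial>lborel)"
proof -
  note sp = scale_pairD[OF scale_pair_bump]
  have "(\<integral>s. (dil s (\<lambda>v. \<zeta> v) v / s) * indicator {t / 2..t} s \<partial>lborel) = - dil t u v - (- dil (t / 2) u v)"
  proof (rule integral_FTC_Icc_real)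
    fix s assume "t / 2 \<le> s" "s \<le> t"
    then have s: "0 < s" using t by simp
    show "((\<lambda>s. - dil s u v) has_real_derivative dil s (\<lambda>v. \<zeta> v) v / s) (at s)"
      using DERIV_minus[OF sp(4)[OF s, of v]] by simp
    show "isCont (\<lambda>s. dil s (\<lambda>v. \<zeta> v) v / s) s"
      by (intro continuous_intros sp(9)) (use s in auto)
  qed (use t in simp)
  then show ?thesis
    using t by (simp add: dil_def difference_def diff_divide_distrib mult.commute)
qed

lemma avg_difference:
  assumes [measurable]: "case_prod f \<in> borel_measurable (borel \<Otimes>\<^sub>M borel)"
    "case_prod g \<in> borel_measurable (borel \<Otimes>\<^sub>M borel)"
    and fin: "(\<integral>\<^sup>+z. ennreal \<bar>f z (snd r) * g z (fst r) * tail (z - fst r - snd r)\<bar> \<partial>lborel) < \<infinity>"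
    and t: "0 < t"
  shows "avg (difference u) f g t r = - (\<integral>s. indicator {t / 2..t} s / s * avg (\<lambda>v. \<zeta> v) f g s r \<partial>lborel)"
proof -
  let ?h = "\<lambda>z. f z (snd r) * g z (fst r)" and ?c = "fst r + snd r"
  have [measurable]: "?h \<in> borel_measurable borel" by measurable
  have fin': "(\<integral>\<^sup>+z. ennreal \<bar>?h z * tail (z - ?c)\<bar> \<partial>lborel) < \<infinity>"
    using fin by (simp add: algebra_simps)
  have av: "avg k f g s r = (\<integral>z. ?h z * dil s k (z - ?c) \<partial>lborel)" for k s
    by (simp add: avg_def algebra_simps)
  let ?z = "\<lambda>v. \<zeta> v"
  let ?F = "\<integral>\<^sup>+z. ennreal \<bar>?h z * tail (z - ?c)\<bar> \<partial>lborel"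
  have slab: "integrable lborel (\<lambda>(s, z). indicator {t / 2..t} s / s * (?h z * dil s ?z (z - ?c)))"
  proof (rule integrable_slab[where B = "4 * K * (t + 1 / (t / 2)) * enn2real ?F"])
    show "(\<lambda>(s, z). ?h z * dil s ?z (z - ?c)) \<in> borel_measurable borel"
      unfolding case_prod_beta' by measurable
    fix s assume s: "t / 2 \<le> s" "s \<le> t"
    then have s0: "0 < s" using t by simp
    have "(\<integral>\<^sup>+z. ennreal \<bar>?h z * dil s ?z (z - ?c)\<bar> \<partial>lborel) \<le> ennreal (4 * K * (s + 1 / s)) * ?F"
      by (rule integrable_weighted(1)[OF _ fin' _ _ s0]) (use scale_pairD(6)[OF scale_pair_bump] in auto)
    also have "\<dots> \<le> ennreal (4 * K * (t + 1 / (t / 2))) * ?F"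
    proof (intro mult_right_mono ennreal_leI mult_left_mono add_mono)
      show "1 / s \<le> 1 / (t / 2)" using s t by (intro divide_left_mono) auto
    qed (use s K_nonneg in auto)
    also have "\<dots> = ennreal (4 * K * (t + 1 / (t / 2)) * enn2real ?F)"
      using fin' K_nonneg t by (subst ennreal_mult) (auto simp: less_top)
    finally show "(\<integral>\<^sup>+z. ennreal \<bar>?h z * dil s ?z (z - ?c)\<bar> \<partial>lborel) \<le> ennreal (4 * K * (t + 1 / (t / 2)) * enn2real ?F)" .
  qed (use t in simp)
  have "avg (difference u) f g t r = (\<integral>z. - (\<integral>s. indicator {t / 2..t} s / s * (?h z * dil s ?z (z - ?c)) \<partial>lborel) \<partial>lborel)"
    unfolding av
  proof (rule Bochner_Integration.integral_cong[OF refl])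
    fix z
    have "(\<integral>s. indicator {t / 2..t} s / s * (?h z * dil s ?z (z - ?c)) \<partial>lborel)
       = ?h z * (\<integral>s. (dil s ?z (z - ?c) / s) * indicator {t / 2..t} s \<partial>lborel)"
      by (subst integral_mult_right_zero[symmetric]) (simp add: mult_ac)
    then show "?h z * dil t (difference u) (z - ?c) = - (\<integral>s. indicator {t / 2..t} s / s * (?h z * dil s ?z (z - ?c)) \<partial>lborel)"
      unfolding dil_difference[OF t] by simp
  qed
  also have "\<dots> = - (\<integral>z. \<integral>s. indicator {t / 2..t} s / s * (?h z * dil s ?z (z - ?c)) \<partial>lborel \<partial>lborel)"
    by simp
  also have "(\<integral>z. \<integral>s. indicator {t / 2..t} s / s * (?h z * dil s ?z (z - ?c)) \<partial>lborel \<partial>lborel)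
     = (\<integral>s. \<integral>z. indicator {t / 2..t} s / s * (?h z * dil s ?z (z - ?c)) \<partial>lborel \<partial>lborel)"
    using integral_lborel_fst[OF slab] integral_lborel_snd[OF slab] by simp
  finally show ?thesis unfolding av by simp
qed

text \<open>On \<open>[t/2, t]\<close> the measure \<open>ds/s\<close> has mass \<open>ln 2 \<le> 1\<close>, so the Cauchy--Schwarz inequality costs no constant.  The
  half-open intervals are chosen so that those of different dyadic scales are disjoint.\<close>

lemma avg_difference_square:
  assumes [measurable]: "case_prod f \<in> borel_measurable (borel \<Otimes>\<^sub>M borel)"
    "case_prod g \<in> borel_measurable (borel \<Otimes>\<^sub>M borel)"
    and fin: "(\<integral>\<^sup>+z. ennreal \<bar>f z (snd r) * g z (fst r) * tail (z - fst r - snd r)\<bar> \<partial>lborel) < \<infinity>"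
    and t: "0 < t"
  shows "ennreal ((avg (difference u) f g t r)\<^sup>2)
    \<le> (\<integral>\<^sup>+s. ennreal (indicator {t / 2..<t} s / s) * ennreal ((avg (\<lambda>v. \<zeta> v) f g s r)\<^sup>2) \<partial>lborel)"
proof -
  let ?a = "\<lambda>s. avg (\<lambda>v. \<zeta> v) f g s r"
  have [measurable]: "?a \<in> borel_measurable borel"
    unfolding avg_def by measurable
  let ?F = "\<lambda>s. ennreal (indicator {t / 2..<t} s * sqrt (1 / s))"
  have "ennreal \<bar>avg (difference u) f g t r\<bar> \<le> (\<integral>\<^sup>+s. ennreal (norm (indicator {t / 2..t} s / s * ?a s)) \<partial>lborel)"
    unfolding avg_difference[OF assms]
    using integral_norm_bound_ennreal[of lborel "\<lambda>s. indicator {t / 2..t} s / s * ?a s"]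
    by (cases "integrable lborel (\<lambda>s. indicator {t / 2..t} s / s * ?a s)") (auto simp: not_integrable_integral_eq)
  also have "\<dots> = (\<integral>\<^sup>+s. ?F s * (?F s * ennreal \<bar>?a s\<bar>) \<partial>lborel)"
  proof (rule nn_integral_cong_AE)
    show "AE s in lborel. ennreal (norm (indicator {t / 2..t} s / s * ?a s)) = ?F s * (?F s * ennreal \<bar>?a s\<bar>)"
      using AE_lborel_singleton[of t]
    proof eventually_elim
      case (elim s)
      show ?case
      proof (cases "s \<in> {t / 2..<t}")
        case True
        then have s: "0 < s" using t by simp
        have "1 / s * \<bar>?a s\<bar> = sqrt (1 / s) * (sqrt (1 / s) * \<bar>?a s\<bar>)"
          using s by (simp add: mult.assoc[symmetric] real_sqrt_mult_self del: real_sqrt_divide)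
        then show ?thesis
          using True s by (simp add: ennreal_mult'[symmetric] abs_mult)
      next
        case False
        then show ?thesis using elim by (auto simp: indicator_def)
      qed
    qed
  qed
  finally have 1: "ennreal \<bar>avg (difference u) f g t r\<bar> \<le> (\<integral>\<^sup>+s. ?F s * (?F s * ennreal \<bar>?a s\<bar>) \<partial>lborel)" .
  have F2: "?F s ^ 2 = ennreal (indicator {t / 2..<t} s / s)" for s
  proof (cases "s \<in> {t / 2..<t}")
    case True
    then have "0 < s" using t by simp
    then show ?thesis using True by (simp add: ennreal_power)
  qed (simp add: power2_eq_square)
  have "ennreal ((avg (difference u) f g t r)\<^sup>2) = ennreal \<bar>avg (difference u) f g t r\<bar> ^ 2"
    by (simp add: ennreal_power)
  also have "\<dots> \<le> (\<integral>\<^sup>+s. ?F s * (?F s * ennreal \<bar>?a s\<bar>) \<partial>lborel) ^ 2"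
    by (rule power_mono[OF 1]) simp
  also have "\<dots> \<le> (\<integral>\<^sup>+s. ?F s ^ 2 \<partial>lborel) * (\<integral>\<^sup>+s. (?F s * ennreal \<bar>?a s\<bar>) ^ 2 \<partial>lborel)"
    by (rule Cauchy_Schwarz_nn_integral) measurable
  also have "\<dots> \<le> 1 * (\<integral>\<^sup>+s. (?F s * ennreal \<bar>?a s\<bar>) ^ 2 \<partial>lborel)"
  proof (rule mult_right_mono)
    have "(\<integral>\<^sup>+s. ?F s ^ 2 \<partial>lborel) \<le> (\<integral>\<^sup>+s. ennreal (1 / (t / 2)) * indicator {t / 2..<t} s \<partial>lborel)"
      unfolding F2
    proof (rule nn_integral_mono)
      fix s
      show "ennreal (indicator {t / 2..<t} s / s) \<le> ennreal (1 / (t / 2)) * indicator {t / 2..<t} s"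
      proof (cases "s \<in> {t / 2..<t}")
        case True
        then have "1 / s \<le> 1 / (t / 2)" using t by (intro divide_left_mono) auto
        then show ?thesis using True by (simp add: ennreal_leI)
      qed simp
    qed
    also have "\<dots> = ennreal (1 / (t / 2)) * ennreal (t - t / 2)"
      using t by (subst nn_integral_cmult) auto
    also have "\<dots> = 1"
      using t by (simp add: ennreal_mult'[symmetric])
    finally show "(\<integral>\<^sup>+s. ?F s ^ 2 \<partial>lborel) \<le> 1" .
  qed simp
  also have "\<dots> = (\<integral>\<^sup>+s. ennreal (indicator {t / 2..<t} s / s) * ennreal ((?a s)\<^sup>2) \<partial>lborel)"
    by (simp add: power_mult_distrib F2 ennreal_power)
  finally show ?thesis .
qed

lemma dyadic_square_function_estimate:
  obtains C where "0 \<le> C"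
    "\<And>f g B J. case_prod f \<in> borel_measurable (borel \<Otimes>\<^sub>M borel) \<Longrightarrow> case_prod g \<in> borel_measurable (borel \<Otimes>\<^sub>M borel) \<Longrightarrow>
      fourth f + fourth g \<le> ennreal B \<Longrightarrow> 0 \<le> B \<Longrightarrow> finite J \<Longrightarrow>
      (\<Sum>j\<in>J. \<integral>\<^sup>+r. ennreal ((avg (difference u) f g (2 powi j) r)\<^sup>2) \<partial>lborel) \<le> ennreal (C * B)"
proof -
  obtain C where C: "0 \<le> C" and est: "\<And>f g B t0 t1. case_prod f \<in> borel_measurable (borel \<Otimes>\<^sub>M borel) \<Longrightarrow> case_prod g \<in> borel_measurable (borel \<Otimes>\<^sub>M borel) \<Longrightarrow>
      fourth f + fourth g \<le> ennreal B \<Longrightarrow> 0 \<le> B \<Longrightarrow> 0 < t0 \<Longrightarrow> t0 \<le> t1 \<Longrightarrow>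
      (\<integral>\<^sup>+t. ennreal (indicator {t0..t1} t / t) * (\<integral>\<^sup>+r. ennreal ((avg (\<lambda>v. \<zeta> v) f g t r)\<^sup>2) \<partial>lborel) \<partial>lborel) \<le> ennreal (C * B)"
    using square_function_estimate by blast
  show ?thesis
  proof (rule that[OF C])
    fix f g :: "real \<Rightarrow> real \<Rightarrow> real" and B :: real and J :: "int set"
    assume fm [measurable]: "case_prod f \<in> borel_measurable (borel \<Otimes>\<^sub>M borel)"
      and gm [measurable]: "case_prod g \<in> borel_measurable (borel \<Otimes>\<^sub>M borel)"
      and B: "fourth f + fourth g \<le> ennreal B" "0 \<le> B" and J: "finite J"
    have fin: "fourth f < \<infinity>" "fourth g < \<infinity>"
      using le_less_trans[OF B(1) ennreal_less_top] by simp_all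
    let ?I = "\<lambda>j::int. {2 powi j / 2..<2 powi j :: real}"
    let ?a = "\<lambda>s r. ennreal ((avg (\<lambda>v. \<zeta> v) f g s r)\<^sup>2)"
    let ?A = "\<lambda>s. \<integral>\<^sup>+r. ?a s r \<partial>lborel"
    have am [measurable]: "(\<lambda>x. ?a (fst x) (snd x)) \<in> borel_measurable borel"
      by measurable
    have Am [measurable]: "?A \<in> borel_measurable borel"
      unfolding avg_def by measurable
    have one: "(\<integral>\<^sup>+r. ennreal ((avg (difference u) f g (2 powi j) r)\<^sup>2) \<partial>lborel)
      \<le> (\<integral>\<^sup>+s. ennreal (indicator (?I j) s / s) * ?A s \<partial>lborel)" for j
    proof -
      have "(\<integral>\<^sup>+r. ennreal ((avg (difference u) f g (2 powi j) r)\<^sup>2) \<partial>lborel)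
        \<le> (\<integral>\<^sup>+r. \<integral>\<^sup>+s. ennreal (indicator (?I j) s / s) * ?a s r \<partial>lborel \<partial>lborel)"
      proof (rule nn_integral_mono_AE)
        show "AE r in lborel. ennreal ((avg (difference u) f g (2 powi j) r)\<^sup>2) \<le> (\<integral>\<^sup>+s. ennreal (indicator (?I j) s / s) * ?a s r \<partial>lborel)"
          using AE_weighted_product_finite[OF fm gm fin]
          by eventually_elim (rule avg_difference_square[OF fm gm], simp_all)
      qed
      also have "\<dots> = (\<integral>\<^sup>+s. \<integral>\<^sup>+r. ennreal (indicator (?I j) s / s) * ?a s r \<partial>lborel \<partial>lborel)"
      proof (rule nn_integral_lborel_swap)
        have "(\<lambda>x. ennreal (indicator (?I j) (snd x) / snd x) * ennreal ((avg (\<lambda>v. \<zeta> v) f g (snd x) (fst x))\<^sup>2)) \<in> borel_measurable borel"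
          unfolding avg_def by measurable
        then show "(\<lambda>(r, s). ennreal (indicator (?I j) s / s) * ?a s r) \<in> borel_measurable borel"
          by (simp add: case_prod_beta')
      qed
      also have "\<dots> = (\<integral>\<^sup>+s. ennreal (indicator (?I j) s / s) * ?A s \<partial>lborel)"
        by (intro nn_integral_cong nn_integral_cmult) measurable
      finally show ?thesis .
    qed
    obtain n :: nat where n: "J \<subseteq> {- int n..int n}"
      using finite_int_subset_interval[OF J] by blast
    let ?t0 = "2 powi (- int n) / 2 :: real" and ?t1 = "2 powi (int n) :: real"
    have t: "0 < ?t0" "?t0 \<le> ?t1"
    proof -
      have "2 powi (- int n) \<le> (2 powi (int n) :: real)" by (rule power_int_increasing) auto
      moreover have "0 < (2 powi (- int n) :: real)" by simp
      ultimately show "0 < ?t0" "?t0 \<le> ?t1" by linarith+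
    qed
    have disj: "disjoint_family_on ?I J"
    proof -
      have "?I i \<inter> ?I j = {}" if "i < j" for i j :: int
      proof -
        have "(2::real) powi i \<le> 2 powi (j - 1)" using that by (intro power_int_increasing) auto
        also have "\<dots> = 2 powi j / 2" by (simp add: power_int_diff)
        finally show ?thesis by auto
      qed
      then show ?thesis
        unfolding disjoint_family_on_def by (metis inf_commute linorder_neqE)
    qed
    have ind: "(\<Sum>j\<in>J. ennreal (indicator (?I j) s / s)) \<le> ennreal (indicator {?t0..?t1} s / s)" for s
    proof (cases "0 < s")
      case True
      have "(\<Sum>j\<in>J. ennreal (indicator (?I j) s / s)) = ennreal (\<Sum>j\<in>J. indicator (?I j) s / s)"
        using True by (intro sum_ennreal) auto
      also have "(\<Sum>j\<in>J. indicator (?I j) s / s) = indicator (\<Union>j\<in>J. ?I j) s / s"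
        unfolding sum_divide_distrib[symmetric] indicator_UN_disjoint[OF J disj] ..
      also have "\<dots> \<le> indicator {?t0..?t1} s / s"
      proof (rule divide_right_mono)
        have "?I j \<subseteq> {?t0..?t1}" if "j \<in> J" for j
        proof -
          have "- int n \<le> j" "j \<le> int n" using n that by auto
          then have "(2::real) powi (- int n) \<le> 2 powi j" "(2::real) powi j \<le> 2 powi (int n)"
            using power_int_increasing[of "- int n" j "2::real"] power_int_increasing[of j "int n" "2::real"] by linarith+
          then show ?thesis by (auto simp del: power_int_of_nat)
        qed
        then have sub: "(\<Union>j\<in>J. ?I j) \<subseteq> {?t0..?t1}" by blast
        have "indicator X s \<le> (indicator Y s :: real)" if "X \<subseteq> Y" for X Y :: "real set"
          using that by (auto simp: indicator_def)
        from this[OF sub] show "indicator (\<Union>j\<in>J. ?I j) s \<le> (indicator {?t0..?t1} s :: real)" .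
      qed (use True in simp)
      finally show ?thesis by (simp add: ennreal_leI)
    next
      case False
      have "ennreal (indicator (?I j) s / s) = 0" for j
      proof -
        have "0 < (2::real) powi j / 2" by simp
        then have "s \<notin> ?I j" using False by auto
        then show ?thesis by simp
      qed
      then show ?thesis by simp
    qed
    have "(\<Sum>j\<in>J. \<integral>\<^sup>+r. ennreal ((avg (difference u) f g (2 powi j) r)\<^sup>2) \<partial>lborel)
      \<le> (\<Sum>j\<in>J. \<integral>\<^sup>+s. ennreal (indicator (?I j) s / s) * ?A s \<partial>lborel)"
      by (intro sum_mono one)
    also have "\<dots> = (\<integral>\<^sup>+s. (\<Sum>j\<in>J. ennreal (indicator (?I j) s / s) * ?A s) \<partial>lborel)"
      by (rule nn_integral_sum[symmetric]) measurable
    also have "\<dots> \<le> (\<integral>\<^sup>+s. ennreal (indicator {?t0..?t1} s / s) * ?A s \<partial>lborel)"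
      by (intro nn_integral_mono, unfold sum_distrib_right[symmetric], rule mult_right_mono[OF ind]) simp
    also have "\<dots> \<le> ennreal (C * B)"
      by (rule est[OF fm gm B t])
    finally show "(\<Sum>j\<in>J. \<integral>\<^sup>+r. ennreal ((avg (difference u) f g (2 powi j) r)\<^sup>2) \<partial>lborel) \<le> ennreal (C * B)" .
  qed
qed

end

section \<open>Reduction of the complex square function to real pieces\<close>

lemma schwartz_deriv:
  assumes "schwartz \<phi>"
  shows "(iterated_deriv n \<phi> has_vector_derivative iterated_deriv (Suc n) \<phi> v) (at v)"
  using assms by (simp add: schwartz_def iterated_deriv_def vector_derivative_works)

lemma schwartz_decay:
  assumes "schwartz \<phi>"
  obtains K where "\<And>n v. n \<le> 3 \<Longrightarrow> norm (iterated_deriv n \<phi> v) \<le> K / (1 + \<bar>v\<bar>) ^ 7"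
proof -
  have "\<exists>B. \<forall>v. norm (v ^ k *\<^sub>R iterated_deriv n \<phi> v) \<le> B" for k n
    using assms unfolding schwartz_def bounded_iff by blast
  then obtain B where B: "\<And>k n v. norm (v ^ k *\<^sub>R iterated_deriv n \<phi> v) \<le> B k n"
    by metis
  have one: "norm (iterated_deriv n \<phi> v) \<le> 128 * (B 0 n + B 7 n) / (1 + \<bar>v\<bar>) ^ 7" for n v
  proof -
    have "(1 + \<bar>v\<bar>) ^ 7 \<le> 128 * (1 + \<bar>v\<bar> ^ 7)"
    proof (cases "\<bar>v\<bar> \<le> 1")
      case True
      then have "(1 + \<bar>v\<bar>) ^ 7 \<le> 2 ^ 7" by (intro power_mono) auto
      also have "(2 :: real) ^ 7 \<le> 128 * (1 + \<bar>v\<bar> ^ 7)" by simp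
      finally show ?thesis .
    next
      case False
      then have "(1 + \<bar>v\<bar>) ^ 7 \<le> (2 * \<bar>v\<bar>) ^ 7" by (intro power_mono) auto
      then show ?thesis by (simp add: power_mult_distrib)
    qed
    then have "norm (iterated_deriv n \<phi> v) * (1 + \<bar>v\<bar>) ^ 7 \<le> norm (iterated_deriv n \<phi> v) * (128 * (1 + \<bar>v\<bar> ^ 7))"
      by (rule mult_left_mono) simp
    also have "\<dots> = 128 * (norm (v ^ 0 *\<^sub>R iterated_deriv n \<phi> v) + norm (v ^ 7 *\<^sub>R iterated_deriv n \<phi> v))"
      by (simp add: power_abs algebra_simps)
    also have "\<dots> \<le> 128 * (B 0 n + B 7 n)"
      by (intro mult_left_mono add_mono B) simp
    finally show ?thesis
      by (subst pos_le_divide_eq) (auto intro!: zero_less_power)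
  qed
  define K where "K = Max ((\<lambda>n. 128 * (B 0 n + B 7 n)) ` {..3})"
  show ?thesis
  proof (rule that)
    fix n :: nat and v :: real assume "n \<le> 3"
    then have "128 * (B 0 n + B 7 n) \<le> K"
      unfolding K_def by (intro Max_ge) auto
    then have "128 * (B 0 n + B 7 n) / (1 + \<bar>v\<bar>) ^ 7 \<le> K / (1 + \<bar>v\<bar>) ^ 7"
      by (intro divide_right_mono) auto
    with one[of n v] show "norm (iterated_deriv n \<phi> v) \<le> K / (1 + \<bar>v\<bar>) ^ 7" by linarith
  qed
qed

definition re_im :: "bool \<Rightarrow> complex \<Rightarrow> real" where
  "re_im b z = (if b then Im z else Re z)"

definition unit_of :: "bool \<Rightarrow> complex" where
  "unit_of b = (if b then \<i> else 1)"

lemma norm_unit_of [simp]: "norm (unit_of b) = 1"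
  by (simp add: unit_of_def)

lemma re_im_decomposition: "z = (\<Sum>b\<in>UNIV. unit_of b * of_real (re_im b z))"
  by (simp add: UNIV_bool re_im_def unit_of_def complex_eq)

lemma bounded_linear_re_im: "bounded_linear (re_im b)"
  unfolding re_im_def[abs_def] by (cases b) (simp_all add: bounded_linear_Re bounded_linear_Im)

lemma abs_re_im_le: "\<bar>re_im b z\<bar> \<le> norm z"
  by (simp add: re_im_def abs_Re_le_cmod abs_Im_le_cmod)

lemma measurable_re_im [measurable]:
  "f \<in> borel_measurable M \<Longrightarrow> (\<lambda>x. re_im b (f x)) \<in> borel_measurable M"
  unfolding re_im_def by (cases b) simp_all

definition sgn_of :: "bool \<Rightarrow> real" where
  "sgn_of e = (if e then - 1 else 1)"

definition parity_part :: "bool \<Rightarrow> bool \<Rightarrow> (real \<Rightarrow> complex) \<Rightarrow> real \<Rightarrow> real" where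
  "parity_part b e \<phi> v = (re_im b (\<phi> v) + sgn_of e * re_im b (\<phi> (- v))) / 2"

lemma parity_bump_parity_part:
  assumes \<phi>: "schwartz \<phi>"
  obtains K u1 u2 u3 where "parity_bump K (sgn_of e) (parity_part b e \<phi>) u1 u2 u3"
proof -
  obtain K where K: "\<And>n v. n \<le> 3 \<Longrightarrow> norm (iterated_deriv n \<phi> v) \<le> K / (1 + \<bar>v\<bar>) ^ 7"
    using schwartz_decay[OF \<phi>] by blast
  define a where "a n v = re_im b (iterated_deriv n \<phi> v)" for n v
  define w where "w n v = (a n v + sgn_of e * (- 1) ^ n * a n (- v)) / 2" for n v
  have a: "(a n has_real_derivative a (Suc n) v) (at v)" for n v
    unfolding has_real_derivative_iff_has_vector_derivative a_def[abs_def]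
    by (rule bounded_linear.has_vector_derivative[OF bounded_linear_re_im schwartz_deriv[OF \<phi>]])
  have w: "(w n has_real_derivative w (Suc n) v) (at v)" for n v
  proof -
    have "((\<lambda>v. a n (- v)) has_real_derivative - a (Suc n) (- v)) (at v)"
      using DERIV_affine_compose[OF a, of n 0 "-1" v] by simp
    from DERIV_cdivide[OF DERIV_add[OF a[of n v] DERIV_cmult[OF this, of "sgn_of e * (- 1) ^ n"]], of 2 ]
    show ?thesis
      unfolding w_def[abs_def] by (rule DERIV_cong) (simp add: algebra_simps)
  qed
  have bnd: "\<bar>w n v\<bar> \<le> K / (1 + \<bar>v\<bar>) ^ 7" if "n \<le> 3" for n v
  proof -
    have "\<bar>a n v\<bar> \<le> K / (1 + \<bar>v\<bar>) ^ 7" "\<bar>a n (- v)\<bar> \<le> K / (1 + \<bar>v\<bar>) ^ 7"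
      using order_trans[OF abs_re_im_le K[OF that, of v]] order_trans[OF abs_re_im_le K[OF that, of "- v"]]
      by (simp_all add: a_def)
    moreover have "\<bar>sgn_of e * (- 1) ^ n * a n (- v)\<bar> = \<bar>a n (- v)\<bar>"
      by (simp add: abs_mult sgn_of_def power_abs)
    ultimately show ?thesis
      unfolding w_def using abs_triangle_ineq[of "a n v" "sgn_of e * (- 1) ^ n * a n (- v)"]
      unfolding abs_divide abs_numeral by linarith
  qed
  have "parity_bump K (sgn_of e) (w 0) (w 1) (w 2) (w 3)"
  proof
    show "(w 0 has_real_derivative w 1 v) (at v)" "(w 1 has_real_derivative w 2 v) (at v)"
      "(w 2 has_real_derivative w 3 v) (at v)" for v
      using w[of 0 v] w[of 1 v] w[of 2 v] by (simp_all add: numeral_2_eq_2 numeral_3_eq_3)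
    show "isCont (w 3) v" for v
      using w[of 3 v] by (rule DERIV_isCont)
    show "\<bar>sgn_of e\<bar> = 1" by (simp add: sgn_of_def)
    show "w 0 (- v) = sgn_of e * w 0 v" for v
      by (simp add: w_def sgn_of_def)
  qed (use bnd in auto)
  moreover have "w 0 = parity_part b e \<phi>"
    by (auto simp: w_def a_def parity_part_def iterated_deriv_def)
  ultimately show ?thesis using that by metis
qed

lemma difference_decomposition:
  "\<phi> v - 2 * \<phi> (2 * v) = (\<Sum>b\<in>UNIV. \<Sum>e\<in>UNIV. unit_of b * of_real (difference (parity_part b e \<phi>) v))"
proof -
  have "(\<Sum>e\<in>UNIV. difference (parity_part b e \<phi>) v) = re_im b (\<phi> v) - 2 * re_im b (\<phi> (2 * v))" for b
    by (simp add: UNIV_bool difference_def parity_part_def sgn_of_def field_simps)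
  note * = this
  have "(\<Sum>e\<in>UNIV. unit_of b * of_real (difference (parity_part b e \<phi>) v))
      = unit_of b * of_real (re_im b (\<phi> v)) - 2 * (unit_of b * of_real (re_im b (\<phi> (2 * v))))" for b
  proof -
    have "(\<Sum>e\<in>UNIV. unit_of b * of_real (difference (parity_part b e \<phi>) v))
        = unit_of b * of_real (\<Sum>e\<in>UNIV. difference (parity_part b e \<phi>) v)"
      by (simp only: of_real_sum sum_distrib_left)
    then show ?thesis
      unfolding * by (simp add: right_diff_distrib)
  qed
  then have "(\<Sum>b\<in>UNIV. \<Sum>e\<in>UNIV. unit_of b * of_real (difference (parity_part b e \<phi>) v))
    = (\<Sum>b\<in>UNIV. unit_of b * of_real (re_im b (\<phi> v))) - 2 * (\<Sum>b\<in>UNIV. unit_of b * of_real (re_im b (\<phi> (2 * v))))"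
    by (simp only: sum_subtractf sum_distrib_left)
  then show ?thesis
    by (simp only: re_im_decomposition[symmetric])
qed

text \<open>Parts of \<open>F\<close> and of \<open>G\<close> in the coordinates in which the inner integral runs over their common first variable
  \<open>z = x + y + s\<close>.\<close>

definition row_part :: "bool \<Rightarrow> (real \<times> real \<Rightarrow> complex) \<Rightarrow> real \<Rightarrow> real \<Rightarrow> real" where
  "row_part b F z y = re_im b (F (z - y, y))"

definition col_part :: "bool \<Rightarrow> (real \<times> real \<Rightarrow> complex) \<Rightarrow> real \<Rightarrow> real \<Rightarrow> real" where
  "col_part b G z x = re_im b (G (x, z - x))"

lemma measurable_row_col_part [measurable]:
  assumes [measurable]: "F \<in> borel_measurable borel"
  shows "case_prod (row_part b F) \<in> borel_measurable (borel \<Otimes>\<^sub>M borel)"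
    "case_prod (col_part b F) \<in> borel_measurable (borel \<Otimes>\<^sub>M borel)"
  unfolding row_part_def col_part_def by measurable

definition quartic :: "(real \<times> real \<Rightarrow> complex) \<Rightarrow> ennreal" where
  "quartic F = (\<integral>\<^sup>+p. ennreal (norm (F p) ^ 4) \<partial>lborel)"

lemma fourth_row_col_part:
  assumes [measurable]: "F \<in> borel_measurable borel"
  shows "fourth (row_part b F) \<le> quartic F" "fourth (col_part b F) \<le> quartic F"
proof -
  have p4: "ennreal (re_im b z ^ 4) \<le> ennreal (norm z ^ 4)" for z
    using power_mono[OF abs_re_im_le[of b z], of 4] by (simp add: power_even_abs ennreal_leI)
  have sh: "(\<integral>\<^sup>+z. h (z - y) \<partial>lborel) = (\<integral>\<^sup>+x. h x \<partial>lborel)" if "h \<in> borel_measurable borel" for h :: "real \<Rightarrow> ennreal" and y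
    using nn_integral_real_affine[OF that, of 1 "- y"] by simp
  have m: "(\<lambda>p. ennreal (norm (F p) ^ 4)) \<in> borel_measurable borel" by measurable
  have "fourth (row_part b F) \<le> (\<integral>\<^sup>+z. \<integral>\<^sup>+y. ennreal (norm (F (z - y, y)) ^ 4) \<partial>lborel \<partial>lborel)"
    unfolding fourth_def row_part_def by (intro nn_integral_mono p4)
  also have "\<dots> = (\<integral>\<^sup>+y. \<integral>\<^sup>+z. ennreal (norm (F (z - y, y)) ^ 4) \<partial>lborel \<partial>lborel)"
    by (rule nn_integral_lborel_swap) (unfold case_prod_beta', measurable)
  also have "\<dots> = (\<integral>\<^sup>+y. \<integral>\<^sup>+x. ennreal (norm (F (x, y)) ^ 4) \<partial>lborel \<partial>lborel)"
    by (intro nn_integral_cong sh[of "\<lambda>x. ennreal (norm (F (x, _)) ^ 4)"]) measurable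
  also have "\<dots> = quartic F"
    unfolding quartic_def by (rule nn_integral_lborel_snd[OF m])
  finally show "fourth (row_part b F) \<le> quartic F" .
  have "fourth (col_part b F) \<le> (\<integral>\<^sup>+z. \<integral>\<^sup>+x. ennreal (norm (F (x, z - x)) ^ 4) \<partial>lborel \<partial>lborel)"
    unfolding fourth_def col_part_def by (intro nn_integral_mono p4)
  also have "\<dots> = (\<integral>\<^sup>+x. \<integral>\<^sup>+z. ennreal (norm (F (x, z - x)) ^ 4) \<partial>lborel \<partial>lborel)"
    by (rule nn_integral_lborel_swap) (unfold case_prod_beta', measurable)
  also have "\<dots> = (\<integral>\<^sup>+x. \<integral>\<^sup>+y. ennreal (norm (F (x, y)) ^ 4) \<partial>lborel \<partial>lborel)"
    by (intro nn_integral_cong sh[of "\<lambda>y. ennreal (norm (F (_, y)) ^ 4)"]) measurable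
  also have "\<dots> = quartic F"
    unfolding quartic_def by (rule nn_integral_lborel_fst[OF m])
  finally show "fourth (col_part b F) \<le> quartic F" .
qed

text \<open>The flags select the real or imaginary part of \<open>F\<close>, of \<open>G\<close> and of \<open>\<phi>\<close>, and the even or odd part of the latter.\<close>

abbreviation piece :: "(real \<Rightarrow> complex) \<Rightarrow> (real \<times> real \<Rightarrow> complex) \<Rightarrow> (real \<times> real \<Rightarrow> complex) \<Rightarrow>
    bool \<Rightarrow> bool \<Rightarrow> bool \<Rightarrow> bool \<Rightarrow> int \<Rightarrow> real \<times> real \<Rightarrow> real" where
  "piece \<phi> F G a b c e j r \<equiv> avg (difference (parity_part c e \<phi>)) (row_part a F) (col_part b G) (2 powi j) r"

lemma S_integrand_decomposition:
  "S_integrand (\<lambda>s. \<phi> s - 2 * \<phi> (2 * s)) F G j r s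
    = (\<Sum>a\<in>UNIV. \<Sum>b\<in>UNIV. \<Sum>c\<in>UNIV. \<Sum>e\<in>UNIV. unit_of a * unit_of b * unit_of c *
        of_real (row_part a F (s + (fst r + snd r)) (snd r) * col_part b G (s + (fst r + snd r)) (fst r)
          * dil (2 powi j) (difference (parity_part c e \<phi>)) s))"
proof -
  obtain x y where r: "r = (x, y)" by (cases r)
  let ?t = "2 powi (- j) :: real"
  have F: "F (x + s, y) = (\<Sum>a\<in>UNIV. unit_of a * of_real (row_part a F (s + (x + y)) y))"
    unfolding row_part_def re_im_decomposition[symmetric] by (simp add: algebra_simps)
  have G: "G (x, y + s) = (\<Sum>b\<in>UNIV. unit_of b * of_real (col_part b G (s + (x + y)) x))"
    unfolding col_part_def re_im_decomposition[symmetric] by (simp add: algebra_simps)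
  have d: "dil (2 powi j) k s = ?t * k (?t * s)" for k
    by (simp add: dil_def power_int_minus field_simps)
  show ?thesis
    unfolding r S_integrand_def prod.case fst_conv snd_conv F G difference_decomposition d
    by (simp add: UNIV_bool algebra_simps)
qed

lemma norm_sum_bool_squared:
  fixes h :: "bool \<Rightarrow> complex"
  shows "(norm (\<Sum>b\<in>UNIV. h b))\<^sup>2 \<le> 2 * (\<Sum>b\<in>UNIV. (norm (h b))\<^sup>2)"
proof -
  have "(norm (h False + h True))\<^sup>2 \<le> (norm (h False) + norm (h True))\<^sup>2"
    by (intro power_mono norm_triangle_ineq) simp
  also have "\<dots> \<le> 2 * ((norm (h False))\<^sup>2 + (norm (h True))\<^sup>2)"
    using sum_squares_bound[of "norm (h False)" "norm (h True)"] by (simp add: power2_sum)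
  finally show ?thesis by (simp add: UNIV_bool add.commute)
qed

lemma S_term_decomposition:
  assumes \<phi>: "schwartz \<phi>" and [measurable]: "F \<in> borel_measurable borel" "G \<in> borel_measurable borel"
    and fin: "quartic F < \<infinity>" "quartic G < \<infinity>"
  shows "AE r in lborel. \<forall>j. integrable lebesgue (S_integrand (\<lambda>s. \<phi> s - 2 * \<phi> (2 * s)) F G j r) \<and>
    S_term (\<lambda>s. \<phi> s - 2 * \<phi> (2 * s)) F G j r
     = (\<Sum>a\<in>UNIV. \<Sum>b\<in>UNIV. \<Sum>c\<in>UNIV. \<Sum>e\<in>UNIV. unit_of a * unit_of b * unit_of c * of_real (piece \<phi> F G a b c e j r))"
proof -
  let ?W = "\<lambda>a b r. \<integral>\<^sup>+z. ennreal \<bar>row_part a F z (snd r) * col_part b G z (fst r) * tail (z - fst r - snd r)\<bar> \<partial>lborel"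
  have "AE r in lborel. ?W a b r < \<infinity>" for a b
    by (rule AE_weighted_product_finite)
      (use fourth_row_col_part[of F a] fourth_row_col_part[of G b] fin in \<open>auto intro: le_less_trans\<close>)
  then have "AE r in lborel. \<forall>a\<in>UNIV. \<forall>b\<in>UNIV. ?W a b r < \<infinity>"
    by (simp add: UNIV_bool AE_conj_iff)
  then show ?thesis
  proof eventually_elim
    case (elim r)
    show ?case
    proof
      fix j :: int
      let ?c = "fst r + snd r" and ?t = "2 powi j :: real"
      let ?h = "\<lambda>a b z. row_part a F z (snd r) * col_part b G z (fst r)"
      let ?k = "\<lambda>c e. difference (parity_part c e \<phi>)"
      have iz: "integrable lborel (\<lambda>z. ?h a b z * dil ?t (?k c e) (z - ?c))" for a b c e
      proof -
        obtain K u1 u2 u3 where "parity_bump K (sgn_of e) (parity_part c e \<phi>) u1 u2 u3"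
          using parity_bump_parity_part[OF \<phi>] by blast
        then interpret parity_bump K "sgn_of e" "parity_part c e \<phi>" u1 u2 u3 .
        show ?thesis
        proof (rule integrable_weighted(2)[OF _ _ _ difference_bound])
          note [measurable] = measurable_row_col_part(1)[OF assms(2), of a] measurable_row_col_part(2)[OF assms(3), of b]
          show "?h a b \<in> borel_measurable borel" by measurable
          show "?k c e \<in> borel_measurable borel" by (rule measurable_difference[OF bump_measurable(1)])
          show "(\<integral>\<^sup>+z. ennreal \<bar>?h a b z * tail (z - ?c)\<bar> \<partial>lborel) < \<infinity>"
            using elim by (simp add: algebra_simps)
        qed simp
      qed
      have ish: "integrable lborel (\<lambda>s. ?h a b (s + ?c) * dil ?t (?k c e) s)" for a b c e
        using lborel_integrable_real_affine[OF iz[of a b c e], of 1 ?c] by (simp add: add.commute)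
      have av: "(\<integral>s. ?h a b (s + ?c) * dil ?t (?k c e) s \<partial>lborel) = piece \<phi> F G a b c e j r" for a b c e
        using lborel_integral_real_affine[of 1 "\<lambda>z. ?h a b z * dil ?t (?k c e) (z - ?c)" ?c]
        by (simp add: avg_def add.commute algebra_simps)
      have eq: "S_integrand (\<lambda>s. \<phi> s - 2 * \<phi> (2 * s)) F G j r
        = (\<lambda>s. \<Sum>a\<in>UNIV. \<Sum>b\<in>UNIV. \<Sum>c\<in>UNIV. \<Sum>e\<in>UNIV. unit_of a * unit_of b * unit_of c * of_real (?h a b (s + ?c) * dil ?t (?k c e) s))"
        by (rule ext) (rule S_integrand_decomposition)
      have ic: "integrable lborel (\<lambda>s. unit_of a * unit_of b * unit_of c * of_real (?h a b (s + ?c) * dil ?t (?k c e) s))" for a b c e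
        using ish[of a b c e] by (intro integrable_mult_right integrable_of_real)
      have i: "integrable lborel (S_integrand (\<lambda>s. \<phi> s - 2 * \<phi> (2 * s)) F G j r)"
        unfolding eq by (intro Bochner_Integration.integrable_sum ic)
      have m: "S_integrand (\<lambda>s. \<phi> s - 2 * \<phi> (2 * s)) F G j r \<in> borel_measurable lborel"
        using i by (rule borel_measurable_integrable)
      have "S_term (\<lambda>s. \<phi> s - 2 * \<phi> (2 * s)) F G j r = (\<integral>s. S_integrand (\<lambda>s. \<phi> s - 2 * \<phi> (2 * s)) F G j r s \<partial>lborel)"
        unfolding S_term_def by (rule integral_completion[OF m])
      also have "\<dots> = (\<Sum>a\<in>UNIV. \<Sum>b\<in>UNIV. \<Sum>c\<in>UNIV. \<Sum>e\<in>UNIV. unit_of a * unit_of b * unit_of c * of_real (piece \<phi> F G a b c e j r))"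
        unfolding eq av[symmetric]
        by (subst Bochner_Integration.integral_sum, (intro Bochner_Integration.integrable_sum ic),
            rule sum.cong[OF refl])+
          (simp only: integral_mult_right_zero integral_complex_of_real)
      finally show "integrable lebesgue (S_integrand (\<lambda>s. \<phi> s - 2 * \<phi> (2 * s)) F G j r) \<and>
        S_term (\<lambda>s. \<phi> s - 2 * \<phi> (2 * s)) F G j r
         = (\<Sum>a\<in>UNIV. \<Sum>b\<in>UNIV. \<Sum>c\<in>UNIV. \<Sum>e\<in>UNIV. unit_of a * unit_of b * unit_of c * of_real (piece \<phi> F G a b c e j r))"
        using integrable_completion[OF m] i by simp
    qed
  qed
qed

lemma norm_sum_of_pieces_squared_le:
  fixes h :: "bool \<Rightarrow> bool \<Rightarrow> bool \<Rightarrow> bool \<Rightarrow> real"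
  shows "(norm (\<Sum>a\<in>UNIV. \<Sum>b\<in>UNIV. \<Sum>c\<in>UNIV. \<Sum>e\<in>UNIV. unit_of a * unit_of b * unit_of c * of_real (h a b c e)))\<^sup>2
    \<le> 16 * (\<Sum>a\<in>UNIV. \<Sum>b\<in>UNIV. \<Sum>c\<in>UNIV. \<Sum>e\<in>UNIV. (h a b c e)\<^sup>2)"
proof -
  let ?x = "\<lambda>a b c e. unit_of a * unit_of b * unit_of c * of_real (h a b c e)"
  have "(norm (\<Sum>a\<in>UNIV. \<Sum>b\<in>UNIV. \<Sum>c\<in>UNIV. \<Sum>e\<in>UNIV. ?x a b c e))\<^sup>2
    \<le> 2 * (\<Sum>a\<in>UNIV. (norm (\<Sum>b\<in>UNIV. \<Sum>c\<in>UNIV. \<Sum>e\<in>UNIV. ?x a b c e))\<^sup>2)"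
    by (rule norm_sum_bool_squared)
  also have "\<dots> \<le> 2 * (\<Sum>a\<in>UNIV. 2 * (\<Sum>b\<in>UNIV. (norm (\<Sum>c\<in>UNIV. \<Sum>e\<in>UNIV. ?x a b c e))\<^sup>2))"
    by (intro mult_left_mono sum_mono norm_sum_bool_squared) simp
  also have "\<dots> \<le> 2 * (\<Sum>a\<in>UNIV. 2 * (\<Sum>b\<in>UNIV. 2 * (\<Sum>c\<in>UNIV. (norm (\<Sum>e\<in>UNIV. ?x a b c e))\<^sup>2)))"
    by (intro mult_left_mono sum_mono norm_sum_bool_squared) simp_all
  also have "\<dots> \<le> 2 * (\<Sum>a\<in>UNIV. 2 * (\<Sum>b\<in>UNIV. 2 * (\<Sum>c\<in>UNIV. 2 * (\<Sum>e\<in>UNIV. (norm (?x a b c e))\<^sup>2))))"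
    by (intro mult_left_mono sum_mono norm_sum_bool_squared) simp_all
  also have "\<dots> = 16 * (\<Sum>a\<in>UNIV. \<Sum>b\<in>UNIV. \<Sum>c\<in>UNIV. \<Sum>e\<in>UNIV. (h a b c e)\<^sup>2)"
    by (simp add: norm_mult sum_distrib_left[symmetric])
  finally show ?thesis .
qed

lemma S_term_square_sum_estimate:
  assumes \<phi>: "schwartz \<phi>"
  obtains C where "0 \<le> C"
    "\<And>F G B J. F \<in> borel_measurable borel \<Longrightarrow> G \<in> borel_measurable borel \<Longrightarrow>
      quartic F + quartic G \<le> ennreal B \<Longrightarrow> 0 \<le> B \<Longrightarrow> finite J \<Longrightarrow>
      (\<Sum>j\<in>J. \<integral>\<^sup>+r. ennreal ((norm (S_term (\<lambda>s. \<phi> s - 2 * \<phi> (2 * s)) F G j r))\<^sup>2) \<partial>lborel) \<le> ennreal (C * B)"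
proof -
  have "\<exists>C\<ge>0. \<forall>f g B J. case_prod f \<in> borel_measurable (borel \<Otimes>\<^sub>M borel) \<longrightarrow> case_prod g \<in> borel_measurable (borel \<Otimes>\<^sub>M borel) \<longrightarrow>
      fourth f + fourth g \<le> ennreal B \<longrightarrow> 0 \<le> B \<longrightarrow> finite J \<longrightarrow>
      (\<Sum>j\<in>J. \<integral>\<^sup>+r. ennreal ((avg (difference (parity_part c e \<phi>)) f g (2 powi j) r)\<^sup>2) \<partial>lborel) \<le> ennreal (C * B)" for c e
  proof -
    obtain K u1 u2 u3 where "parity_bump K (sgn_of e) (parity_part c e \<phi>) u1 u2 u3"
      using parity_bump_parity_part[OF \<phi>] by blast
    then interpret parity_bump K "sgn_of e" "parity_part c e \<phi>" u1 u2 u3 .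
    show ?thesis
      using dyadic_square_function_estimate by metis
  qed
  then obtain C where C0: "\<And>c e. 0 \<le> C c e" and C: "\<And>c e f g B J. case_prod f \<in> borel_measurable (borel \<Otimes>\<^sub>M borel) \<Longrightarrow> case_prod g \<in> borel_measurable (borel \<Otimes>\<^sub>M borel) \<Longrightarrow>
      fourth f + fourth g \<le> ennreal B \<Longrightarrow> 0 \<le> B \<Longrightarrow> finite J \<Longrightarrow>
      (\<Sum>j\<in>J. \<integral>\<^sup>+r. ennreal ((avg (difference (parity_part c e \<phi>)) f g (2 powi j) r)\<^sup>2) \<partial>lborel) \<le> ennreal (C c e * B)"
    by metis
  define D where "D = 16 * (\<Sum>a\<in>(UNIV::bool set). \<Sum>b\<in>(UNIV::bool set). \<Sum>c\<in>UNIV. \<Sum>e\<in>UNIV. C c e)"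
  show ?thesis
  proof (rule that)
    show "0 \<le> D" unfolding D_def using C0 by (intro mult_nonneg_nonneg sum_nonneg) auto
    fix F G :: "real \<times> real \<Rightarrow> complex" and B :: real and J :: "int set"
    assume Fm [measurable]: "F \<in> borel_measurable borel" and Gm [measurable]: "G \<in> borel_measurable borel"
      and B: "quartic F + quartic G \<le> ennreal B" "0 \<le> B" and J: "finite J"
    have fin: "quartic F < \<infinity>" "quartic G < \<infinity>"
      using le_less_trans[OF B(1) ennreal_less_top] by simp_all
    have pm [measurable]: "piece \<phi> F G a b c e j \<in> borel_measurable borel" for a b c e j
    proof -
      obtain K u1 u2 u3 where "parity_bump K (sgn_of e) (parity_part c e \<phi>) u1 u2 u3"
        using parity_bump_parity_part[OF \<phi>] by blast
      then interpret parity_bump K "sgn_of e" "parity_part c e \<phi>" u1 u2 u3 .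
      show ?thesis by measurable
    qed
    let ?q = "\<lambda>a b c e j r. ennreal ((piece \<phi> F G a b c e j r)\<^sup>2)"
    have "(\<integral>\<^sup>+r. ennreal ((norm (S_term (\<lambda>s. \<phi> s - 2 * \<phi> (2 * s)) F G j r))\<^sup>2) \<partial>lborel)
      \<le> 16 * (\<Sum>a\<in>UNIV. \<Sum>b\<in>UNIV. \<Sum>c\<in>UNIV. \<Sum>e\<in>UNIV. \<integral>\<^sup>+r. ?q a b c e j r \<partial>lborel)" for j
    proof -
      have "(\<integral>\<^sup>+r. ennreal ((norm (S_term (\<lambda>s. \<phi> s - 2 * \<phi> (2 * s)) F G j r))\<^sup>2) \<partial>lborel)
        \<le> (\<integral>\<^sup>+r. 16 * (\<Sum>a\<in>UNIV. \<Sum>b\<in>UNIV. \<Sum>c\<in>UNIV. \<Sum>e\<in>UNIV. ?q a b c e j r) \<partial>lborel)"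
      proof (rule nn_integral_mono_AE)
        show "AE r in lborel. ennreal ((norm (S_term (\<lambda>s. \<phi> s - 2 * \<phi> (2 * s)) F G j r))\<^sup>2)
          \<le> 16 * (\<Sum>a\<in>UNIV. \<Sum>b\<in>UNIV. \<Sum>c\<in>UNIV. \<Sum>e\<in>UNIV. ?q a b c e j r)"
          using S_term_decomposition[OF \<phi> Fm Gm fin]
        proof eventually_elim
          case (elim r)
          have "ennreal ((norm (S_term (\<lambda>s. \<phi> s - 2 * \<phi> (2 * s)) F G j r))\<^sup>2)
            \<le> ennreal (16 * (\<Sum>a\<in>UNIV. \<Sum>b\<in>UNIV. \<Sum>c\<in>UNIV. \<Sum>e\<in>UNIV. (piece \<phi> F G a b c e j r)\<^sup>2))"
            using elim norm_sum_of_pieces_squared_le[of "\<lambda>a b c e. piece \<phi> F G a b c e j r"] by (simp add: ennreal_leI)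
          also have "\<dots> = 16 * (\<Sum>a\<in>UNIV. \<Sum>b\<in>UNIV. \<Sum>c\<in>UNIV. \<Sum>e\<in>UNIV. ?q a b c e j r)"
            by (simp add: ennreal_mult sum_nonneg)
          finally show ?case .
        qed
      qed
      also have "\<dots> = 16 * (\<Sum>a\<in>UNIV. \<Sum>b\<in>UNIV. \<Sum>c\<in>UNIV. \<Sum>e\<in>UNIV. \<integral>\<^sup>+r. ?q a b c e j r \<partial>lborel)"
        by (simp add: nn_integral_cmult nn_integral_sum del: sum_ennreal)
      finally show ?thesis .
    qed
    then have "(\<Sum>j\<in>J. \<integral>\<^sup>+r. ennreal ((norm (S_term (\<lambda>s. \<phi> s - 2 * \<phi> (2 * s)) F G j r))\<^sup>2) \<partial>lborel)
      \<le> (\<Sum>j\<in>J. 16 * (\<Sum>a\<in>UNIV. \<Sum>b\<in>UNIV. \<Sum>c\<in>UNIV. \<Sum>e\<in>UNIV. \<integral>\<^sup>+r. ?q a b c e j r \<partial>lborel))"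
      by (rule sum_mono)
    also have "\<dots> = 16 * (\<Sum>a\<in>UNIV. \<Sum>b\<in>UNIV. \<Sum>c\<in>UNIV. \<Sum>e\<in>UNIV. \<Sum>j\<in>J. \<integral>\<^sup>+r. ?q a b c e j r \<partial>lborel)"
      unfolding sum_distrib_left[symmetric] by (simp only: UNIV_bool sum.insert finite.intros sum.empty insert_iff empty_iff simp_thms sum.distrib add_0_right)
    also have "\<dots> \<le> 16 * (\<Sum>a\<in>(UNIV::bool set). \<Sum>b\<in>(UNIV::bool set). \<Sum>c\<in>UNIV. \<Sum>e\<in>UNIV. ennreal (C c e * B))"
    proof (intro mult_left_mono sum_mono C J B(2))
      fix a b
      show "fourth (row_part a F) + fourth (col_part b G) \<le> ennreal B"
        using add_mono[OF fourth_row_col_part(1)[OF Fm, of a] fourth_row_col_part(2)[OF Gm, of b]] B(1) by (rule order_trans)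
      show "case_prod (row_part a F) \<in> borel_measurable (borel \<Otimes>\<^sub>M borel)"
        by (rule measurable_row_col_part(1)[OF Fm])
      show "case_prod (col_part b G) \<in> borel_measurable (borel \<Otimes>\<^sub>M borel)"
        by (rule measurable_row_col_part(2)[OF Gm])
    qed simp
    also have "\<dots> = ennreal (D * B)"
    proof -
      have nn: "0 \<le> C c e * B" for c e using C0 B(2) by simp
      have "D * B = 16 * (\<Sum>a\<in>(UNIV::bool set). \<Sum>b\<in>(UNIV::bool set). \<Sum>c\<in>UNIV. \<Sum>e\<in>UNIV. C c e * B)"
        by (simp only: D_def sum_distrib_right mult.assoc)
      also have "ennreal \<dots> = ennreal 16 * ennreal (\<Sum>a\<in>(UNIV::bool set). \<Sum>b\<in>(UNIV::bool set). \<Sum>c\<in>UNIV. \<Sum>e\<in>UNIV. C c e * B)"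
        by (rule ennreal_mult') simp
      also have "ennreal (\<Sum>a\<in>(UNIV::bool set). \<Sum>b\<in>(UNIV::bool set). \<Sum>c\<in>UNIV. \<Sum>e\<in>UNIV. C c e * B)
         = (\<Sum>a\<in>(UNIV::bool set). \<Sum>b\<in>(UNIV::bool set). \<Sum>c\<in>UNIV. \<Sum>e\<in>UNIV. ennreal (C c e * B))"
        using nn by (simp only: sum_ennreal[symmetric] sum_nonneg)
      finally show ?thesis by simp
    qed
    finally show "(\<Sum>j\<in>J. \<integral>\<^sup>+r. ennreal ((norm (S_term (\<lambda>s. \<phi> s - 2 * \<phi> (2 * s)) F G j r))\<^sup>2) \<partial>lborel) \<le> ennreal (D * B)" .
  qed
qed

section \<open>Summation over the scales\<close>

text \<open>Exhausting the integers by symmetric intervals turns the unordered sum into a monotone limit of finite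
  sums.  This gives measurability of the sum as a function of a parameter.\<close>

lemma infsum_int_eq_SUP:
  fixes a :: "int \<Rightarrow> real"
  assumes nn: "\<And>j. 0 \<le> a j" and X: "X = (SUP n::nat. ennreal (\<Sum>j\<in>{- int n..int n}. a j))" and fin: "X < \<infinity>"
  shows "a summable_on UNIV" "infsum a UNIV = enn2real X"
proof -
  have le: "sum a J \<le> enn2real X" if J: "finite J" for J
  proof -
    obtain n :: nat where n: "J \<subseteq> {- int n..int n}"
      using finite_int_subset_interval[OF J] by blast
    have "ennreal (sum a J) \<le> ennreal (\<Sum>j\<in>{- int n..int n}. a j)"
      by (intro ennreal_leI sum_mono2 n) (auto simp: nn)
    also have "\<dots> \<le> X"
      unfolding X by (rule SUP_upper) simp
    also have "X = ennreal (enn2real X)"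
      using fin by simp
    finally show ?thesis by (simp add: nn sum_nonneg)
  qed
  show s: "a summable_on UNIV"
    by (rule nonneg_bdd_above_summable_on) (auto simp: nn bdd_above_def intro: le)
  show "infsum a UNIV = enn2real X"
  proof (rule antisym)
    show "infsum a UNIV \<le> enn2real X"
      by (rule infsum_le_finite_sums[OF s]) (simp add: le)
    have "X \<le> ennreal (infsum a UNIV)"
      unfolding X by (intro SUP_least ennreal_leI finite_sum_le_infsum s) (auto simp: nn)
    then have "enn2real X \<le> enn2real (ennreal (infsum a UNIV))"
      by (rule enn2real_mono) simp
    then show "enn2real X \<le> infsum a UNIV"
      by (simp add: infsum_nonneg nn)
  qed
qed

lemma square_function_Borel:
  assumes \<phi>: "schwartz \<phi>"
  defines "\<psi> \<equiv> (\<lambda>s. \<phi> s - 2 * \<phi> (2 * s))"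
  obtains C where "0 \<le> C"
    "\<And>F G. F \<in> borel_measurable borel \<Longrightarrow> G \<in> borel_measurable borel \<Longrightarrow> quartic F < \<infinity> \<Longrightarrow> quartic G < \<infinity> \<Longrightarrow>
      (AE r in lborel. S_converges \<psi> F G r) \<and> S \<psi> F G \<in> borel_measurable lebesgue"
    "\<And>F G B. F \<in> borel_measurable borel \<Longrightarrow> G \<in> borel_measurable borel \<Longrightarrow> quartic F + quartic G \<le> ennreal B \<Longrightarrow> 0 \<le> B \<Longrightarrow>
      (\<integral>\<^sup>+r. ennreal ((S \<psi> F G r)\<^sup>2) \<partial>lborel) \<le> ennreal (C * B)"
proof -
  obtain C where C: "0 \<le> C" and est: "\<And>F G B J. F \<in> borel_measurable borel \<Longrightarrow> G \<in> borel_measurable borel \<Longrightarrow>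
      quartic F + quartic G \<le> ennreal B \<Longrightarrow> 0 \<le> B \<Longrightarrow> finite J \<Longrightarrow>
      (\<Sum>j\<in>J. \<integral>\<^sup>+r. ennreal ((norm (S_term \<psi> F G j r))\<^sup>2) \<partial>lborel) \<le> ennreal (C * B)"
    using S_term_square_sum_estimate[OF \<phi>] unfolding \<psi>_def by blast
  have [measurable]: "\<psi> \<in> borel_measurable borel"
  proof -
    have "continuous_on UNIV \<phi>"
      using \<phi> unfolding schwartz_def
      by (metis continuous_at_imp_continuous_on differentiable_imp_continuous_within funpow_0 iterated_deriv_def)
    then have [measurable]: "\<phi> \<in> borel_measurable borel"
      by (rule borel_measurable_continuous_onI)
    show ?thesis unfolding \<psi>_def by measurable
  qed
  have all: "(AE r in lborel. S_converges \<psi> F G r) \<and> S \<psi> F G \<in> borel_measurable lebesgue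
      \<and> (\<integral>\<^sup>+r. ennreal ((S \<psi> F G r)\<^sup>2) \<partial>lborel) \<le> ennreal (C * B)"
    if Fm [measurable]: "F \<in> borel_measurable borel" and Gm [measurable]: "G \<in> borel_measurable borel"
      and B: "quartic F + quartic G \<le> ennreal B" "0 \<le> B" for F G B
  proof -
    have fin: "quartic F < \<infinity>" "quartic G < \<infinity>"
      using le_less_trans[OF B(1) ennreal_less_top] by simp_all
    have tm: "S_term \<psi> F G j \<in> borel_measurable borel" for j
    proof -
      have "S_integrand \<psi> F G j r \<in> borel_measurable lborel" for r
        unfolding S_integrand_def case_prod_beta' by measurable
      then have "S_term \<psi> F G j = (\<lambda>r. \<integral>s. S_integrand \<psi> F G j r s \<partial>lborel)"
        unfolding S_term_def by (intro ext integral_completion) simp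
      also have "\<dots> \<in> borel_measurable borel"
        unfolding S_integrand_def case_prod_beta' by measurable
      finally show ?thesis .
    qed
    note [measurable] = tm
    define a where "a r j = (norm (S_term \<psi> F G j r))\<^sup>2" for r j
    define X where "X r = (SUP n::nat. ennreal (\<Sum>j\<in>{- int n..int n}. a r j))" for r
    have [measurable]: "X \<in> borel_measurable borel"
      unfolding X_def[abs_def] a_def by measurable
    have "(\<integral>\<^sup>+r. X r \<partial>lborel) = (SUP n::nat. \<integral>\<^sup>+r. ennreal (\<Sum>j\<in>{- int n..int n}. a r j) \<partial>lborel)"
      unfolding X_def
    proof (rule nn_integral_monotone_convergence_SUP)
      show "incseq (\<lambda>(n::nat) r. ennreal (\<Sum>j\<in>{- int n..int n}. a r j))"
        by (auto simp: incseq_def le_fun_def a_def intro!: ennreal_leI sum_mono2)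
      show "(\<lambda>r. ennreal (\<Sum>j\<in>{- int n..int n}. a r j)) \<in> borel_measurable lborel" for n :: nat
        unfolding a_def by measurable
    qed
    also have "\<dots> \<le> ennreal (C * B)"
    proof (rule SUP_least)
      fix n :: nat
      have "(\<integral>\<^sup>+r. ennreal (\<Sum>j\<in>{- int n..int n}. a r j) \<partial>lborel) = (\<integral>\<^sup>+r. (\<Sum>j\<in>{- int n..int n}. ennreal (a r j)) \<partial>lborel)"
        by (simp add: a_def)
      also have "\<dots> = (\<Sum>j\<in>{- int n..int n}. \<integral>\<^sup>+r. ennreal (a r j) \<partial>lborel)"
        by (rule nn_integral_sum) (unfold a_def, measurable)
      also have "\<dots> \<le> ennreal (C * B)"
        unfolding a_def by (rule est[OF Fm Gm B]) simp
      finally show "(\<integral>\<^sup>+r. ennreal (\<Sum>j\<in>{- int n..int n}. a r j) \<partial>lborel) \<le> ennreal (C * B)" .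
    qed
    finally have XB: "(\<integral>\<^sup>+r. X r \<partial>lborel) \<le> ennreal (C * B)" .
    have Xfin: "AE r in lborel. X r \<noteq> \<infinity>"
      by (rule nn_integral_PInf_AE) (use le_less_trans[OF XB ennreal_less_top] in \<open>auto simp: less_top\<close>)
    have sum: "a r summable_on UNIV \<and> S \<psi> F G r = sqrt (enn2real (X r))" if "X r \<noteq> \<infinity>" for r
    proof -
      have "X r < \<infinity>" using that by (simp add: less_top)
      note s = infsum_int_eq_SUP[of "a r", OF _ X_def this]
      show ?thesis
        using s by (simp add: S_def a_def[abs_def])
    qed
    have "AE r in lborel. S_converges \<psi> F G r"
      using Xfin S_term_decomposition[OF \<phi> Fm Gm fin]
    proof eventually_elim
      case (elim r)
      then show ?case
        using sum[OF elim(1)] unfolding S_converges_def \<psi>_def[symmetric] by (simp add: a_def[abs_def])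
    qed
    moreover have "S \<psi> F G \<in> borel_measurable lebesgue"
    proof (rule borel_measurable_AE)
      show "(\<lambda>r. sqrt (enn2real (X r))) \<in> borel_measurable lebesgue"
        by (rule measurable_completion) measurable
      have "AE r in lborel. sqrt (enn2real (X r)) = S \<psi> F G r"
        using Xfin by eventually_elim (simp add: sum)
      then show "AE r in lebesgue. sqrt (enn2real (X r)) = S \<psi> F G r"
        by (rule AE_completion)
    qed
    moreover have "(\<integral>\<^sup>+r. ennreal ((S \<psi> F G r)\<^sup>2) \<partial>lborel) = (\<integral>\<^sup>+r. X r \<partial>lborel)"
    proof (rule nn_integral_cong_AE)
      show "AE r in lborel. ennreal ((S \<psi> F G r)\<^sup>2) = X r"
        using Xfin by eventually_elim (simp add: sum less_top)
    qed
    ultimately show ?thesis using XB by simp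
  qed
  show ?thesis
  proof (rule that[OF C])
    fix F G :: "real \<times> real \<Rightarrow> complex"
    assume m: "F \<in> borel_measurable borel" "G \<in> borel_measurable borel" and f: "quartic F < \<infinity>" "quartic G < \<infinity>"
    have "quartic F + quartic G \<le> ennreal (enn2real (quartic F + quartic G))"
      using f by simp
    from all[OF m this] show "(AE r in lborel. S_converges \<psi> F G r) \<and> S \<psi> F G \<in> borel_measurable lebesgue"
      by simp
  qed (use all in blast)
qed

section \<open>Lebesgue measurable functions\<close>

lemma Borel_representative:
  fixes F :: "real \<times> real \<Rightarrow> complex"
  assumes [measurable]: "F \<in> borel_measurable lebesgue"
  obtains F0 where "F0 \<in> borel_measurable borel" "AE p in lborel. F p = F0 p"
proof -
  have "(\<lambda>p. Re (F p)) \<in> borel_measurable lebesgue" "(\<lambda>p. Im (F p)) \<in> borel_measurable lebesgue"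
    by measurable
  from this[THEN completion_ex_borel_measurable_real]
  obtain R I where [measurable]: "R \<in> borel_measurable lborel" "I \<in> borel_measurable lborel"
    and ae: "AE p in lborel. Re (F p) = R p" "AE p in lborel. Im (F p) = I p"
    by blast
  show ?thesis
  proof (rule that)
    have [measurable]: "R \<in> borel_measurable borel" "I \<in> borel_measurable borel"
      using \<open>R \<in> borel_measurable lborel\<close> \<open>I \<in> borel_measurable lborel\<close> by simp_all
    show "(\<lambda>p. of_real (R p) + \<i> * of_real (I p)) \<in> borel_measurable borel"
      by measurable
    show "AE p in lborel. F p = of_real (R p) + \<i> * of_real (I p)"
      using ae by eventually_elim (simp add: complex_eq_iff)
  qed
qed

text \<open>A null set of the plane, translated along an axis by any fixed amount, is null; by Tonelli's theorem almost every
  point sees it only in a null set of its horizontal and vertical line.\<close>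

lemma AE_line_sections:
  fixes P :: "real \<times> real \<Rightarrow> bool"
  assumes "AE p in lborel. P p"
  shows "AE r in lborel. AE s in lborel. P (fst r + s, snd r)"
    and "AE r in lborel. AE s in lborel. P (fst r, snd r + s)"
proof -
  obtain N where N: "{p. \<not> P p} \<subseteq> N" "emeasure lborel N = 0" "N \<in> sets borel"
    using AE_E[OF assms] by auto
  let ?h = "indicator N :: real \<times> real \<Rightarrow> ennreal"
  have [measurable]: "?h \<in> borel_measurable borel" using N(3) by measurable
  have 0: "(\<integral>\<^sup>+p. ?h p \<partial>lborel) = 0" using N by simp
  have sh: "(\<integral>\<^sup>+x. k (x + s) \<partial>lborel) = (\<integral>\<^sup>+x. k x \<partial>lborel)" if "k \<in> borel_measurable borel" for k :: "real \<Rightarrow> ennreal" and s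
    using nn_integral_real_affine[OF that, of 1 s] by (simp add: add.commute)
  have conc: "AE r in lborel. AE s in lborel. P (T r s)"
    if [measurable]: "(\<lambda>x. T (fst x) (snd x)) \<in> borel_measurable borel"
      and z: "\<And>s. (\<integral>\<^sup>+r. ?h (T r s) \<partial>lborel) = 0" for T :: "real \<times> real \<Rightarrow> real \<Rightarrow> real \<times> real"
  proof -
    have m: "(\<lambda>x. ?h (T (fst x) (snd x))) \<in> borel_measurable borel"
      using measurable_compose[OF that(1), of ?h] by simp
    have "(\<integral>\<^sup>+r. \<integral>\<^sup>+s. ?h (T r s) \<partial>lborel \<partial>lborel) = (\<integral>\<^sup>+s. \<integral>\<^sup>+r. ?h (T r s) \<partial>lborel \<partial>lborel)"
      by (rule nn_integral_lborel_swap) (use m in \<open>simp add: case_prod_beta'\<close>)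
    then have *: "(\<integral>\<^sup>+r. \<integral>\<^sup>+s. ?h (T r s) \<partial>lborel \<partial>lborel) = 0" by (simp add: z)
    have m': "(\<lambda>(r, s). ?h (T r s)) \<in> borel_measurable (borel \<Otimes>\<^sub>M borel)"
      using m by (simp add: case_prod_beta' borel_prod)
    have "(\<lambda>r. \<integral>\<^sup>+s. ?h (T r s) \<partial>lborel) \<in> borel_measurable lborel"
      using lborel.borel_measurable_nn_integral[of "\<lambda>r s. ?h (T r s)" lborel] m' by simp
    from nn_integral_0_iff_AE[OF this] * have "AE r in lborel. (\<integral>\<^sup>+s. ?h (T r s) \<partial>lborel) = 0"
      by simp
    then show ?thesis
    proof eventually_elim
      case (elim r)
      have "(\<lambda>s. ?h (T r s)) \<in> borel_measurable lborel"
        using measurable_Pair2[OF m', of r] by simp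
      from nn_integral_0_iff_AE[OF this] elim have "AE s in lborel. ?h (T r s) = 0" by simp
      then show ?case
        by eventually_elim (use N(1) in \<open>auto simp: indicator_eq_0_iff\<close>)
    qed
  qed
  show "AE r in lborel. AE s in lborel. P (fst r + s, snd r)"
  proof (rule conc)
    fix s
    have m: "(\<lambda>r. ?h (fst r + s, snd r)) \<in> borel_measurable borel" by measurable
    have "(\<integral>\<^sup>+r. ?h (fst r + s, snd r) \<partial>lborel) = (\<integral>\<^sup>+y. \<integral>\<^sup>+x. ?h (x + s, y) \<partial>lborel \<partial>lborel)"
      unfolding nn_integral_lborel_snd[OF m, symmetric] by simp
    also have "\<dots> = (\<integral>\<^sup>+y. \<integral>\<^sup>+x. ?h (x, y) \<partial>lborel \<partial>lborel)"
      by (intro nn_integral_cong sh[of "\<lambda>x. ?h (x, _)"]) measurable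
    also have "\<dots> = 0"
      using 0 nn_integral_lborel_snd[of ?h] by simp
    finally show "(\<integral>\<^sup>+r. ?h (fst r + s, snd r) \<partial>lborel) = 0" .
  qed measurable
  show "AE r in lborel. AE s in lborel. P (fst r, snd r + s)"
  proof (rule conc)
    fix s
    have m: "(\<lambda>r. ?h (fst r, snd r + s)) \<in> borel_measurable borel" by measurable
    have "(\<integral>\<^sup>+r. ?h (fst r, snd r + s) \<partial>lborel) = (\<integral>\<^sup>+x. \<integral>\<^sup>+y. ?h (x, y + s) \<partial>lborel \<partial>lborel)"
      unfolding nn_integral_lborel_fst[OF m, symmetric] by simp
    also have "\<dots> = (\<integral>\<^sup>+x. \<integral>\<^sup>+y. ?h (x, y) \<partial>lborel \<partial>lborel)"
      by (intro nn_integral_cong sh[of "\<lambda>y. ?h (_, y)"]) measurable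
    also have "\<dots> = 0"
      using 0 nn_integral_lborel_fst[of ?h] by simp
    finally show "(\<integral>\<^sup>+r. ?h (fst r, snd r + s) \<partial>lborel) = 0" .
  qed measurable
qed

lemma square_function_AE_cong:
  assumes [measurable]: "\<psi> \<in> borel_measurable borel" "F0 \<in> borel_measurable borel" "G0 \<in> borel_measurable borel"
    and F: "AE p in lborel. F p = F0 p" and G: "AE p in lborel. G p = G0 p"
  shows "AE r in lborel. (S_converges \<psi> F G r \<longleftrightarrow> S_converges \<psi> F0 G0 r) \<and> S \<psi> F G r = S \<psi> F0 G0 r"
  using AE_line_sections(1)[OF F] AE_line_sections(2)[OF G]
proof eventually_elim
  case (elim r)
  have eq: "AE s in lebesgue. S_integrand \<psi> F0 G0 j r s = S_integrand \<psi> F G j r s" for j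
  proof (rule AE_completion)
    show "AE s in lborel. S_integrand \<psi> F0 G0 j r s = S_integrand \<psi> F G j r s"
      using elim by eventually_elim (simp add: S_integrand_def case_prod_beta')
  qed
  have m0: "S_integrand \<psi> F0 G0 j r \<in> borel_measurable lebesgue" for j
    unfolding S_integrand_def case_prod_beta' by (rule measurable_completion) measurable
  have m: "S_integrand \<psi> F G j r \<in> borel_measurable lebesgue" for j
    by (rule borel_measurable_AE[OF m0 eq])
  have "integrable lebesgue (S_integrand \<psi> F0 G0 j r) \<longleftrightarrow> integrable lebesgue (S_integrand \<psi> F G j r)" for j
    by (rule integrable_cong_AE[OF m0 m eq])
  moreover have "S_term \<psi> F0 G0 j r = S_term \<psi> F G j r" for j
    unfolding S_term_def by (rule integral_cong_AE[OF m0 m eq])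
  ultimately show ?case
    by (simp add: S_converges_def S_def)
qed

section \<open>Scaling and the final estimate\<close>

text \<open>The optimal weight is \<open>\<mu> = sqrt (B/A)\<close>.  Adding a small \<open>e\<close> to both constants avoids the degenerate cases.\<close>

lemma le_geometric_mean_of_weighted_sums:
  fixes T A B C :: real
  assumes le: "\<And>\<mu>. 0 < \<mu> \<Longrightarrow> T \<le> C * (\<mu> * A + B / \<mu>)" and C: "0 \<le> C" and AB: "0 \<le> A" "0 \<le> B"
  shows "T \<le> 2 * C * sqrt (A * B)"
proof -
  have pos: "T \<le> 2 * C * sqrt ((A + e) * (B + e))" if e: "0 < e" for e
  proof -
    let ?a = "A + e" and ?b = "B + e"
    have ab: "0 < ?a" "0 < ?b" using AB e by auto
    define \<mu> where "\<mu> = sqrt ?b / sqrt ?a"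
    have \<mu>: "0 < \<mu>" using ab by (simp add: \<mu>_def)
    have "T \<le> C * (\<mu> * A + B / \<mu>)" by (rule le[OF \<mu>])
    also have "\<dots> \<le> C * (\<mu> * ?a + ?b / \<mu>)"
      using e \<mu> C by (intro mult_left_mono add_mono divide_right_mono) auto
    also have "\<mu> * ?a + ?b / \<mu> = sqrt (?a * ?b) + sqrt (?a * ?b)"
    proof -
      have "y / x * (x * x) = x * y" "(y * y) / (y / x) = x * y" if "0 < x" "0 < y" for x y :: real
        using that by simp_all
      from this[of "sqrt ?a" "sqrt ?b"] have "\<mu> * ?a = sqrt (?a * ?b)" "?b / \<mu> = sqrt (?a * ?b)"
        using ab by (simp_all only: \<mu>_def real_sqrt_mult real_sqrt_gt_zero abs_of_pos real_sqrt_mult_self)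
      then show ?thesis by simp
    qed
    finally show ?thesis by simp
  qed
  have "((\<lambda>e. 2 * C * sqrt ((A + e) * (B + e))) \<longlongrightarrow> 2 * C * sqrt ((A + 0) * (B + 0))) (at_right 0)"
    by (intro tendsto_intros)
  then have "T \<le> 2 * C * sqrt ((A + 0) * (B + 0))"
    by (rule tendsto_lowerbound) (auto simp: eventually_at_right_field intro!: pos exI[of _ 1])
  then show ?thesis by simp
qed

lemma norm_powr_4: "norm z powr 4 = norm z ^ 4"
  by (cases "norm z = 0") (auto simp: powr_numeral)

lemma quartic_cong:
  assumes "AE p in lborel. F p = F0 p" "F \<in> Lp_space 4 lebesgue"
  shows "quartic F0 = ennreal (LINT p|lebesgue. norm (F p) powr 4)"
proof -
  have i: "integrable lebesgue (\<lambda>p. norm (F p) powr 4)"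
    using assms(2) by (simp add: Lp_space_def)
  have "quartic F0 = (\<integral>\<^sup>+p. ennreal (norm (F p) powr 4) \<partial>lborel)"
    unfolding quartic_def norm_powr_4 by (rule nn_integral_cong_AE) (use assms(1) in eventually_elim, simp)
  also have "\<dots> = (\<integral>\<^sup>+p. ennreal (norm (F p) powr 4) \<partial>lebesgue)"
    by (rule nn_integral_completion[symmetric])
  also have "\<dots> = ennreal (LINT p|lebesgue. norm (F p) powr 4)"
    by (rule nn_integral_eq_integral[OF i]) simp
  finally show ?thesis .
qed

lemma quartic_scale: "quartic (\<lambda>p. of_real c * F p) = ennreal (c ^ 4) * quartic F" if "F \<in> borel_measurable borel"
proof -
  have "quartic (\<lambda>p. of_real c * F p) = (\<integral>\<^sup>+p. ennreal (c ^ 4) * ennreal (norm (F p) ^ 4) \<partial>lborel)"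
    unfolding quartic_def by (rule nn_integral_cong) (simp add: norm_mult power_mult_distrib ennreal_mult)
  also have "\<dots> = ennreal (c ^ 4) * quartic F"
    unfolding quartic_def by (rule nn_integral_cmult) (use that in measurable)
  finally show ?thesis .
qed

lemma S_scale:
  assumes "c \<noteq> 0"
  shows "S \<psi> (\<lambda>p. of_real c * F p) (\<lambda>p. of_real (1 / c) * G p) = S \<psi> F G"
proof -
  have "S_integrand \<psi> (\<lambda>p. of_real c * F p) (\<lambda>p. of_real (1 / c) * G p) j r = S_integrand \<psi> F G j r" for j r
    using assms by (simp add: S_integrand_def case_prod_beta' fun_eq_iff)
  then have "S_term \<psi> (\<lambda>p. of_real c * F p) (\<lambda>p. of_real (1 / c) * G p) = S_term \<psi> F G"
    by (simp add: S_term_def fun_eq_iff)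
  then show ?thesis
    by (simp add: S_def fun_eq_iff)
qed

lemma square_function_bounded:
  assumes \<phi>: "schwartz \<phi>" and \<psi>: "\<psi> = (\<lambda>s. \<phi> s - 2 * \<phi> (2 * s))"
  shows "\<exists>c. \<forall>F G. F \<in> Lp_space 4 lebesgue \<and> G \<in> Lp_space 4 lebesgue \<longrightarrow>
    (AE z in lebesgue. S_converges \<psi> F G z) \<and> S \<psi> F G \<in> Lp_space 2 lebesgue \<and>
    Lp_norm 2 lebesgue (S \<psi> F G) \<le> c * Lp_norm 4 lebesgue F * Lp_norm 4 lebesgue G"
proof -
  obtain C where C: "0 \<le> C"
    and conv: "\<And>F G. F \<in> borel_measurable borel \<Longrightarrow> G \<in> borel_measurable borel \<Longrightarrow> quartic F < \<infinity> \<Longrightarrow> quartic G < \<infinity> \<Longrightarrow>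
      (AE r in lborel. S_converges \<psi> F G r) \<and> S \<psi> F G \<in> borel_measurable lebesgue"
    and est: "\<And>F G B. F \<in> borel_measurable borel \<Longrightarrow> G \<in> borel_measurable borel \<Longrightarrow> quartic F + quartic G \<le> ennreal B \<Longrightarrow> 0 \<le> B \<Longrightarrow>
      (\<integral>\<^sup>+r. ennreal ((S \<psi> F G r)\<^sup>2) \<partial>lborel) \<le> ennreal (C * B)"
    using square_function_Borel[OF \<phi>] unfolding \<psi> by blast
  have \<psi>m: "\<psi> \<in> borel_measurable borel"
  proof -
    have "continuous_on UNIV \<phi>"
      using \<phi> unfolding schwartz_def
      by (metis continuous_at_imp_continuous_on differentiable_imp_continuous_within funpow_0 iterated_deriv_def)
    then have [measurable]: "\<phi> \<in> borel_measurable borel"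
      by (rule borel_measurable_continuous_onI)
    show ?thesis unfolding \<psi> by measurable
  qed
  show ?thesis
  proof (intro exI[of _ "sqrt (2 * C)"] allI impI, elim conjE)
    fix F G :: "real \<times> real \<Rightarrow> complex"
    assume F: "F \<in> Lp_space 4 lebesgue" and G: "G \<in> Lp_space 4 lebesgue"
    obtain F0 where F0 [measurable]: "F0 \<in> borel_measurable borel" and FF: "AE p in lborel. F p = F0 p"
      using F Borel_representative[of F] by (auto simp: Lp_space_def)
    obtain G0 where G0 [measurable]: "G0 \<in> borel_measurable borel" and GG: "AE p in lborel. G p = G0 p"
      using G Borel_representative[of G] by (auto simp: Lp_space_def)
    define A where "A = (LINT p|lebesgue. norm (F p) powr 4)"
    define B where "B = (LINT p|lebesgue. norm (G p) powr 4)"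
    have AB: "0 \<le> A" "0 \<le> B" by (simp_all add: A_def B_def)
    have qF: "quartic F0 = ennreal A" and qG: "quartic G0 = ennreal B"
      using quartic_cong[OF FF F] quartic_cong[OF GG G] by (simp_all add: A_def B_def)
    have c0: "AE r in lborel. S_converges \<psi> F0 G0 r" and m0: "S \<psi> F0 G0 \<in> borel_measurable lebesgue"
      using conv[OF F0 G0] qF qG by simp_all
    note cong = square_function_AE_cong[OF \<psi>m F0 G0 FF GG]
    have converges: "AE z in lebesgue. S_converges \<psi> F G z"
      by (rule AE_completion) (use c0 cong in eventually_elim, simp)
    have m: "S \<psi> F G \<in> borel_measurable lebesgue"
    proof (rule borel_measurable_AE[OF m0])
      show "AE r in lebesgue. S \<psi> F0 G0 r = S \<psi> F G r"
        by (rule AE_completion) (use cong in eventually_elim, simp)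
    qed
    let ?T = "\<integral>\<^sup>+r. ennreal ((S \<psi> F G r)\<^sup>2) \<partial>lebesgue"
    have T: "?T = (\<integral>\<^sup>+r. ennreal ((S \<psi> F0 G0 r)\<^sup>2) \<partial>lborel)"
      unfolding nn_integral_completion by (rule nn_integral_cong_AE) (use cong in eventually_elim, simp)
    have Tle: "?T \<le> ennreal (C * (\<mu> * A + B / \<mu>))" if \<mu>: "0 < \<mu>" for \<mu>
    proof -
      define c where "c = root 4 \<mu>"
      have c: "0 < c" "c ^ 4 = \<mu>" using \<mu> by (simp_all add: c_def real_root_pow_pos2)
      have "(\<integral>\<^sup>+r. ennreal ((S \<psi> (\<lambda>p. of_real c * F0 p) (\<lambda>p. of_real (1 / c) * G0 p) r)\<^sup>2) \<partial>lborel)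
        \<le> ennreal (C * (\<mu> * A + B / \<mu>))"
      proof (rule est)
        have "quartic (\<lambda>p. of_real c * F0 p) + quartic (\<lambda>p. of_real (1 / c) * G0 p) = ennreal (c ^ 4) * ennreal A + ennreal ((1 / c) ^ 4) * ennreal B"
          by (simp only: quartic_scale[OF F0] quartic_scale[OF G0] qF qG)
        also have "\<dots> = ennreal (\<mu> * A + B / \<mu>)"
          using AB \<mu> by (simp add: c(2) power_divide ennreal_mult'[symmetric] ennreal_plus[symmetric] del: ennreal_plus)
        finally show "quartic (\<lambda>p. of_real c * F0 p) + quartic (\<lambda>p. of_real (1 / c) * G0 p) \<le> ennreal (\<mu> * A + B / \<mu>)"
          by simp
      qed (use AB \<mu> in \<open>measurable, simp\<close>)
      then show ?thesis
        unfolding T using S_scale[of c \<psi> F0 G0] c(1) by simp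
    qed
    have i: "integrable lebesgue (\<lambda>r. (S \<psi> F G r)\<^sup>2)"
    proof (rule integrableI_bounded)
      show "(\<lambda>r. (S \<psi> F G r)\<^sup>2) \<in> borel_measurable lebesgue" using m by measurable
      show "(\<integral>\<^sup>+r. ennreal (norm ((S \<psi> F G r)\<^sup>2)) \<partial>lebesgue) < \<infinity>"
        using le_less_trans[OF Tle[of 1] ennreal_less_top] by simp
    qed
    have p2: "norm (S \<psi> F G r) powr 2 = (S \<psi> F G r)\<^sup>2" for r
      by (cases "S \<psi> F G r = 0") (auto simp: powr_numeral)
    have "(LINT r|lebesgue. (S \<psi> F G r)\<^sup>2) \<le> 2 * C * sqrt (A * B)"
    proof (rule le_geometric_mean_of_weighted_sums[OF _ C AB])
      fix \<mu> :: real assume \<mu>: "0 < \<mu>"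
      have "ennreal (LINT r|lebesgue. (S \<psi> F G r)\<^sup>2) = ?T"
        by (rule nn_integral_eq_integral[symmetric, OF i]) simp
      with Tle[OF \<mu>] have "ennreal (LINT r|lebesgue. (S \<psi> F G r)\<^sup>2) \<le> ennreal (C * (\<mu> * A + B / \<mu>))" by simp
      then show "(LINT r|lebesgue. (S \<psi> F G r)\<^sup>2) \<le> C * (\<mu> * A + B / \<mu>)"
        using AB C \<mu> by (subst (asm) ennreal_le_iff) auto
    qed
    then have "(LINT r|lebesgue. norm (S \<psi> F G r) powr 2) powr (1 / 2) \<le> (2 * C * sqrt (A * B)) powr (1 / 2)"
      unfolding p2 by (intro powr_mono2) auto
    also have "\<dots> = sqrt (2 * C) * A powr (1 / 4) * B powr (1 / 4)"
    proof -
      have "sqrt x powr (1 / 2) = x powr (1 / 4)" if "0 \<le> x" for x :: real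
        using that by (simp add: powr_half_sqrt[symmetric] powr_powr)
      then show ?thesis
        using C AB by (simp add: powr_mult real_sqrt_mult powr_half_sqrt[symmetric])
    qed
    finally have "Lp_norm 2 lebesgue (S \<psi> F G) \<le> sqrt (2 * C) * Lp_norm 4 lebesgue F * Lp_norm 4 lebesgue G"
      by (simp add: Lp_norm_def A_def B_def)
    moreover have "S \<psi> F G \<in> Lp_space 2 lebesgue"
      unfolding Lp_space_def p2[symmetric] using m i by (simp add: p2)
    ultimately show "(AE z in lebesgue. S_converges \<psi> F G z) \<and> S \<psi> F G \<in> Lp_space 2 lebesgue \<and>
      Lp_norm 2 lebesgue (S \<psi> F G) \<le> sqrt (2 * C) * Lp_norm 4 lebesgue F * Lp_norm 4 lebesgue G"
      using converges by blast
  qed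
qed

theorem corollary5:
  "\<exists>C :: (real \<Rightarrow> complex) \<Rightarrow> real.
     \<forall>\<phi> \<psi>. schwartz \<phi> \<and> \<psi> = (\<lambda>s. \<phi> s - 2 * \<phi> (2 * s)) \<longrightarrow>
       (\<forall>F G. F \<in> Lp_space 4 lebesgue \<and> G \<in> Lp_space 4 lebesgue \<longrightarrow>
          (AE z in lebesgue. S_converges \<psi> F G z) \<and>
          S \<psi> F G \<in> Lp_space 2 lebesgue \<and>
          Lp_norm 2 lebesgue (S \<psi> F G)
            \<le> C \<psi> * Lp_norm 4 lebesgue F * Lp_norm 4 lebesgue G)"
proof -
  let ?bounded = "\<lambda>\<psi> c. \<forall>F G. F \<in> Lp_space 4 lebesgue \<and> G \<in> Lp_space 4 lebesgue \<longrightarrow>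
    (AE z in lebesgue. S_converges \<psi> F G z) \<and> S \<psi> F G \<in> Lp_space 2 lebesgue \<and>
    Lp_norm 2 lebesgue (S \<psi> F G) \<le> c * Lp_norm 4 lebesgue F * Lp_norm 4 lebesgue G"
  have "?bounded \<psi> (SOME c. ?bounded \<psi> c)" if "schwartz \<phi>" "\<psi> = (\<lambda>s. \<phi> s - 2 * \<phi> (2 * s))" for \<phi> \<psi>
    by (rule someI_ex) (rule square_function_bounded[OF that])
  then show ?thesis
    by (intro exI[of _ "\<lambda>\<psi>. SOME c. ?bounded \<psi> c"]) blast
qed

end
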